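(* Let $\zeta_{1},\zeta_{2}$ be two aperiodic primitive constant-shape substitutions (in dimension $d\geq 1$) with the same expansion matrix. Then there exists a computable constant $R$ (i.e. $R$ can be computed by an algorithm from $\zeta_1,\zeta_2$) such that every factor map from $(X_{\zeta_{1}},S,\mathbb{Z}^{d})$ to $(X_{\zeta_{2}},S,\mathbb{Z}^{d})$ is the composition of a shift map $S^{j}$, $j\in\mathbb{Z}^d$, with a factor map from $(X_{\zeta_{1}},S,\mathbb{Z}^{d})$ to $(X_{\zeta_{2}},S,\mathbb{Z}^{d})$ of radius less than $R$.
   Context: Fix $d\ge 1$; $\|\cdot\|$ is the Euclidean norm on $\mathbb{R}^d$ and $B(0,r)$ the Euclidean ball. An integer $d\times d$ matrix $L$ is an expansion matrix if there is $\lambda>1$ with $\|Lx\|>\lambda\|x\|$ for all $x\in\mathbb{R}^d\setminus\{0\}$. A fundamental domain of $L(\mathbb{Z}^d)$ in $\mathbb{Z}^d$ is a set containing exactly one representative of each class of $\mathbb{Z}^d/L(\mathbb{Z}^d)$; it is always taken to contain $0$. For a finite alphabet $\mathcal A$, $\mathcal A^{\mathbb{Z}^d}$ has the product topology and $\mathbb{Z}^d$ acts by $S^{n}(x)_{k}=x_{n+k}$. A subshift is a closed $S$-invariant subset. A pattern is an element of $\mathcal A^P$ with $P\subset\mathbb{Z}^d$ finite; it occurs in $x$ (or in a larger pattern) if it equals, up to translation of its support, a restriction of it. A factor map $\phi:X\to Y$ between subshifts is a continuous surjective map commuting with all $S^n$; by Curtis–Hedlund–Lyndon it is given by a block map: $\phi(x)_n=\Phi(x|_{n+P})$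 for some finite $P$ (the support of $\Phi$). The radius of $\phi$ is the infimum of the $r\in\mathbb{N}$ such that $\phi$ is induced by a block map with support $B(0,r)\cap\mathbb{Z}^d$. A constant-shape substitution with expansion matrix $L$ and support $F_1$ (a fundamental domain of $L(\mathbb{Z}^d)$ in $\mathbb{Z}^d$) is a map $\zeta:\mathcal A\to\mathcal A^{F_1}$. Put $F_{n+1}=L(F_n)+F_1$; the iterates $\zeta^n:\mathcal A\to\mathcal A^{F_n}$ are defined by $\zeta^1=\zeta$ and $\zeta^{n+1}(a)_{L(j)+f}=\zeta(\zeta^n(a)_j)_f$ for $j\in F_n$, $f\in F_1$. $X_\zeta\subseteq \mathcal A^{\mathbb{Z}^d}$ is the set of all $x$ such that every pattern occurring in $x$ occurs in $\zeta^n(a)$ for some $n>0$, $a\in\mathcal A$. $\zeta$ is primitive if there is $n>0$ such that for all $a,b\in\mathcal A$, $b$ occurs in $\zeta^n(a)$. $\zeta$ is aperiodic if $S^px=x$ with $x\in X_\zeta$, $p\in\mathbb{Z}^d$, implies $p=0$. Standing assumption: for every substitution considered, the sequence of supports $(F_n)_{n>0}$ is Følner, i.e. $|F_n\Delta(m+F_n)|/|F_n|\to0$ for every $m\in\mathbb{Z}^d$. *)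

theory Defs
  imports
    "Jordan_Normal_Form.Determinant"
    "HOL-Analysis.Function_Topology"
    "HOL-Library.Nat_Bijection"
begin

section \<open>Expansion matrices and fundamental domains\<close>

text \<open>The group \<open>\<int>\<^sup>d\<close> is the carrier set of integer vectors of dimension \<open>d\<close>.\<close>

abbreviation Zd :: "nat \<Rightarrow> int Matrix.vec set" where
  "Zd d \<equiv> carrier_vec d"

definition enorm :: "real Matrix.vec \<Rightarrow> real" where
  "enorm x = sqrt (x \<bullet> x)"

definition expansion_matrix :: "nat \<Rightarrow> int mat \<Rightarrow> bool" where
  "expansion_matrix d L \<longleftrightarrow> L \<in> carrier_mat d d \<and>
     (\<exists>l>1. \<forall>x \<in> carrier_vec d - {0\<^sub>v d}. enorm (map_mat real_of_int L *\<^sub>v x) > l * enorm x)"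

definition fundamental_domain :: "nat \<Rightarrow> int mat \<Rightarrow> int Matrix.vec set \<Rightarrow> bool" where
  "fundamental_domain d L F \<longleftrightarrow> F \<subseteq> Zd d \<and> 0\<^sub>v d \<in> F \<and>
     (\<forall>n \<in> Zd d. \<exists>!f. f \<in> F \<and> (\<exists>m \<in> Zd d. n - f = L *\<^sub>v m))"


section \<open>Configurations, patterns and factor maps\<close>

text \<open>Elements of \<open>A\<^bsup>P\<^esup>\<close> (configurations if \<open>P\<close> is all of \<open>Zd d\<close>) are extensional functions, so that
  equality of functions is equality of configurations.\<close>

definition shift :: "nat \<Rightarrow> int Matrix.vec \<Rightarrow> (int Matrix.vec \<Rightarrow> nat) \<Rightarrow> (int Matrix.vec \<Rightarrow> nat)" where
  "shift d n x = (\<lambda>k \<in> Zd d. x (n + k))"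

text \<open>The pattern \<open>p\<close> with support \<open>P\<close> occurs in \<open>q\<close>, which has support \<open>Q\<close>. The support \<open>Q\<close> may be
  finite or all of \<open>Zd d\<close>.\<close>

definition occurs_in ::
  "nat \<Rightarrow> int Matrix.vec set \<Rightarrow> (int Matrix.vec \<Rightarrow> nat) \<Rightarrow> int Matrix.vec set \<Rightarrow> (int Matrix.vec \<Rightarrow> nat) \<Rightarrow> bool" where
  "occurs_in d P p Q q \<longleftrightarrow> (\<exists>t \<in> Zd d. \<forall>k \<in> P. t + k \<in> Q \<and> q (t + k) = p k)"

definition config_topology :: "nat \<Rightarrow> nat set \<Rightarrow> (int Matrix.vec \<Rightarrow> nat) topology" where
  "config_topology d A = product_topology (\<lambda>_. discrete_topology A) (Zd d)"

definition factor_map ::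
  "nat \<Rightarrow> nat set \<Rightarrow> (int Matrix.vec \<Rightarrow> nat) set \<Rightarrow> nat set \<Rightarrow> (int Matrix.vec \<Rightarrow> nat) set \<Rightarrow>
   ((int Matrix.vec \<Rightarrow> nat) \<Rightarrow> (int Matrix.vec \<Rightarrow> nat)) \<Rightarrow> bool" where
  "factor_map d A X B Y \<phi> \<longleftrightarrow>
     continuous_map (subtopology (config_topology d A) X) (subtopology (config_topology d B) Y) \<phi> \<and>
     \<phi> ` X = Y \<and>
     (\<forall>n \<in> Zd d. \<forall>x \<in> X. \<phi> (shift d n x) = shift d n (\<phi> x))"

definition induced_by ::
  "nat \<Rightarrow> nat set \<Rightarrow> (int Matrix.vec \<Rightarrow> nat) set \<Rightarrow> nat set \<Rightarrow> ((int Matrix.vec \<Rightarrow> nat) \<Rightarrow> (int Matrix.vec \<Rightarrow> nat)) \<Rightarrow>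
   int Matrix.vec set \<Rightarrow> ((int Matrix.vec \<Rightarrow> nat) \<Rightarrow> nat) \<Rightarrow> bool" where
  "induced_by d A X B \<phi> P \<Phi> \<longleftrightarrow> \<Phi> \<in> (P \<rightarrow>\<^sub>E A) \<rightarrow> B \<and>
     (\<forall>x \<in> X. \<forall>n \<in> Zd d. \<phi> x n = \<Phi> (\<lambda>k \<in> P. x (n + k)))"

definition lattice_ball :: "nat \<Rightarrow> nat \<Rightarrow> int Matrix.vec set" where
  "lattice_ball d r = {k \<in> Zd d. enorm (map_vec real_of_int k) \<le> real r}"

text \<open>By the Curtis--Hedlund--Lyndon theorem the infimum is over a nonempty set whenever \<open>\<phi>\<close> is a factor
  map between subshifts.\<close>

definition radius ::
  "nat \<Rightarrow> nat set \<Rightarrow> (int Matrix.vec \<Rightarrow> nat) set \<Rightarrow> nat set \<Rightarrow> ((int Matrix.vec \<Rightarrow> nat) \<Rightarrow> (int Matrix.vec \<Rightarrow> nat)) \<Rightarrow> nat" where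
  "radius d A X B \<phi> = Inf {r. \<exists>\<Phi>. induced_by d A X B \<phi> (lattice_ball d r) \<Phi>}"


section \<open>Constant-shape substitutions\<close>

text \<open>Letters are natural numbers, so that a substitution is a finite object that can be given to an
  algorithm; the alphabet is an arbitrary finite nonempty set of them.\<close>

record substitution =
  expansion :: "int mat"
  supp :: "int Matrix.vec set"
  alphabet :: "nat set"
  subst_rule :: "nat \<Rightarrow> int Matrix.vec \<Rightarrow> nat"

abbreviation sdim :: "substitution \<Rightarrow> nat" where
  "sdim \<zeta> \<equiv> dim_row (expansion \<zeta>)"

definition constant_shape_substitution :: "substitution \<Rightarrow> bool" where
  "constant_shape_substitution \<zeta> \<longleftrightarrow> 1 \<le> sdim \<zeta> \<and>
     expansion_matrix (sdim \<zeta>) (expansion \<zeta>) \<and>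
     fundamental_domain (sdim \<zeta>) (expansion \<zeta>) (supp \<zeta>) \<and>
     finite (alphabet \<zeta>) \<and> alphabet \<zeta> \<noteq> {} \<and>
     subst_rule \<zeta> \<in> alphabet \<zeta> \<rightarrow>\<^sub>E (supp \<zeta> \<rightarrow>\<^sub>E alphabet \<zeta>)"

text \<open>Both recursions start at \<open>n = 0\<close> with the identity substitution, whose support is \<open>{0}\<close>.
  The decomposition \<open>v = L j + f\<close> used for the iterates is unique, see \<open>iter_Suc_apply\<close> below.\<close>

primrec iter_supp :: "substitution \<Rightarrow> nat \<Rightarrow> int Matrix.vec set" where
  "iter_supp \<zeta> 0 = {0\<^sub>v (sdim \<zeta>)}"
| "iter_supp \<zeta> (Suc n) = {expansion \<zeta> *\<^sub>v j + f | j f. j \<in> iter_supp \<zeta> n \<and> f \<in> supp \<zeta>}"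

primrec iter :: "substitution \<Rightarrow> nat \<Rightarrow> nat \<Rightarrow> int Matrix.vec \<Rightarrow> nat" where
  "iter \<zeta> 0 a = (\<lambda>v \<in> iter_supp \<zeta> 0. a)"
| "iter \<zeta> (Suc n) a = (\<lambda>v \<in> iter_supp \<zeta> (Suc n).
     case (THE (j, f). j \<in> iter_supp \<zeta> n \<and> f \<in> supp \<zeta> \<and> v = expansion \<zeta> *\<^sub>v j + f) of
       (j, f) \<Rightarrow> subst_rule \<zeta> (iter \<zeta> n a j) f)"

definition subst_shift :: "substitution \<Rightarrow> (int Matrix.vec \<Rightarrow> nat) set" where
  "subst_shift \<zeta> = {x \<in> Zd (sdim \<zeta>) \<rightarrow>\<^sub>E alphabet \<zeta>.
     \<forall>P p. finite P \<and> P \<subseteq> Zd (sdim \<zeta>) \<and> p \<in> P \<rightarrow>\<^sub>E alphabet \<zeta> \<and>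
       occurs_in (sdim \<zeta>) P p (Zd (sdim \<zeta>)) x \<longrightarrow>
       (\<exists>n>0. \<exists>a \<in> alphabet \<zeta>. occurs_in (sdim \<zeta>) P p (iter_supp \<zeta> n) (iter \<zeta> n a))}"

definition primitive :: "substitution \<Rightarrow> bool" where
  "primitive \<zeta> \<longleftrightarrow> (\<exists>n>0. \<forall>a \<in> alphabet \<zeta>. \<forall>b \<in> alphabet \<zeta>. \<exists>v \<in> iter_supp \<zeta> n. iter \<zeta> n a v = b)"

definition aperiodic :: "substitution \<Rightarrow> bool" where
  "aperiodic \<zeta> \<longleftrightarrow> (\<forall>x \<in> subst_shift \<zeta>. \<forall>p \<in> Zd (sdim \<zeta>). shift (sdim \<zeta>) p x = x \<longrightarrow> p = 0\<^sub>v (sdim \<zeta>))"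

definition folner :: "substitution \<Rightarrow> bool" where
  "folner \<zeta> \<longleftrightarrow> (\<forall>m \<in> Zd (sdim \<zeta>).
     (\<lambda>n. real (card (sym_diff (iter_supp \<zeta> n) ((\<lambda>v. m + v) ` iter_supp \<zeta> n))) / real (card (iter_supp \<zeta> n)))
       \<longlonglongrightarrow> 0)"

abbreviation subst_factor_map ::
  "substitution \<Rightarrow> substitution \<Rightarrow> ((int Matrix.vec \<Rightarrow> nat) \<Rightarrow> (int Matrix.vec \<Rightarrow> nat)) \<Rightarrow> bool" where
  "subst_factor_map \<zeta>\<^sub>1 \<zeta>\<^sub>2 \<equiv>
     factor_map (sdim \<zeta>\<^sub>1) (alphabet \<zeta>\<^sub>1) (subst_shift \<zeta>\<^sub>1) (alphabet \<zeta>\<^sub>2) (subst_shift \<zeta>\<^sub>2)"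

abbreviation subst_radius ::
  "substitution \<Rightarrow> substitution \<Rightarrow> ((int Matrix.vec \<Rightarrow> nat) \<Rightarrow> (int Matrix.vec \<Rightarrow> nat)) \<Rightarrow> nat" where
  "subst_radius \<zeta>\<^sub>1 \<zeta>\<^sub>2 \<equiv>
     radius (sdim \<zeta>\<^sub>1) (alphabet \<zeta>\<^sub>1) (subst_shift \<zeta>\<^sub>1) (alphabet \<zeta>\<^sub>2)"

lemma expansion_matrix_inj:
  assumes L: "expansion_matrix d L" and j: "j \<in> Zd d" "j' \<in> Zd d" and eq: "L *\<^sub>v j = L *\<^sub>v j'"
  shows "j = j'"
proof (rule ccontr)
  assume ne: "j \<noteq> j'"
  define h :: "int \<Rightarrow> real" where "h = real_of_int"
  define x where "x = map_vec h (j - j')"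
  have Lc: "L \<in> carrier_mat d d" using L by (simp add: expansion_matrix_def)
  have xc: "x \<in> carrier_vec d" using j by (simp add: x_def)
  have x0: "x \<noteq> 0\<^sub>v d"
  proof
    assume "x = 0\<^sub>v d"
    then have "\<forall>i<d. x $ i = 0" by simp
    then have "\<forall>i<d. (j - j') $ i = 0" using j by (auto simp: x_def h_def)
    then have "j = j'" using j by (intro eq_vecI) auto
    with ne show False by simp
  qed
  have "L *\<^sub>v (j - j') = 0\<^sub>v d"
    using mult_minus_distrib_mat_vec[OF Lc j] eq Lc j by simp
  moreover have "map_mat h L *\<^sub>v x = map_vec h (L *\<^sub>v (j - j'))"
    unfolding x_def h_def
    by (rule of_int_hom.mult_mat_vec_hom[OF Lc, symmetric]) (use j in simp)
  ultimately have "map_mat h L *\<^sub>v x = 0\<^sub>v d" by (auto simp: h_def)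
  moreover obtain l where l: "l > 1"
    and exp: "\<forall>x \<in> carrier_vec d - {0\<^sub>v d}. enorm (map_mat h L *\<^sub>v x) > l * enorm x"
    using L unfolding expansion_matrix_def h_def by blast
  ultimately have "enorm (0\<^sub>v d) > l * enorm x"
    using xc x0 by (metis DiffI singletonD)
  moreover have "enorm (0\<^sub>v d) = 0" by (simp add: enorm_def)
  moreover have "l * enorm x \<ge> 0"
    using l by (intro mult_nonneg_nonneg) (simp_all add: enorm_def scalar_prod_def sum_nonneg)
  ultimately show False by linarith
qed

lemma finite_fundamental_domain:
  assumes L: "expansion_matrix d L" and F: "fundamental_domain d L F"
  shows "finite F"
proof -
  define h :: "int \<Rightarrow> real" where "h = real_of_int"
  define D where "D = det L"
  have Lc: "L \<in> carrier_mat d d" using L by (simp add: expansion_matrix_def)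
  have D0: "D \<noteq> 0"
  proof
    assume "D = 0"
    then have "det (map_mat h L) = 0" unfolding h_def D_def by (simp add: of_int_hom.hom_det)
    then obtain x where x: "x \<in> carrier_vec d" "x \<noteq> 0\<^sub>v d" "map_mat h L *\<^sub>v x = 0\<^sub>v d"
      using det_0_iff_vec_prod_zero_field[of "map_mat h L" d] Lc by auto
    obtain l where l: "l > 1"
      and exp: "\<forall>x \<in> carrier_vec d - {0\<^sub>v d}. enorm (map_mat h L *\<^sub>v x) > l * enorm x"
      using L unfolding expansion_matrix_def h_def by blast
    have "enorm (0\<^sub>v d) > l * enorm x" using exp x by (metis DiffI singletonD)
    moreover have "enorm (0\<^sub>v d) = 0" by (simp add: enorm_def)
    moreover have "l * enorm x \<ge> 0"
      using l by (intro mult_nonneg_nonneg) (simp_all add: enorm_def scalar_prod_def sum_nonneg)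
    ultimately show False by linarith
  qed
  define r where "r f = map (\<lambda>x. x mod D) (list_of_vec f)" for f :: "int Matrix.vec"
  have "inj_on r F"
  proof (rule inj_onI)
    fix f g assume f: "f \<in> F" and g: "g \<in> F" and eq: "r f = r g"
    have fd: "f \<in> Zd d" and gd: "g \<in> Zd d" using f g F by (auto simp: fundamental_domain_def)
    have dvd: "D dvd f $ i - g $ i" if i: "i < d" for i
    proof -
      have "r f ! i = r g ! i" using eq by simp
      then have "f $ i mod D = g $ i mod D" using i fd gd by (simp add: r_def)
      then show ?thesis by (simp add: mod_eq_dvd_iff)
    qed
    define w where "w = Matrix.vec d (\<lambda>i. (f $ i - g $ i) div D)"
    have wd: "w \<in> Zd d" by (simp add: w_def)
    have adj: "adj_mat L \<in> carrier_mat d d" "L * adj_mat L = D \<cdot>\<^sub>m 1\<^sub>m d"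
      using adj_mat[OF Lc] by (simp_all add: D_def)
    have "f - g = D \<cdot>\<^sub>v w"
      using dvd fd gd by (intro eq_vecI) (simp_all add: w_def)
    also have "\<dots> = (L * adj_mat L) *\<^sub>v w"
      unfolding adj(2) using wd by (intro eq_vecI) (simp_all add: scalar_prod_smult_left)
    also have "\<dots> = L *\<^sub>v (adj_mat L *\<^sub>v w)"
      by (rule assoc_mult_mat_vec[OF Lc adj(1) wd])
    finally have "f - g = L *\<^sub>v (adj_mat L *\<^sub>v w)" .
    moreover have "adj_mat L *\<^sub>v w \<in> Zd d" by (rule mult_mat_vec_carrier[OF adj(1) wd])
    moreover have "f - f = L *\<^sub>v 0\<^sub>v d"
      using fd Lc by (intro eq_vecI) (simp_all add: scalar_prod_def)
    ultimately show "f = g"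
      using F f g fd zero_carrier_vec[of d] unfolding fundamental_domain_def by metis
  qed
  moreover have "finite (r ` F)"
  proof (rule finite_subset)
    show "r ` F \<subseteq> {xs. set xs \<subseteq> {-\<bar>D\<bar>..\<bar>D\<bar>} \<and> length xs = d}"
    proof
      fix xs assume "xs \<in> r ` F"
      then obtain f where xs: "xs = r f" and fd: "f \<in> Zd d" using F by (auto simp: fundamental_domain_def)
      have "x mod D \<in> {-\<bar>D\<bar>..\<bar>D\<bar>}" for x
        using abs_mod_less[OF D0, of x] by auto
      then show "xs \<in> {xs. set xs \<subseteq> {-\<bar>D\<bar>..\<bar>D\<bar>} \<and> length xs = d}"
        using fd by (auto simp: xs r_def)
    qed
    show "finite {xs. set xs \<subseteq> {-\<bar>D\<bar>..\<bar>D\<bar>} \<and> length xs = d}"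
      by (rule finite_lists_length_eq) simp
  qed
  ultimately show ?thesis by (rule finite_imageD[rotated])
qed

context
  fixes \<zeta> assumes \<zeta>: "constant_shape_substitution \<zeta>"
begin

lemma expansion_carrier: "expansion \<zeta> \<in> carrier_mat (sdim \<zeta>) (sdim \<zeta>)"
  using \<zeta> by (simp add: constant_shape_substitution_def expansion_matrix_def)

lemma expansion_mult_carrier: "j \<in> Zd (sdim \<zeta>) \<Longrightarrow> expansion \<zeta> *\<^sub>v j \<in> Zd (sdim \<zeta>)"
  by (rule mult_mat_vec_carrier[OF expansion_carrier])

lemma supp_subset: "supp \<zeta> \<subseteq> Zd (sdim \<zeta>)"
  using \<zeta> by (simp add: constant_shape_substitution_def fundamental_domain_def)

lemma iter_supp_subset: "iter_supp \<zeta> n \<subseteq> Zd (sdim \<zeta>)"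
proof (induction n)
  case (Suc n)
  show ?case
  proof
    fix v assume "v \<in> iter_supp \<zeta> (Suc n)"
    then obtain j f where "j \<in> iter_supp \<zeta> n" "f \<in> supp \<zeta>" "v = expansion \<zeta> *\<^sub>v j + f" by auto
    then show "v \<in> Zd (sdim \<zeta>)"
      using Suc supp_subset expansion_mult_carrier by (blast intro: add_carrier_vec)
  qed
qed simp

lemma iter_decomposition_unique:
  assumes "j \<in> Zd (sdim \<zeta>)" "f \<in> supp \<zeta>" "j' \<in> Zd (sdim \<zeta>)" "f' \<in> supp \<zeta>"
    and eq: "expansion \<zeta> *\<^sub>v j + f = expansion \<zeta> *\<^sub>v j' + f'"
  shows "j = j' \<and> f = f'"
proof -
  let ?d = "sdim \<zeta>" and ?L = "expansion \<zeta>"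
  have c: "?L *\<^sub>v j \<in> Zd ?d" "?L *\<^sub>v j' \<in> Zd ?d" "f \<in> Zd ?d" "f' \<in> Zd ?d"
    using assms supp_subset expansion_mult_carrier by blast+
  define n where "n = ?L *\<^sub>v j + f"
  have n: "n \<in> Zd ?d" unfolding n_def by (rule add_carrier_vec[OF c(1,3)])
  have minus: "v + w - w = v" if "v \<in> Zd ?d" "w \<in> Zd ?d" for v w
    using that unfolding carrier_vec_def by (intro eq_vecI) simp_all
  have "n - f = ?L *\<^sub>v j" unfolding n_def by (rule minus[OF c(1,3)])
  moreover have "n - f' = ?L *\<^sub>v j'" unfolding n_def eq by (rule minus[OF c(2,4)])
  ultimately have f: "f = f'"
    using \<zeta> n assms(1-4) unfolding constant_shape_substitution_def fundamental_domain_def by blast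
  then have "?L *\<^sub>v j = ?L *\<^sub>v j'" using \<open>n - f = _\<close> \<open>n - f' = _\<close> by simp
  then show ?thesis
    using f \<zeta> assms(1,3) expansion_matrix_inj unfolding constant_shape_substitution_def by blast
qed

lemma iter_Suc_apply:
  assumes j: "j \<in> iter_supp \<zeta> n" and f: "f \<in> supp \<zeta>"
  shows "iter \<zeta> (Suc n) a (expansion \<zeta> *\<^sub>v j + f) = subst_rule \<zeta> (iter \<zeta> n a j) f"
proof -
  let ?v = "expansion \<zeta> *\<^sub>v j + f"
  have "(THE (j, f). j \<in> iter_supp \<zeta> n \<and> f \<in> supp \<zeta> \<and> ?v = expansion \<zeta> *\<^sub>v j + f) = (j, f)"
  proof (rule the_equality)
    fix q assume "case q of (j', f') \<Rightarrow> j' \<in> iter_supp \<zeta> n \<and> f' \<in> supp \<zeta> \<and> ?v = expansion \<zeta> *\<^sub>v j' + f'"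
    then obtain j' f' where q: "q = (j', f')" and j': "j' \<in> iter_supp \<zeta> n" and f': "f' \<in> supp \<zeta>"
      and v: "?v = expansion \<zeta> *\<^sub>v j' + f'" by (cases q) simp
    have "j = j' \<and> f = f'"
      by (rule iter_decomposition_unique) (use iter_supp_subset j f j' f' v in blast)+
    then show "q = (j, f)" using q by simp
  qed (use j f in simp)
  moreover have "?v \<in> iter_supp \<zeta> (Suc n)" using j f by auto
  ultimately show ?thesis by (simp del: iter_supp.simps)
qed

lemma expansion_zero_plus:
  assumes "f \<in> supp \<zeta>"
  shows "expansion \<zeta> *\<^sub>v 0\<^sub>v (sdim \<zeta>) + f = f"
proof -
  have "dim_col (expansion \<zeta>) = sdim \<zeta>" using expansion_carrier by (rule carrier_matD(2))
  then have "expansion \<zeta> *\<^sub>v 0\<^sub>v (sdim \<zeta>) = 0\<^sub>v (sdim \<zeta>)"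
    by (intro eq_vecI) (simp_all add: scalar_prod_def)
  then show ?thesis using assms supp_subset left_zero_vec by auto
qed

lemma iter_supp_1: "iter_supp \<zeta> 1 = supp \<zeta>"
  using expansion_zero_plus by force

lemma iter_1_apply:
  assumes "f \<in> supp \<zeta>"
  shows "iter \<zeta> 1 a f = subst_rule \<zeta> a f"
proof -
  have "iter \<zeta> (Suc 0) a (expansion \<zeta> *\<^sub>v 0\<^sub>v (sdim \<zeta>) + f) = subst_rule \<zeta> (iter \<zeta> 0 a (0\<^sub>v (sdim \<zeta>))) f"
    using assms by (intro iter_Suc_apply) simp_all
  then show ?thesis using expansion_zero_plus[OF assms] by simp
qed

end


section \<open>Computability\<close>

text \<open>Algorithms are partial recursive functions. \<open>recf_eval p xs y\<close> says that \<open>p\<close> halts on the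
  input \<open>xs\<close> with output \<open>y\<close>.\<close>

datatype recf =
    Zero
  | Succ
  | Proj nat
  | Comp recf "recf list"
  | Prec recf recf
  | Mu recf

inductive recf_eval :: "recf \<Rightarrow> nat list \<Rightarrow> nat \<Rightarrow> bool" where
  Zero: "recf_eval Zero xs 0"
| Succ: "recf_eval Succ [x] (Suc x)"
| Proj: "i < length xs \<Longrightarrow> recf_eval (Proj i) xs (xs ! i)"
| Comp: "list_all2 (\<lambda>g y. recf_eval g xs y) gs ys \<Longrightarrow> recf_eval f ys z \<Longrightarrow> recf_eval (Comp f gs) xs z"
| Prec_0: "recf_eval f xs y \<Longrightarrow> recf_eval (Prec f g) (0 # xs) y"
| Prec_Suc: "recf_eval (Prec f g) (n # xs) y \<Longrightarrow> recf_eval g (n # y # xs) z \<Longrightarrow>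
    recf_eval (Prec f g) (Suc n # xs) z"
| Mu: "recf_eval f (n # xs) 0 \<Longrightarrow> (\<forall>m<n. \<exists>y. recf_eval f (m # xs) (Suc y)) \<Longrightarrow> recf_eval (Mu f) xs n"

inductive_cases recf_eval_ZeroE: "recf_eval Zero xs y"
inductive_cases recf_eval_SuccE: "recf_eval Succ xs y"
inductive_cases recf_eval_ProjE: "recf_eval (Proj i) xs y"
inductive_cases recf_eval_CompE: "recf_eval (Comp f gs) xs y"
inductive_cases recf_eval_Prec_0E: "recf_eval (Prec f g) (0 # xs) y"
inductive_cases recf_eval_Prec_SucE: "recf_eval (Prec f g) (Suc n # xs) y"
inductive_cases recf_eval_MuE: "recf_eval (Mu f) xs y"

lemma recf_eval_deterministic:
  "recf_eval p xs y \<Longrightarrow> recf_eval p xs z \<Longrightarrow> y = z"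
proof (induction arbitrary: z rule: recf_eval.induct)
  case (Zero xs)
  then show ?case by (rule recf_eval_ZeroE) simp
next
  case (Succ x)
  then show ?case by (rule recf_eval_SuccE) simp
next
  case (Proj i xs)
  from Proj.prems show ?case by (rule recf_eval_ProjE) simp
next
  case (Comp xs gs ys f w)
  from Comp.prems obtain ys' where ys': "list_all2 (\<lambda>g y. recf_eval g xs y) gs ys'" "recf_eval f ys' z"
    by (rule recf_eval_CompE)
  have "ys = ys'"
  proof (rule nth_equalityI)
    show "length ys = length ys'"
      using Comp.IH(1) ys'(1) by (simp add: list_all2_lengthD[symmetric])
    fix i assume "i < length ys"
    then show "ys ! i = ys' ! i"
      using list_all2_nthD2[OF Comp.IH(1)] list_all2_nthD[OF ys'(1)] list_all2_lengthD[OF Comp.IH(1)]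
      by metis
  qed
  with Comp.IH(2) ys'(2) show ?case by blast
next
  case (Prec_0 f xs y g)
  from Prec_0.prems have "recf_eval f xs z" by (rule recf_eval_Prec_0E)
  then show ?case by (rule Prec_0.IH)
next
  case (Prec_Suc f g n xs y w)
  from Prec_Suc.prems obtain y' where y': "recf_eval (Prec f g) (n # xs) y'" "recf_eval g (n # y' # xs) z"
    by (rule recf_eval_Prec_SucE)
  from Prec_Suc.IH(1)[OF y'(1)] y'(2) have "recf_eval g (n # y # xs) z" by simp
  then show ?case by (rule Prec_Suc.IH(2))
next
  case (Mu f n xs)
  from Mu.prems have z: "recf_eval f (z # xs) 0" and m: "\<And>m. m < z \<Longrightarrow> \<exists>y. recf_eval f (m # xs) (Suc y)"
    by (auto elim: recf_eval_MuE)
  have "\<not> z < n" using Mu.IH(2) z by blast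
  moreover have "\<not> n < z" using Mu.IH(1) m by blast
  ultimately show ?case by simp
qed

text \<open>A substitution is given to an algorithm as its expansion matrix (by rows) together with the finite
  set of all \<open>(a, f, b)\<close> with \<open>b = \<zeta>(a)\<^sub>f\<close>. The alphabet and the support can be read off from this set.\<close>

definition vec_code :: "int Matrix.vec \<Rightarrow> nat" where
  "vec_code v = list_encode (map int_encode (list_of_vec v))"

definition mat_code :: "int mat \<Rightarrow> nat" where
  "mat_code M = list_encode (map vec_code (rows M))"

definition subst_code :: "substitution \<Rightarrow> nat" where
  "subst_code \<zeta> = prod_encode (mat_code (expansion \<zeta>),
     set_encode {prod_encode (a, prod_encode (vec_code f, subst_rule \<zeta> a f)) | a f.
                   a \<in> alphabet \<zeta> \<and> f \<in> supp \<zeta>})"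

lemma vec_code_inj: "vec_code v = vec_code w \<Longrightarrow> v = w"
  by (metis vec_code_def list_encode_eq inj_int_encode inj_map_eq_map vec_list)

lemma subst_code_inj:
  assumes z1: "constant_shape_substitution z1" and z2: "constant_shape_substitution z2"
    and eq: "subst_code z1 = subst_code z2"
  shows "z1 = z2"
proof -
  define T where "T z = {(a, f, subst_rule z a f) | a f. a \<in> alphabet z \<and> f \<in> supp z}" for z :: substitution
  define e where "e = (\<lambda>(a, f, b). prod_encode (a :: nat, prod_encode (vec_code f, b :: nat)))"
  have e: "inj e" by (auto simp: e_def inj_def dest: vec_code_inj)
  have code: "subst_code z = prod_encode (mat_code (expansion z), set_encode (e ` T z))" for z
    unfolding subst_code_def T_def e_def by (intro arg_cong[where f = prod_encode] arg_cong2[where f = Pair]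
        arg_cong[where f = set_encode] refl) force
  have finT: "finite (T z)" if "constant_shape_substitution z" for z
  proof -
    have "finite (alphabet z \<times> supp z)"
      using that finite_fundamental_domain unfolding constant_shape_substitution_def by blast
    moreover have "T z = (\<lambda>(a, f). (a, f, subst_rule z a f)) ` (alphabet z \<times> supp z)"
      by (auto simp: T_def)
    ultimately show ?thesis by simp
  qed
  have m: "mat_code (expansion z1) = mat_code (expansion z2)" using eq by (simp add: code)
  have "e ` T z1 = e ` T z2"
    using eq finT[OF z1] finT[OF z2] by (simp add: code set_encode_eq)
  then have T: "T z1 = T z2" using e by (simp add: inj_image_eq_iff)
  have "inj vec_code" by (rule injI) (rule vec_code_inj)
  then have rows: "rows (expansion z1) = rows (expansion z2)"
    using m by (simp add: mat_code_def list_encode_eq inj_map_eq_map)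
  have sq: "dim_col (expansion z) = dim_row (expansion z)" if "constant_shape_substitution z" for z
    using expansion_carrier[OF that] by (rule carrier_matD(2))
  have "dim_row (expansion z1) = dim_row (expansion z2)" using arg_cong[OF rows, of length] by simp
  then have L: "expansion z1 = expansion z2"
    using rows sq[OF z1] sq[OF z2] by (metis mat_of_rows_rows)
  have ne: "alphabet z \<noteq> {}" "supp z \<noteq> {}" if "constant_shape_substitution z" for z
    using that by (auto simp: constant_shape_substitution_def fundamental_domain_def)
  have alph: "fst ` T z = alphabet z" and supp: "(fst \<circ> snd) ` T z = supp z"
    if "constant_shape_substitution z" for z
    using ne[OF that] by (force simp: T_def)+
  have A: "alphabet z1 = alphabet z2" and F: "supp z1 = supp z2"
    using alph[OF z1] alph[OF z2] supp[OF z1] supp[OF z2] T by metis+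
  have r: "subst_rule z1 a f = subst_rule z2 a f" if "a \<in> alphabet z1" "f \<in> supp z1" for a f
  proof -
    have "(a, f, subst_rule z1 a f) \<in> T z1" using that by (auto simp: T_def)
    then have "(a, f, subst_rule z1 a f) \<in> T z2" by (simp only: T)
    then show ?thesis by (simp add: T_def)
  qed
  have E: "subst_rule z \<in> alphabet z \<rightarrow>\<^sub>E (supp z \<rightarrow>\<^sub>E alphabet z)"
    if "constant_shape_substitution z" for z
    using that by (simp add: constant_shape_substitution_def)
  have "subst_rule z1 = subst_rule z2"
  proof (rule PiE_ext)
    show "subst_rule z1 \<in> alphabet z1 \<rightarrow>\<^sub>E (supp z1 \<rightarrow>\<^sub>E alphabet z1)" by (rule E[OF z1])
    show "subst_rule z2 \<in> alphabet z1 \<rightarrow>\<^sub>E (supp z1 \<rightarrow>\<^sub>E alphabet z1)" using E[OF z2] A F by simp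
    fix a assume a: "a \<in> alphabet z1"
    show "subst_rule z1 a = subst_rule z2 a"
    proof (rule PiE_ext)
      show "subst_rule z1 a \<in> supp z1 \<rightarrow>\<^sub>E alphabet z1" using E[OF z1] a by (rule PiE_mem)
      show "subst_rule z2 a \<in> supp z1 \<rightarrow>\<^sub>E alphabet z1" using PiE_mem[OF E[OF z2]] a A F by simp
    qed (rule r[OF a])
  qed
  with L A F show ?thesis by simp
qed

end

theory Submission
  imports Defs "HOL-Analysis.L2_Norm"
begin

text \<open>A Coven--Dekking--Keane argument. Let \<open>\<phi>\<close> be a factor map. Recognizability of \<open>\<zeta>\<^sub>2\<close> yields a factor
  map \<open>\<psi>\<close> and \<open>g\<close> with \<open>\<phi> \<circ> \<zeta>\<^sub>1 = S\<^sup>g \<circ> \<zeta>\<^sub>2 \<circ> \<psi>\<close>. If \<open>\<phi>\<close> has radius \<open>r\<close> then \<open>\<psi>\<close> has radius at most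
  \<open>(r + C) / \<lambda>\<close>, so iterating \<open>\<phi> \<mapsto> \<psi>\<close> leads into the finite set of maps of radius at most about
  \<open>C / (\<lambda> - 1)\<close>. This iteration is injective modulo shifts and maps that finite set into itself, where
  it is therefore a bijection modulo shifts; hence \<open>\<phi>\<close> already agrees with a map in that set up to a shift.

  For the constant to be computable, recognizability needs an explicit window. If \<open>S\<^sup>f \<zeta>\<^sup>l(x)\<close> and
  \<open>\<zeta>\<^sup>l(y)\<close> agree on a large ball while \<open>f \<notin> L\<^sup>l \<int>\<^sup>d\<close>, then by repetitivity every point has, on a window,
  two decompositions of level \<open>l\<close>, and so \<open>2\<^sup>n\<close> decompositions of level \<open>l n\<close>. Once \<open>2\<^sup>n\<close> exceeds
  the number of patches of a fixed size, two of the desubstituted points have the same patch, and the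
  difference of the two positions is a period of every point of \<open>X\<^sub>\<zeta>\<close>. All constants that occur are elementary in
  one number \<open>c\<close>, which bounds the substitution data, the norm of \<open>L\<close> and \<open>1 / (\<lambda> - 1)\<close>.\<close>

section \<open>Integer vectors and expansion matrices\<close>

text \<open>Three obstacles shape the constants. The hypothesis only asserts that some factor
  \<lambda> > 1 exists, so an explicit gap 1 / c has to be extracted from the integrality of
  \<open>L\<close>. The supports of the iterates have arbitrary shapes, so windows are balls
  instead; this works because addition in base \<open>L\<close> produces carries that stay in one
  ball, uniformly in the number of digits (\<open>quon_ball\<close>). Finally \<zeta> need not be
  injective on letters: the block structure of \<open>sub y\<close> only reveals the images of the
  letters of y, and letters with equal images must be told apart by going further back. Injectivity
  of \<open>sub\<close> on the subshift therefore uses recognizability at a level where the merging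
  of letters has stabilized, not at level 1. Computability then costs little: codes dominate the
  data they encode, so every bound is built by sums, products and powers from the sum of the two
  codes, and no recursive function has to decode or search.\<close>

definition znorm :: "int Matrix.vec \<Rightarrow> real" where
  "znorm v = enorm (map_vec real_of_int v)"

lemma znorm_L2_set: "v \<in> Zd d \<Longrightarrow> znorm v = L2_set (\<lambda>i. real_of_int (v $ i)) {..<d}"
  by (simp add: znorm_def enorm_def L2_set_def scalar_prod_def power2_eq_square lessThan_atLeast0)

lemma znorm_nonneg: "0 \<le> znorm v"
  by (simp add: znorm_def enorm_def scalar_prod_def sum_nonneg)

lemma znorm_triangle: "a \<in> Zd d \<Longrightarrow> b \<in> Zd d \<Longrightarrow> znorm (a + b) \<le> znorm a + znorm b"
  using L2_set_triangle_ineq[of "\<lambda>i. real_of_int (a $ i)" "\<lambda>i. real_of_int (b $ i)" "{..<d}"]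
  by (simp add: znorm_L2_set[of _ d] L2_set_def)

lemma znorm_uminus: "a \<in> Zd d \<Longrightarrow> znorm (- a) = znorm a"
  by (simp add: znorm_L2_set[of _ d] L2_set_def)

lemma znorm_zero: "znorm (0\<^sub>v d) = 0"
  by (simp add: znorm_L2_set[of _ d] L2_set_def)

lemma znorm_diff:
  assumes "a \<in> Zd d" "b \<in> Zd d" shows "znorm (a - b) \<le> znorm a + znorm b"
proof -
  have "a - b = a + (- b)" using assms by (intro eq_vecI) simp_all
  then show ?thesis using znorm_triangle[of a d "- b"] znorm_uminus[of b d] assms by simp
qed

lemma znorm_coord: "v \<in> Zd d \<Longrightarrow> i < d \<Longrightarrow> \<bar>real_of_int (v $ i)\<bar> \<le> znorm v"
  using member_le_L2_set[of "{..<d}" i "\<lambda>i. real_of_int (v $ i)"]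
   member_le_L2_set[of "{..<d}" i "\<lambda>i. - real_of_int (v $ i)"]
  by (simp add: znorm_L2_set[of _ d] L2_set_def)

lemma lattice_ball_iff: "v \<in> lattice_ball d r \<longleftrightarrow> v \<in> Zd d \<and> znorm v \<le> real r"
  by (simp add: lattice_ball_def znorm_def)

lemma lattice_ball_coords:
  "inj_on list_of_vec (lattice_ball d r)"
  "list_of_vec ` lattice_ball d r \<subseteq> {xs. set xs \<subseteq> {- int r..int r} \<and> length xs = d}"
proof -
  show "inj_on list_of_vec (lattice_ball d r)" by (metis inj_onI vec_list)
  show "list_of_vec ` lattice_ball d r \<subseteq> {xs. set xs \<subseteq> {- int r..int r} \<and> length xs = d}"
  proof clarify
    fix v assume v: "v \<in> lattice_ball d r"
    then have vd: "v \<in> Zd d" "dim_vec v = d" by (auto simp: lattice_ball_iff)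
    have "- int r \<le> v $ i \<and> v $ i \<le> int r" if "i < d" for i
      using znorm_coord[OF vd(1) that] v by (simp add: lattice_ball_iff) linarith
    then show "set (list_of_vec v) \<subseteq> {- int r..int r} \<and> length (list_of_vec v) = d"
      using vd by (auto simp: set_list_of_vec vec_set_def)
  qed
qed

lemma finite_lattice_ball: "finite (lattice_ball d r)"
  using lattice_ball_coords finite_lists_length_eq[of "{- int r..int r}" d]
  by (meson finite_atLeastAtMost_int inj_on_finite)

lemma card_lattice_ball: "card (lattice_ball d r) \<le> (2 * r + 1) ^ d"
proof -
  have "card (lattice_ball d r) \<le> card {xs. set xs \<subseteq> {- int r..int r} \<and> length xs = d}"
    using lattice_ball_coords[of d r] finite_lists_length_eq[of "{- int r..int r}" d]
    by (intro card_inj_on_le[of list_of_vec]) auto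
  also have "\<dots> = (2 * r + 1) ^ d"
    by (subst card_lists_length_eq) (auto simp: nat_add_distrib nat_mult_distrib)
  finally show ?thesis .
qed

lemma lattice_ball_mono: "r \<le> s \<Longrightarrow> lattice_ball d r \<subseteq> lattice_ball d s"
  by (auto simp: lattice_ball_iff)

lemma zero_in_lattice_ball: "0\<^sub>v d \<in> lattice_ball d r"
  by (simp add: lattice_ball_iff znorm_zero)

lemma finite_subset_lattice_ball:
  assumes "finite P" "P \<subseteq> Zd d" shows "\<exists>r. P \<subseteq> lattice_ball d r"
proof -
  have "P \<subseteq> lattice_ball d (Max (insert 0 ((\<lambda>v. nat \<lceil>znorm v\<rceil>) ` P)))"
  proof
    fix v assume v: "v \<in> P"
    then have "nat \<lceil>znorm v\<rceil> \<le> Max (insert 0 ((\<lambda>v. nat \<lceil>znorm v\<rceil>) ` P))"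
      using assms by (intro Max_ge) auto
    then show "v \<in> lattice_ball d (Max (insert 0 ((\<lambda>v. nat \<lceil>znorm v\<rceil>) ` P)))"
      using v assms(2) unfolding lattice_ball_iff by (smt (verit, best) of_nat_mono real_nat_ceiling_ge subsetD)
  qed
  then show ?thesis by blast
qed

lemma mult_mat_vec_zero: "M \<in> carrier_mat n d \<Longrightarrow> M *\<^sub>v 0\<^sub>v d = 0\<^sub>v n" for M :: "int mat"
  by (intro eq_vecI) (simp_all add: scalar_prod_def)

text \<open>An element of the level-n support is a sum of L^i f_i over i < n with digits f_i of norm
  at most c, hence of norm at most c (1 + c + ... + c^(n-1)). The coarser product keeps the bound
  within multiplication and powers.\<close>

definition support_radius :: "nat \<Rightarrow> nat \<Rightarrow> nat" where "support_radius c n = c * n * c ^ n"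

text \<open>The least r with r + 4 c \<le> (1 + 1 / c) r: from this radius on, division by
  \<open>L\<close> maps a ball into itself even after three digits have been added. Three of the
  four c come from the digits in \<open>quon_ball\<close>, the fourth from the remainder in
  \<open>quo_bound\<close>.\<close>

definition base_radius :: "nat \<Rightarrow> nat" where "base_radius c = 4 * c * c"

text \<open>Keeps products with \<open>L\<close> atomic, so that identities between sums of vectors
  reduce to linear arithmetic in each coordinate.\<close>

declare index_mult_mat_vec [simp del]

text \<open>The parameter c makes the expansion and the Lipschitz constant of \<open>L\<close>
  explicit. Only integer vectors are ever measured, so \<open>gap\<close> and \<open>lip\<close> are
  required for them alone; \<open>csubstI\<close> supplies a c computed from the code.\<close>

locale expanding =
  fixes d :: nat and L :: "int mat" and c :: nat
  assumes L_carrier: "L \<in> carrier_mat d d" and c_pos: "1 \<le> c" and d_le: "d \<le> c"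
    and gap: "v \<in> Zd d \<Longrightarrow> (1 + 1 / real c) * znorm v \<le> znorm (L *\<^sub>v v)"
    and lip: "v \<in> Zd d \<Longrightarrow> znorm (L *\<^sub>v v) \<le> real c * znorm v"
begin

abbreviation "G \<equiv> Zd d"
abbreviation "B \<equiv> lattice_ball d"

lemma dim_G [simp]: "v \<in> G \<Longrightarrow> dim_vec v = d"
  by simp

lemma vec_eqI: "a \<in> G \<Longrightarrow> b \<in> G \<Longrightarrow> (\<And>i. i < d \<Longrightarrow> a $ i = b $ i) \<Longrightarrow> a = b"
  by (intro eq_vecI) auto

lemma L_G [simp]: "v \<in> G \<Longrightarrow> L *\<^sub>v v \<in> G"
  by (rule mult_mat_vec_carrier[OF L_carrier])

lemma L_add: "a \<in> G \<Longrightarrow> b \<in> G \<Longrightarrow> L *\<^sub>v (a + b) = L *\<^sub>v a + L *\<^sub>v b"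
  by (rule mult_add_distrib_mat_vec[OF L_carrier])

lemma L_diff: "a \<in> G \<Longrightarrow> b \<in> G \<Longrightarrow> L *\<^sub>v (a - b) = L *\<^sub>v a - L *\<^sub>v b"
  by (rule mult_minus_distrib_mat_vec[OF L_carrier])

lemma L_zero: "L *\<^sub>v 0\<^sub>v d = 0\<^sub>v d"
  by (rule mult_mat_vec_zero[OF L_carrier])

primrec Lpow :: "nat \<Rightarrow> int Matrix.vec \<Rightarrow> int Matrix.vec" where
  "Lpow 0 v = v"
| "Lpow (Suc n) v = L *\<^sub>v Lpow n v"

lemma Lpow_G [simp]: "v \<in> G \<Longrightarrow> Lpow n v \<in> G"
  by (induction n) auto

lemma Lpow_add: "a \<in> G \<Longrightarrow> b \<in> G \<Longrightarrow> Lpow n (a + b) = Lpow n a + Lpow n b"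
  by (induction n) (auto simp: L_add)

lemma Lpow_diff: "a \<in> G \<Longrightarrow> b \<in> G \<Longrightarrow> Lpow n (a - b) = Lpow n a - Lpow n b"
  by (induction n) (auto simp: L_diff)

lemma Lpow_zero: "Lpow n (0\<^sub>v d) = 0\<^sub>v d"
  by (induction n) (auto simp: L_zero)

lemma znorm_Lpow: "v \<in> G \<Longrightarrow> znorm (Lpow n v) \<le> real (c ^ n) * znorm v"
proof (induction n)
  case (Suc n)
  have "znorm (Lpow (Suc n) v) \<le> real c * znorm (Lpow n v)" using lip Suc.prems by simp
  also have "\<dots> \<le> real c * (real (c ^ n) * znorm v)" using Suc by (intro mult_left_mono) auto
  finally show ?case by (simp add: mult.assoc)
qed simp

lemma L_inj: "a \<in> G \<Longrightarrow> b \<in> G \<Longrightarrow> L *\<^sub>v a = L *\<^sub>v b \<Longrightarrow> a = b"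
proof -
  assume a: "a \<in> G" "b \<in> G" "L *\<^sub>v a = L *\<^sub>v b"
  have "L *\<^sub>v (a - b) = 0\<^sub>v d" using a by (simp add: L_diff)
  then have "(1 + 1 / real c) * znorm (a - b) \<le> 0" using gap[of "a - b"] a by (simp add: znorm_zero)
  moreover have "1 + 1 / real c > 0" by (simp add: add_pos_nonneg)
  ultimately have "znorm (a - b) \<le> 0" by (simp add: mult_le_0_iff)
  then have "\<bar>real_of_int ((a - b) $ i)\<bar> \<le> 0" if "i < d" for i
    using znorm_coord[of "a - b" d i] a that by simp
  then have "a $ i = b $ i" if "i < d" for i using that a by (simp add: index_minus_vec(1))
  then show "a = b" using a by (intro vec_eqI) auto
qed

end

locale csubst = expanding +
  fixes \<zeta> :: substitution
  assumes cs: "constant_shape_substitution \<zeta>" and exp_L [simp]: "expansion \<zeta> = L"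
    and card_A: "card (alphabet \<zeta>) \<le> c" and F_le: "f \<in> supp \<zeta> \<Longrightarrow> znorm f \<le> real c"
begin

abbreviation "F \<equiv> supp \<zeta>"
abbreviation "Fn \<equiv> iter_supp \<zeta>"
abbreviation "A \<equiv> alphabet \<zeta>"
abbreviation "X \<equiv> subst_shift \<zeta>"
abbreviation "Conf \<equiv> Zd d \<rightarrow>\<^sub>E alphabet \<zeta>"

lemma dim_row_L [simp]: "dim_row L = d"
  using L_carrier by simp

lemma F_G [simp]: "f \<in> F \<Longrightarrow> f \<in> G"
  using supp_subset[OF cs] by auto

lemma Fn_G [simp]: "f \<in> Fn n \<Longrightarrow> f \<in> G"
  using iter_supp_subset[OF cs, of n] by auto

lemma zero_F [simp]: "0\<^sub>v d \<in> F"
  using cs by (simp add: constant_shape_substitution_def fundamental_domain_def)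

lemma finite_F: "finite F"
  using cs finite_fundamental_domain unfolding constant_shape_substitution_def by blast

lemma finite_A: "finite A" and A_ne: "A \<noteq> {}"
  using cs by (auto simp: constant_shape_substitution_def)

lemma rule_A [simp]: "a \<in> A \<Longrightarrow> f \<in> F \<Longrightarrow> subst_rule \<zeta> a f \<in> A"
  using cs unfolding constant_shape_substitution_def by blast

section \<open>Digit expansions in base \<open>L\<close>\<close>

lemma ex_decomp: assumes "v \<in> G" shows "\<exists>j\<in>G. \<exists>f\<in>F. v = L *\<^sub>v j + f"
proof -
  have "fundamental_domain d L F" using cs by (simp add: constant_shape_substitution_def)
  then have "\<exists>!f. f \<in> F \<and> (\<exists>m\<in>G. v - f = L *\<^sub>v m)"
    using assms unfolding fundamental_domain_def by blast
  then obtain f m where f: "f \<in> F" "m \<in> G" "v - f = L *\<^sub>v m" by metis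
  have "v = (v - f) + f" using assms f(1) by (intro vec_eqI) auto
  then show ?thesis using f by metis
qed

lemma decomp_unique:
  "j \<in> G \<Longrightarrow> f \<in> F \<Longrightarrow> j' \<in> G \<Longrightarrow> f' \<in> F \<Longrightarrow> L *\<^sub>v j + f = L *\<^sub>v j' + f' \<Longrightarrow> j = j' \<and> f = f'"
  using iter_decomposition_unique[OF cs, of j f j' f'] by simp

text \<open>Division with remainder by \<open>L\<close>, the digits being the elements of the
  support. Both \<open>quo\<close> and \<open>dig\<close> are meaningful on all of Z^d, including
  vectors without a finite expansion, so they also describe \<zeta> acting on
  configurations.\<close>

definition quo :: "int Matrix.vec \<Rightarrow> int Matrix.vec" where
  "quo v = (SOME j. j \<in> G \<and> (\<exists>f\<in>F. v = L *\<^sub>v j + f))"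

definition dig :: "int Matrix.vec \<Rightarrow> int Matrix.vec" where
  "dig v = (SOME f. f \<in> F \<and> v = L *\<^sub>v quo v + f)"

lemma quo_dig:
  assumes "v \<in> G" shows "quo v \<in> G" "dig v \<in> F" "v = L *\<^sub>v quo v + dig v"
proof -
  have 1: "quo v \<in> G \<and> (\<exists>f\<in>F. v = L *\<^sub>v quo v + f)"
    unfolding quo_def by (rule someI_ex) (use ex_decomp[OF assms] in blast)
  have "dig v \<in> F \<and> v = L *\<^sub>v quo v + dig v"
    unfolding dig_def by (rule someI_ex) (use 1 in blast)
  with 1 show "quo v \<in> G" "dig v \<in> F" "v = L *\<^sub>v quo v + dig v" by simp_all
qed

lemma quo_G [simp]: "v \<in> G \<Longrightarrow> quo v \<in> G" and dig_F [simp]: "v \<in> G \<Longrightarrow> dig v \<in> F"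
  by (simp_all add: quo_dig)

lemma quo_dig_eq:
  assumes "j \<in> G" "f \<in> F" shows quo_eq: "quo (L *\<^sub>v j + f) = j" and dig_eq: "dig (L *\<^sub>v j + f) = f"
  using quo_dig[of "L *\<^sub>v j + f"] decomp_unique[of j f "quo (L *\<^sub>v j + f)" "dig (L *\<^sub>v j + f)"] assms by auto

lemma decompE:
  assumes "v \<in> G" obtains j f where "j \<in> G" "f \<in> F" "v = L *\<^sub>v j + f"
  using ex_decomp[OF assms] by blast

lemma quo_add: "j \<in> G \<Longrightarrow> v \<in> G \<Longrightarrow> quo (L *\<^sub>v j + v) = j + quo v \<and> dig (L *\<^sub>v j + v) = dig v"
proof -
  assume j: "j \<in> G" and "v \<in> G"
  obtain i f where v: "i \<in> G" "f \<in> F" "v = L *\<^sub>v i + f" using \<open>v \<in> G\<close> by (rule decompE)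
  have "L *\<^sub>v j + v = L *\<^sub>v (j + i) + f"
    unfolding v(3) using j v(1,2) by (intro vec_eqI) (auto simp: L_add)
  then show ?thesis using j v by (simp add: quo_dig_eq)
qed

declare iter_supp.simps [simp del] iter.simps [simp del]

lemma Fn_Suc: "Fn (Suc n) = {L *\<^sub>v j + f | j f. j \<in> Fn n \<and> f \<in> F}"
  by (simp add: iter_supp.simps)

lemma Fn_Suc_iff:
  assumes "v \<in> G" shows "v \<in> Fn (Suc n) \<longleftrightarrow> quo v \<in> Fn n"
proof
  assume "v \<in> Fn (Suc n)"
  then obtain j f where "v = L *\<^sub>v j + f" "j \<in> Fn n" "f \<in> F" by (auto simp: Fn_Suc)
  then show "quo v \<in> Fn n" by (simp add: quo_eq)
next
  assume "quo v \<in> Fn n"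
  then show "v \<in> Fn (Suc n)" unfolding Fn_Suc using quo_dig[OF assms] by blast
qed

lemma Fn_Suc_intro: "j \<in> Fn n \<Longrightarrow> f \<in> F \<Longrightarrow> L *\<^sub>v j + f \<in> Fn (Suc n)"
  by (auto simp: Fn_Suc)

lemma zero_Fn [simp]: "0\<^sub>v d \<in> Fn n"
proof (induction n)
  case (Suc n)
  have "L *\<^sub>v 0\<^sub>v d + 0\<^sub>v d \<in> Fn (Suc n)" by (rule Fn_Suc_intro[OF Suc zero_F])
  then show ?case by (simp add: L_zero)
qed (simp add: iter_supp.simps)

lemma iter_Suc': "j \<in> Fn n \<Longrightarrow> f \<in> F \<Longrightarrow> iter \<zeta> (Suc n) a (L *\<^sub>v j + f) = subst_rule \<zeta> (iter \<zeta> n a j) f"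
  using iter_Suc_apply[OF cs, of j n f a] by simp

lemma iter_Suc: "v \<in> G \<Longrightarrow> v \<in> Fn (Suc n) \<Longrightarrow> iter \<zeta> (Suc n) a v = subst_rule \<zeta> (iter \<zeta> n a (quo v)) (dig v)"
  by (auto simp: Fn_Suc iter_Suc' quo_dig_eq)

lemma iter_A: "a \<in> A \<Longrightarrow> v \<in> Fn n \<Longrightarrow> iter \<zeta> n a v \<in> A"
proof (induction n arbitrary: v)
  case (Suc n)
  then have "v \<in> G" using Fn_G by blast
  with Suc show ?case using Fn_Suc_iff[of v n] by (simp add: iter_Suc)
qed (simp add: iter.simps iter_supp.simps)

lemma Fn_0: "Fn 0 = {0\<^sub>v d}" by (simp add: iter_supp.simps)

lemma iter_0: "iter \<zeta> 0 a (0\<^sub>v d) = a" by (simp add: iter.simps Fn_0)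

lemma finite_Fn: "finite (Fn n)"
proof (induction n)
  case (Suc n)
  have "Fn (Suc n) = (\<lambda>(j, f). L *\<^sub>v j + f) ` (Fn n \<times> F)" by (force simp: Fn_Suc)
  then show ?case using Suc finite_F by simp
qed (simp add: Fn_0)

text \<open>The blocks \<open>Lpow n j + Fn n\<close> tile Z^d, and \<open>quon n v\<close> is the
  index of the tile that contains v.\<close>

primrec quon :: "nat \<Rightarrow> int Matrix.vec \<Rightarrow> int Matrix.vec" where
  "quon 0 v = v"
| "quon (Suc n) v = quon n (quo v)"

lemma quon_G [simp]: "v \<in> G \<Longrightarrow> quon n v \<in> G"
  by (induction n arbitrary: v) auto

lemma Fn_SucE:
  assumes "f \<in> Fn (Suc n)" obtains j g where "j \<in> Fn n" "g \<in> F" "f = L *\<^sub>v j + g"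
  using assms by (auto simp: Fn_Suc)

lemma quon_eq: "j \<in> G \<Longrightarrow> f \<in> Fn n \<Longrightarrow> quon n (Lpow n j + f) = j"
proof (induction n arbitrary: f)
  case (Suc n)
  obtain h g where f: "h \<in> Fn n" "g \<in> F" "f = L *\<^sub>v h + g" using Suc.prems(2) by (rule Fn_SucE)
  have "Lpow (Suc n) j + f = L *\<^sub>v (Lpow n j + h) + g"
    using f Suc.prems Fn_G[OF f(1)] by (intro vec_eqI) (auto simp: L_add)
  then show ?case using f Suc Fn_G[OF f(1)] by (simp add: quo_eq)
qed (simp add: Fn_0)

lemma quon_decomp: "v \<in> G \<Longrightarrow> \<exists>f\<in>Fn n. v = Lpow n (quon n v) + f"
proof (induction n arbitrary: v)
  case (Suc n)
  obtain f where f: "f \<in> Fn n" "quo v = Lpow n (quon n (quo v)) + f" using Suc.IH[of "quo v"] Suc.prems by auto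
  have fG: "f \<in> G" using f by simp
  obtain j g where v: "j \<in> G" "g \<in> F" "v = L *\<^sub>v j + g" using Suc.prems by (rule decompE)
  have q: "quo v = j" using v by (simp add: quo_eq)
  have "v = L *\<^sub>v (Lpow n (quon n j) + f) + g" using f(2)[unfolded q] v(3) by simp
  also have "\<dots> = Lpow (Suc n) (quon (Suc n) v) + (L *\<^sub>v f + g)"
    using v(1,2) fG by (intro vec_eqI) (auto simp: L_add q)
  finally show ?case using Fn_Suc_intro[OF f(1) v(2)] by blast
qed (simp add: Fn_0)

lemma Fn_decomp_unique:
  assumes "j \<in> G" "f \<in> Fn n" "j' \<in> G" "f' \<in> Fn n" "Lpow n j + f = Lpow n j' + f'"
  shows "j = j' \<and> f = f'"
proof -
  have "j = j'" using quon_eq[of j f n] quon_eq[of j' f' n] assms by simp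
  moreover have "f = (Lpow n j + f) - Lpow n j" "f' = (Lpow n j' + f') - Lpow n j'"
    using assms(1-4) Fn_G[of f n] Fn_G[of f' n] by (auto intro!: vec_eqI)
  ultimately show ?thesis using assms(5) by simp
qed

lemma Fn_add: "j \<in> Fn m \<Longrightarrow> f \<in> Fn n \<Longrightarrow> Lpow n j + f \<in> Fn (m + n)"
proof (induction n arbitrary: f)
  case (Suc n)
  obtain h g where f: "h \<in> Fn n" "g \<in> F" "f = L *\<^sub>v h + g" using Suc.prems(2) by (rule Fn_SucE)
  have "Lpow (Suc n) j + f = L *\<^sub>v (Lpow n j + h) + g"
    using f Suc.prems Fn_G[OF f(1)] Fn_G[OF Suc.prems(1)] by (intro vec_eqI) (auto simp: L_add)
  then show ?case using f Suc Fn_Suc_intro[of "Lpow n j + h" "m + n" g] by simp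
qed (simp add: Fn_0)

text \<open>\<open>iter\<close> is defined by appending one lowest digit at a time. Cutting the
  expansion at an arbitrary place gives the semigroup law: the upper m digits select a letter, the
  lower n digits a position in its image.\<close>

lemma iter_add: "j \<in> Fn m \<Longrightarrow> f \<in> Fn n \<Longrightarrow> iter \<zeta> (m + n) a (Lpow n j + f) = iter \<zeta> n (iter \<zeta> m a j) f"
proof (induction n arbitrary: f)
  case (Suc n)
  obtain h g where f: "h \<in> Fn n" "g \<in> F" "f = L *\<^sub>v h + g" using Suc.prems(2) by (rule Fn_SucE)
  have "Lpow (Suc n) j + f = L *\<^sub>v (Lpow n j + h) + g"
    using f Suc.prems Fn_G[OF f(1)] Fn_G[OF Suc.prems(1)] by (intro vec_eqI) (auto simp: L_add)
  then show ?case using f Suc Fn_add[OF Suc.prems(1) f(1)] by (simp add: iter_Suc')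
next
  case 0
  then show ?case using Fn_G[of j m] by (simp add: Fn_0 iter_0)
qed

section \<open>The substitution acting on configurations\<close>

definition sub :: "(int Matrix.vec \<Rightarrow> nat) \<Rightarrow> (int Matrix.vec \<Rightarrow> nat)" where
  "sub x = (\<lambda>v\<in>G. subst_rule \<zeta> (x (quo v)) (dig v))"

primrec subn :: "nat \<Rightarrow> (int Matrix.vec \<Rightarrow> nat) \<Rightarrow> (int Matrix.vec \<Rightarrow> nat)" where
  "subn 0 x = x"
| "subn (Suc n) x = sub (subn n x)"

lemma sub_eq: "j \<in> G \<Longrightarrow> f \<in> F \<Longrightarrow> sub x (L *\<^sub>v j + f) = subst_rule \<zeta> (x j) f"
  by (simp add: sub_def quo_eq dig_eq)

lemma subn_subn: "subn m (subn n x) = subn (m + n) x"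
  by (induction m) auto

lemma subn_eq: "j \<in> G \<Longrightarrow> f \<in> Fn n \<Longrightarrow> subn n x (Lpow n j + f) = iter \<zeta> n (x j) f"
proof (induction n arbitrary: f)
  case (Suc n)
  obtain h g where f: "h \<in> Fn n" "g \<in> F" "f = L *\<^sub>v h + g" using Suc.prems(2) by (rule Fn_SucE)
  have "Lpow (Suc n) j + f = L *\<^sub>v (Lpow n j + h) + g"
    using f Suc.prems Fn_G[OF f(1)] by (intro vec_eqI) (auto simp: L_add)
  then show ?case using f Suc Fn_G[OF f(1)] by (simp add: sub_eq iter_Suc')
qed (simp add: Fn_0 iter_0)

lemma sub_Conf [simp]: "x \<in> Conf \<Longrightarrow> sub x \<in> Conf"
  by (auto simp: sub_def PiE_iff extensional_def)

lemma subn_Conf [simp]: "x \<in> Conf \<Longrightarrow> subn n x \<in> Conf"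
  by (induction n) auto

lemma shift_Conf [simp]: "j \<in> G \<Longrightarrow> x \<in> Conf \<Longrightarrow> shift d j x \<in> Conf"
  by (auto simp: shift_def PiE_iff extensional_def)

lemma shift_apply: "v \<in> G \<Longrightarrow> shift d j x v = x (j + v)"
  by (simp add: shift_def)

lemma shift_shift: "j \<in> G \<Longrightarrow> k \<in> G \<Longrightarrow> shift d j (shift d k x) = shift d (j + k) x"
  by (auto simp: shift_def fun_eq_iff restrict_def intro!: arg_cong[where f = x] vec_eqI)

lemma shift_zero: "x \<in> Conf \<Longrightarrow> shift d (0\<^sub>v d) x = x"
  by (auto simp: shift_def fun_eq_iff PiE_iff extensional_def restrict_def)

lemma sub_shift: "j \<in> G \<Longrightarrow> sub (shift d j x) = shift d (L *\<^sub>v j) (sub x)"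
  by (auto simp: sub_def shift_def fun_eq_iff restrict_def quo_add)

lemma subn_shift: "j \<in> G \<Longrightarrow> subn n (shift d j x) = shift d (Lpow n j) (subn n x)"
  by (induction n) (auto simp: sub_shift)

text \<open>Removing the remainder from v costs at most c, and what is left is \<open>L\<close>
  applied to the quotient; the gap of \<open>L\<close> thus becomes a contraction.\<close>

lemma quo_bound: assumes "v \<in> G" shows "(1 + 1 / real c) * znorm (quo v) \<le> znorm v + real c"
proof -
  have "L *\<^sub>v quo v = v - dig v"
    using assms by (subst (2) quo_dig(3)[OF assms]) (intro vec_eqI; simp)
  then have "znorm (L *\<^sub>v quo v) \<le> znorm v + znorm (dig v)"
    using znorm_diff[of v d "dig v"] assms by simp
  then show ?thesis using gap[of "quo v"] F_le[of "dig v"] assms by fastforce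
qed

lemma Fn_le: "f \<in> Fn n \<Longrightarrow> znorm f \<le> real (support_radius c n)"
proof (induction n arbitrary: f)
  case (Suc n)
  obtain h g where f: "h \<in> Fn n" "g \<in> F" "f = L *\<^sub>v h + g" using Suc.prems by (rule Fn_SucE)
  have h: "h \<in> G" using f by simp
  have "znorm f \<le> znorm (L *\<^sub>v h) + znorm g" unfolding f(3) by (rule znorm_triangle[of _ d]) (use h f in auto)
  also have "\<dots> \<le> real c * znorm h + real c" using lip[OF h] F_le[OF f(2)] by linarith
  also have "\<dots> \<le> real c * real (support_radius c n) + real c" using Suc.IH[OF f(1)] by (simp add: mult_left_mono)
  also have "\<dots> = real (c * support_radius c n + c)" by simp
  also have "\<dots> \<le> real (support_radius c (Suc n))"
  proof -
    have "1 \<le> c * c ^ n" using c_pos by simp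
    then have "c * 1 \<le> c * (c * c ^ n)" by (rule mult_le_mono2)
    then show ?thesis unfolding of_nat_le_iff support_radius_def by (simp add: algebra_simps)
  qed
  finally show ?case .
qed (simp add: Fn_0 support_radius_def znorm_zero)

lemma quo_ball:
  assumes r: "base_radius c \<le> r" and v: "v \<in> G" "znorm v \<le> real r + 3 * real c"
  shows "quo v \<in> B r"
proof -
  have c: "real c > 0" using c_pos by simp
  have "real (4 * c * c) \<le> real r" using r unfolding base_radius_def by (rule of_nat_mono)
  then have "4 * real c \<le> real r / real c" using c by (simp add: field_simps)
  then have "(1 + 1 / real c) * znorm (quo v) \<le> (1 + 1 / real c) * real r"
    using quo_bound[OF v(1)] v(2) by (simp add: algebra_simps)
  moreover have "1 + 1 / real c > 0" using c by (simp add: add_pos_pos)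
  ultimately show ?thesis using v by (simp add: lattice_ball_iff)
qed

text \<open>Addition with carries: the lowest digits of g, p and p' together with the carry e are
  divided by \<open>L\<close>, and the new carry lies again in \<open>B r\<close>. The radius does
  not depend on the number n of digits, which is why patches of the fixed size
  \<open>base_radius c\<close> suffice at every level in
  \<open>coincident_patches_period\<close>.\<close>

lemma quon_ball:
  assumes r: "base_radius c \<le> r"
  shows "g \<in> Fn n \<Longrightarrow> p \<in> Fn n \<Longrightarrow> p' \<in> Fn n \<Longrightarrow> e \<in> B r \<Longrightarrow> quon n (g + p - p' + e) \<in> B r"
proof (induction n arbitrary: g p p' e)
  case (Suc n)
  obtain g1 g0 where g: "g1 \<in> Fn n" "g0 \<in> F" "g = L *\<^sub>v g1 + g0" using Suc.prems(1) by (rule Fn_SucE)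
  obtain p1 p0 where p: "p1 \<in> Fn n" "p0 \<in> F" "p = L *\<^sub>v p1 + p0" using Suc.prems(2) by (rule Fn_SucE)
  obtain q1 q0 where q: "q1 \<in> Fn n" "q0 \<in> F" "p' = L *\<^sub>v q1 + q0" using Suc.prems(3) by (rule Fn_SucE)
  have G: "g1 \<in> G" "p1 \<in> G" "q1 \<in> G" "g0 \<in> G" "p0 \<in> G" "q0 \<in> G" "e \<in> G"
    using g p q Suc.prems by (auto simp: lattice_ball_iff)
  define e' where "e' = quo (g0 + p0 - q0 + e)"
  have e: "znorm e \<le> real r" using Suc.prems by (simp add: lattice_ball_iff)
  have "znorm (g0 + p0 - q0 + e) \<le> znorm g0 + znorm p0 + znorm q0 + znorm e"
    using G znorm_triangle[of "g0 + p0 - q0" d e] znorm_diff[of "g0 + p0" d q0] znorm_triangle[of g0 d p0] by simp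
  then have e': "e' \<in> B r"
    unfolding e'_def using e F_le[OF g(2)] F_le[OF p(2)] F_le[OF q(2)] G by (intro quo_ball r) auto
  have "g + p - p' + e = L *\<^sub>v (g1 + p1 - q1) + (g0 + p0 - q0 + e)"
    unfolding g p q using G by (intro vec_eqI) (auto simp: L_add L_diff)
  then have "quon (Suc n) (g + p - p' + e) = quon n (g1 + p1 - q1 + e')"
    using G by (simp add: quo_add e'_def)
  then show ?case using Suc.IH[OF g(1) p(1) q(1) e'] by simp
qed (auto simp: Fn_0 lattice_ball_iff)

lemma quon_ball': "base_radius c \<le> r \<Longrightarrow> g \<in> Fn n \<Longrightarrow> e \<in> B r \<Longrightarrow> quon n (g + e) \<in> B r"
  using quon_ball[of r g n "0\<^sub>v d" "0\<^sub>v d" e] Fn_G[of g n] by simp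

end

section \<open>Patterns and compactness\<close>

text \<open>Such a P defines a clopen set. One implication is enough, since x and y may be
  exchanged.\<close>

definition determined_on :: "nat \<Rightarrow> nat set \<Rightarrow> int Matrix.vec set \<Rightarrow> ((int Matrix.vec \<Rightarrow> nat) \<Rightarrow> bool) \<Rightarrow> bool" where
  "determined_on d A W P \<longleftrightarrow> finite W \<and> W \<subseteq> Zd d \<and>
     (\<forall>x \<in> Zd d \<rightarrow>\<^sub>E A. \<forall>y \<in> Zd d \<rightarrow>\<^sub>E A. (\<forall>k\<in>W. x k = y k) \<longrightarrow> P x \<longrightarrow> P y)"

lemma topspace_config_topology: "topspace (config_topology d A) = Zd d \<rightarrow>\<^sub>E A"
  by (simp add: config_topology_def)

lemma openin_determined_on:
  assumes "determined_on d A W P"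
  shows "openin (config_topology d A) {x \<in> Zd d \<rightarrow>\<^sub>E A. P x}"
proof (subst openin_subopen, intro ballI)
  fix x assume x: "x \<in> {x \<in> Zd d \<rightarrow>\<^sub>E A. P x}"
  define T where "T = (\<Pi>\<^sub>E i\<in>Zd d. if i \<in> W then {x i} else A)"
  have "openin (config_topology d A) T"
    unfolding T_def config_topology_def
  proof (rule product_topology_basis)
    show "openin (discrete_topology A) (if i \<in> W then {x i} else A)" for i
      using x assms by (auto simp: determined_on_def)
    show "finite {i. (if i \<in> W then {x i} else A) \<noteq> topspace (discrete_topology A)}"
      by (rule finite_subset[of _ W]) (use assms in \<open>auto simp: determined_on_def\<close>)
  qed
  moreover have "x \<in> T" using x by (auto simp: T_def PiE_iff)
  moreover have "T \<subseteq> {x \<in> Zd d \<rightarrow>\<^sub>E A. P x}"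
  proof
    fix y assume y: "y \<in> T"
    have yi: "y i \<in> (if i \<in> W then {x i} else A)" if "i \<in> Zd d" for i
      using y that by (auto simp: T_def PiE_iff)
    have "y i \<in> A" if "i \<in> Zd d" for i using yi[OF that] x that by (auto split: if_splits)
    then have yA: "y \<in> Zd d \<rightarrow>\<^sub>E A" using y by (auto simp: T_def PiE_iff)
    have "\<forall>k\<in>W. x k = y k"
    proof
      fix k assume "k \<in> W"
      then show "x k = y k" using yi[of k] assms by (auto simp: determined_on_def)
    qed
    then show "y \<in> {x \<in> Zd d \<rightarrow>\<^sub>E A. P x}"
      using x yA assms unfolding determined_on_def by blast
  qed
  ultimately show "\<exists>T. openin (config_topology d A) T \<and> x \<in> T \<and> T \<subseteq> {x \<in> Zd d \<rightarrow>\<^sub>E A. P x}" by blast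
qed

lemma closedin_determined_on:
  assumes "determined_on d A W P"
  shows "closedin (config_topology d A) {x \<in> Zd d \<rightarrow>\<^sub>E A. P x}"
proof -
  have "determined_on d A W (\<lambda>x. \<not> P x)"
    unfolding determined_on_def
  proof (intro conjI ballI impI notI)
    fix x y assume "x \<in> Zd d \<rightarrow>\<^sub>E A" "y \<in> Zd d \<rightarrow>\<^sub>E A" and eq: "\<forall>k\<in>W. x k = y k" and "\<not> P x" "P y"
    moreover have "\<forall>k\<in>W. y k = x k" using eq by simp
    ultimately show False using assms unfolding determined_on_def by blast
  qed (use assms in \<open>auto simp: determined_on_def\<close>)
  then have "openin (config_topology d A) {x \<in> Zd d \<rightarrow>\<^sub>E A. \<not> P x}" by (rule openin_determined_on)
  moreover have "{x \<in> Zd d \<rightarrow>\<^sub>E A. \<not> P x} = topspace (config_topology d A) - {x \<in> Zd d \<rightarrow>\<^sub>E A. P x}"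
    by (auto simp: topspace_config_topology)
  ultimately show ?thesis by (auto simp: closedin_def topspace_config_topology)
qed

lemma compact_space_config: "finite A \<Longrightarrow> compact_space (config_topology d A)"
  by (simp add: config_topology_def compact_space_product_topology compact_space_discrete_topology)

text \<open>Nested nonempty closed sets in a compact space: solutions on every finite window yield a
  single configuration.\<close>

lemma config_compactness:
  assumes A: "finite A" and det: "\<And>r. determined_on d A (W r) (Q r)"
    and ne: "\<And>r. \<exists>x \<in> Zd d \<rightarrow>\<^sub>E A. Q r x"
    and dec: "\<And>r s x. r \<le> s \<Longrightarrow> Q s x \<Longrightarrow> Q r x"
  shows "\<exists>x \<in> Zd d \<rightarrow>\<^sub>E A. \<forall>r::nat. Q r x"
proof -
  define C where "C r = {x \<in> Zd d \<rightarrow>\<^sub>E A. Q r x}" for r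
  have "(\<Inter>r. C r) \<noteq> {}"
  proof (rule compact_space_imp_nest[OF compact_space_config[OF A, of d]])
    show "closedin (config_topology d A) (C r)" for r
      unfolding C_def by (rule closedin_determined_on[OF det])
    show "C r \<noteq> {}" for r using ne[of r] by (auto simp: C_def)
    show "decseq C" using dec by (fastforce simp: decseq_def C_def)
  qed
  then show ?thesis by (auto simp: C_def)
qed

text \<open>\<open>pattern_bound c r\<close> bounds the number of partial patterns on a ball of radius \<open>r\<close>, and \<open>(2 ^ c) ^ c\<close> the
  number of maps from letters to sets of letters. By the pigeonhole principle they bound the level at which
  a pattern first occurs and the level from which on all letters occur.\<close>

definition pattern_bound :: "nat \<Rightarrow> nat \<Rightarrow> nat" where "pattern_bound c r = (c + 1) ^ ((2 * r + 1) ^ c)"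
definition recurrence_level :: "nat \<Rightarrow> nat \<Rightarrow> nat" where "recurrence_level c r = pattern_bound c r * pattern_bound c r + (2 ^ c) ^ c"
definition recurrence_radius :: "nat \<Rightarrow> nat \<Rightarrow> nat" where "recurrence_radius c r = 2 * support_radius c (recurrence_level c r)"

text \<open>In the graph of h the orbit is the only path from \<open>s 0\<close>, and a path of
  length n can be replaced by one with no more steps than there are edges.\<close>

lemma orbit_bound:
  assumes "finite Q" and s: "\<And>m. s m \<in> Q" and step: "\<And>m. s (Suc m) = h (s m)"
  shows "\<exists>m \<le> card Q. s n = s m"
proof -
  define R where "R = (\<lambda>x. (x, h x)) ` Q"
  have R: "finite R" "card R \<le> card Q" using assms by (auto simp: R_def card_image_le)
  have fwd: "(s 0, s n) \<in> R ^^ n" for n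
    by (induction n) (use s step in \<open>auto simp: R_def\<close>)
  have bwd: "(s 0, y) \<in> R ^^ n \<Longrightarrow> y = s n" for n y
    by (induction n arbitrary: y) (auto simp: R_def step)
  obtain m where "m \<le> card R" "(s 0, s n) \<in> R ^^ m" using relpow_finite_bounded[OF R(1), of n] fwd[of n] by blast
  then show ?thesis using bwd R(2) le_trans by blast
qed

section \<open>Occurrences of patterns and the substitution subshift\<close>

context csubst
begin

definition occ :: "nat \<Rightarrow> nat \<Rightarrow> int Matrix.vec set \<Rightarrow> (int Matrix.vec \<Rightarrow> nat) \<Rightarrow> bool" where
  "occ n a P u \<longleftrightarrow> (\<exists>t\<in>G. \<forall>k\<in>P. t + k \<in> Fn n \<and> iter \<zeta> n a (t + k) = u k)"

lemma occ_mono: "occ n a P u \<Longrightarrow> P' \<subseteq> P \<Longrightarrow> occ n a P' u"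
  by (auto simp: occ_def)

lemma X_iff_patterns: "x \<in> X \<longleftrightarrow> x \<in> Conf \<and> (\<forall>P p. finite P \<and> P \<subseteq> G \<and> p \<in> P \<rightarrow>\<^sub>E A \<and> occurs_in d P p G x \<longrightarrow>
    (\<exists>n>0. \<exists>a\<in>A. occurs_in d P p (Fn n) (iter \<zeta> n a)))"
  by (simp add: subst_shift_def)

lemma X_Conf: "x \<in> X \<Longrightarrow> x \<in> Conf"
  by (simp add: subst_shift_def)

lemma X_occ:
  assumes x: "x \<in> X" and P: "finite P" "P \<subseteq> G"
  shows "\<exists>n>0. \<exists>a\<in>A. occ n a P x"
proof -
  have p: "restrict x P \<in> P \<rightarrow>\<^sub>E A" using X_Conf[OF x] P by auto
  moreover have "occurs_in d P (restrict x P) (Zd d) x"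
    unfolding occurs_in_def
  proof (intro bexI[of _ "0\<^sub>v d"] ballI)
    fix k assume k: "k \<in> P"
    then have "0\<^sub>v d + k = k" "k \<in> Zd d" using P by auto
    then show "0\<^sub>v d + k \<in> Zd d \<and> x (0\<^sub>v d + k) = restrict x P k" using k by simp
  qed simp
  ultimately obtain n a where "n > 0" "a \<in> A" "occurs_in d P (restrict x P) (Fn n) (iter \<zeta> n a)"
    using x P unfolding X_iff_patterns by blast
  then show ?thesis by (auto simp: occ_def occurs_in_def)
qed

text \<open>A finite pattern that occurs in x, wherever it sits, is contained in a ball around the
  origin, so these windows suffice.\<close>

lemma X_I:
  assumes x: "x \<in> Conf" and occ: "\<And>r. \<exists>n>0. \<exists>a\<in>A. occ n a (B r) x"
  shows "x \<in> X"
  unfolding X_iff_patterns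
proof (intro conjI allI impI x, elim conjE)
  fix P p assume P: "finite P" "P \<subseteq> Zd d" and p: "p \<in> P \<rightarrow>\<^sub>E A" and "occurs_in d P p (Zd d) x"
  then obtain s where s: "s \<in> G" "\<And>k. k \<in> P \<Longrightarrow> x (s + k) = p k" by (auto simp: occurs_in_def)
  have "(\<lambda>k. s + k) ` P \<subseteq> G" using s P by auto
  then obtain r where r: "(\<lambda>k. s + k) ` P \<subseteq> B r"
    using finite_subset_lattice_ball[of "(\<lambda>k. s + k) ` P" d] P by auto
  obtain n a t where n: "n > 0" "a \<in> A" "t \<in> G"
    "\<And>k. k \<in> B r \<Longrightarrow> t + k \<in> Fn n \<and> iter \<zeta> n a (t + k) = x k" using occ[of r] by (auto simp: occ_def)
  have "occurs_in d P p (Fn n) (iter \<zeta> n a)"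
    unfolding occurs_in_def
  proof (intro bexI[of _ "t + s"] ballI)
    fix k assume k: "k \<in> P"
    then have kG: "k \<in> G" using P by auto
    have "t + s + k = t + (s + k)" using n s kG by (intro vec_eqI) auto
    then show "t + s + k \<in> Fn n \<and> iter \<zeta> n a (t + s + k) = p k"
      using n(4)[of "s + k"] r k s(2)[of k] by auto
  qed (use n s in auto)
  then show "\<exists>n>0. \<exists>a\<in>A. occurs_in d P p (Fn n) (iter \<zeta> n a)" using n by blast
qed

lemma shift_X [simp]:
  assumes x: "x \<in> X" and j: "j \<in> G" shows "shift d j x \<in> X"
proof (rule X_I)
  fix r
  have "finite ((\<lambda>k. j + k) ` B r)" "(\<lambda>k. j + k) ` B r \<subseteq> G" using finite_lattice_ball j by (auto simp: lattice_ball_iff)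
  then obtain n a t where n: "n > 0" "a \<in> A" "t \<in> G"
    "\<And>k. k \<in> B r \<Longrightarrow> t + (j + k) \<in> Fn n \<and> iter \<zeta> n a (t + (j + k)) = x (j + k)"
    using X_occ[OF x, of "(\<lambda>k. j + k) ` B r"] by (auto simp: occ_def)
  have "occ n a (B r) (shift d j x)"
    unfolding occ_def
  proof (intro bexI[of _ "t + j"] ballI)
    fix k assume k: "k \<in> B r"
    then have kG: "k \<in> G" by (auto simp: lattice_ball_iff)
    have "t + j + k = t + (j + k)" using n j kG by (intro vec_eqI) auto
    then show "t + j + k \<in> Fn n \<and> iter \<zeta> n a (t + j + k) = shift d j x k"
      using n(4)[OF k] kG by (simp add: shift_apply)
  qed (use n j in auto)
  then show "\<exists>n>0. \<exists>a\<in>A. occ n a (B r) (shift d j x)" using n by blast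
qed (use x j X_Conf in auto)

text \<open>The letters of \<open>sub x\<close> on a ball are read from x on the quotients of that
  ball; an occurrence of the latter at t in level n becomes one at L t in level n + 1.\<close>

lemma sub_X [simp]:
  assumes x: "x \<in> X" shows "sub x \<in> X"
proof (rule X_I)
  fix r
  have "finite (quo ` B r)" "quo ` B r \<subseteq> G" using finite_lattice_ball by (auto simp: lattice_ball_iff)
  then obtain n a t where n: "n > 0" "a \<in> A" "t \<in> G"
    "\<And>k. k \<in> B r \<Longrightarrow> t + quo k \<in> Fn n \<and> iter \<zeta> n a (t + quo k) = x (quo k)"
    using X_occ[OF x, of "quo ` B r"] by (auto simp: occ_def)
  have "occ (Suc n) a (B r) (sub x)"
    unfolding occ_def
  proof (intro bexI[of _ "L *\<^sub>v t"] ballI)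
    fix k assume k: "k \<in> B r"
    then have kG: "k \<in> G" by (auto simp: lattice_ball_iff)
    have "L *\<^sub>v t + k \<in> Fn (Suc n)" using n k kG by (subst Fn_Suc_iff) (auto simp: quo_add)
    then show "L *\<^sub>v t + k \<in> Fn (Suc n) \<and> iter \<zeta> (Suc n) a (L *\<^sub>v t + k) = sub x k"
      using n k kG by (simp add: iter_Suc quo_add sub_def)
  qed (use n in auto)
  then show "\<exists>n>0. \<exists>a\<in>A. occ n a (B r) (sub x)" using n by blast
qed (use x X_Conf in auto)

lemma subn_X [simp]: "x \<in> X \<Longrightarrow> subn n x \<in> X"
  by (induction n) auto

lemma determined_on_occ:
  assumes "finite P" "P \<subseteq> G" shows "determined_on d A P (\<lambda>x. \<exists>n>0. \<exists>a\<in>A. occ n a P x)"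
  using assms unfolding determined_on_def occ_def by fastforce

lemma ball_G: "B r \<subseteq> G"
  by (auto simp: lattice_ball_iff)

lemma closedin_X: "closedin (config_topology d A) X"
proof -
  define Q where "Q r = {x \<in> Conf. \<exists>n>0. \<exists>a\<in>A. occ n a (B r) x}" for r
  have "closedin (config_topology d A) (Q r)" for r
    unfolding Q_def by (rule closedin_determined_on[OF determined_on_occ[OF finite_lattice_ball ball_G]])
  then have "closedin (config_topology d A) (\<Inter>r. Q r)" by (intro closedin_Inter) auto
  moreover have "X = (\<Inter>r. Q r)"
  proof (intro subset_antisym subsetI INT_I)
    fix x r assume "x \<in> X"
    then show "x \<in> Q r" using X_Conf X_occ[OF _ finite_lattice_ball ball_G] by (simp add: Q_def)
  next
    fix x assume "x \<in> (\<Inter>r. Q r)"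
    then have "x \<in> Q r" for r by (rule INT_D) simp
    then show "x \<in> X" by (intro X_I) (simp_all add: Q_def)
  qed
  ultimately show ?thesis by simp
qed

section \<open>A bound for the level of first occurrence\<close>

lemma card_partial_patterns: "card (B r \<rightarrow>\<^sub>E insert None (Some ` A)) \<le> pattern_bound c r"
proof -
  have "card (insert None (Some ` A)) \<le> c + 1"
    using card_A finite_A by (auto simp: card_insert_if card_image)
  then have "card (insert None (Some ` A)) ^ card (B r) \<le> (c + 1) ^ card (B r)"
    by (rule power_mono) simp
  also have "\<dots> \<le> (c + 1) ^ ((2 * r + 1) ^ c)"
  proof (rule power_increasing)
    show "card (B r) \<le> (2 * r + 1) ^ c"
      using card_lattice_ball[of d r] power_increasing[OF d_le, of "2 * r + 1"] by simp
  qed simp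
  finally show ?thesis by (simp add: card_PiE finite_lattice_ball pattern_bound_def)
qed

text \<open>What is visible of the level-n image of a in a ball around t, with \<open>None\<close>
  outside its support. For r \<ge> \<open>base_radius c\<close> the state at L t + f is determined
  by the state at t, so the states are the vertices of a finite graph whose edges
  \<open>pstep\<close> are labelled by digits.\<close>

definition pstate :: "nat \<Rightarrow> nat \<Rightarrow> nat \<Rightarrow> int Matrix.vec \<Rightarrow> (int Matrix.vec \<Rightarrow> nat option)" where
  "pstate r n a t = (\<lambda>k\<in>B r. if t + k \<in> Fn n then Some (iter \<zeta> n a (t + k)) else None)"

definition pstep :: "nat \<Rightarrow> int Matrix.vec \<Rightarrow> (int Matrix.vec \<Rightarrow> nat option) \<Rightarrow> (int Matrix.vec \<Rightarrow> nat option)" where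
  "pstep r f s = (\<lambda>k\<in>B r. map_option (\<lambda>b. subst_rule \<zeta> b (dig (f + k))) (s (quo (f + k))))"

lemma quo_F_ball: "base_radius c \<le> r \<Longrightarrow> f \<in> F \<Longrightarrow> k \<in> B r \<Longrightarrow> quo (f + k) \<in> B r"
proof -
  assume a: "base_radius c \<le> r" "f \<in> F" "k \<in> B r"
  have "znorm (f + k) \<le> real r + 3 * real c"
    using znorm_triangle[of f d k] F_le[of f] a by (simp add: lattice_ball_iff)
  then show ?thesis using a by (intro quo_ball) (auto simp: lattice_ball_iff)
qed

lemma pstate_Suc:
  assumes r: "base_radius c \<le> r" and t: "t \<in> Fn n" and f: "f \<in> F"
  shows "pstate r (Suc n) a (L *\<^sub>v t + f) = pstep r f (pstate r n a t)"
proof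
  fix k
  show "pstate r (Suc n) a (L *\<^sub>v t + f) k = pstep r f (pstate r n a t) k"
  proof (cases "k \<in> B r")
    case k: True
    have G: "k \<in> G" "t \<in> G" "f \<in> G" using k t f by (auto simp: lattice_ball_iff)
    have eq: "L *\<^sub>v t + f + k = L *\<^sub>v t + (f + k)" using G by (intro vec_eqI) auto
    have q: "quo (f + k) \<in> B r" using quo_F_ball[OF r f k] .
    have "L *\<^sub>v t + (f + k) \<in> Fn (Suc n) \<longleftrightarrow> t + quo (f + k) \<in> Fn n"
      using G by (subst Fn_Suc_iff) (auto simp: quo_add)
    then show ?thesis using k q G by (auto simp: pstate_def pstep_def eq iter_Suc quo_add)
  qed (simp add: pstate_def pstep_def)
qed

text \<open>An occurrence at level n is a path of length n in the graph of states, starting at the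
  single letter a. Some path with the same endpoints has no more steps than there are edges, which
  explains the square of the number of states.\<close>

lemma occ_short:
  assumes r: "base_radius c \<le> r" and a: "a \<in> A" and occ: "occ n a (B r) u"
  shows "\<exists>m \<le> pattern_bound c r * pattern_bound c r. occ m a (B r) u"
proof -
  define S where "S = B r \<rightarrow>\<^sub>E insert None (Some ` A)"
  define R where "R = {(s, pstep r f s) | s f. s \<in> S \<and> f \<in> F}"
  have stepS: "pstep r f s \<in> S" if "s \<in> S" "f \<in> F" for s f
    unfolding S_def
  proof (rule PiE_I)
    fix k assume k: "k \<in> B r"
    have fk: "f + k \<in> G" using that k by (auto simp: lattice_ball_iff)
    have "s (quo (f + k)) \<in> insert None (Some ` A)"
      using that(1) quo_F_ball[OF r that(2) k] unfolding S_def by blast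
    then show "pstep r f s k \<in> insert None (Some ` A)" using k fk by (auto simp: pstep_def)
  qed (simp add: pstep_def)
  have finS: "finite S" unfolding S_def by (intro finite_PiE finite_lattice_ball) (simp add: finite_A)
  have RS: "R \<subseteq> S \<times> S" using stepS by (auto simp: R_def)
  have finR: "finite R" using RS finS finite_subset by blast
  have "card R \<le> card (S \<times> S)" by (rule card_mono[OF _ RS]) (simp add: finS)
  also have "\<dots> \<le> pattern_bound c r * pattern_bound c r"
    using card_partial_patterns[of r] by (simp add: card_cartesian_product S_def mult_le_mono)
  finally have cardR: "card R \<le> pattern_bound c r * pattern_bound c r" .
  have stS: "pstate r n a t \<in> S" for n t
    using iter_A[OF a] by (auto simp: pstate_def S_def)
  have fwd: "(pstate r 0 a (0\<^sub>v d), pstate r n a t) \<in> R ^^ n" if "t \<in> Fn n" for n t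
    using that
  proof (induction n arbitrary: t)
    case (Suc n)
    obtain h g where t: "h \<in> Fn n" "g \<in> F" "t = L *\<^sub>v h + g" using Suc.prems by (rule Fn_SucE)
    have "(pstate r n a h, pstate r (Suc n) a t) \<in> R"
      unfolding R_def t(3) using pstate_Suc[OF r t(1,2)] stS t(2) by blast
    then show ?case using Suc.IH[OF t(1)] by auto
  qed (simp add: Fn_0)
  have bwd: "\<exists>t\<in>Fn n. s = pstate r n a t" if "(pstate r 0 a (0\<^sub>v d), s) \<in> R ^^ n" for n s
    using that
  proof (induction n arbitrary: s)
    case (Suc n)
    then obtain s' where s': "(pstate r 0 a (0\<^sub>v d), s') \<in> R ^^ n" "(s', s) \<in> R" by auto
    obtain t where t: "t \<in> Fn n" "s' = pstate r n a t" using Suc.IH[OF s'(1)] by blast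
    obtain f where f: "f \<in> F" "s = pstep r f s'" using s'(2) by (auto simp: R_def)
    show ?case using pstate_Suc[OF r t(1) f(1), of a] Fn_Suc_intro[OF t(1) f(1)] f t by metis
  qed (simp add: Fn_0)
  obtain t where t: "t \<in> G" "\<And>k. k \<in> B r \<Longrightarrow> t + k \<in> Fn n \<and> iter \<zeta> n a (t + k) = u k"
    using occ by (auto simp: occ_def)
  \<comment> \<open>The origin belongs to the ball, so the centre t of the occurrence lies in the
    support and has a digit expansion, that is, a path leading to it.\<close>
  have "t \<in> Fn n" using t(2)[OF zero_in_lattice_ball] t(1) by simp
  then obtain m where m: "m \<le> card R" "(pstate r 0 a (0\<^sub>v d), pstate r n a t) \<in> R ^^ m"
    using fwd relpow_finite_bounded[OF finR, of n] by blast
  obtain t' where t': "t' \<in> Fn m" "pstate r n a t = pstate r m a t'" using bwd[OF m(2)] by blast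
  have "occ m a (B r) u"
    unfolding occ_def
  proof (intro bexI[of _ t'] ballI)
    fix k assume k: "k \<in> B r"
    show "t' + k \<in> Fn m \<and> iter \<zeta> m a (t' + k) = u k"
      using fun_cong[OF t'(2), of k] t(2)[OF k] k by (auto simp: pstate_def split: if_splits)
  qed (use t' in simp)
  then show ?thesis using m(1) cardR le_trans by blast
qed

lemma occ_lift:
  assumes "occ n a P u" "v \<in> Fn m" "iter \<zeta> m b v = a" "P \<subseteq> G"
  shows "occ (m + n) b P u"
proof -
  obtain t where t: "t \<in> G" "\<And>k. k \<in> P \<Longrightarrow> t + k \<in> Fn n \<and> iter \<zeta> n a (t + k) = u k"
    using assms(1) by (auto simp: occ_def)
  have v: "v \<in> G" using assms by simp
  show ?thesis
    unfolding occ_def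
  proof (intro bexI[of _ "Lpow n v + t"] ballI)
    fix k assume k: "k \<in> P"
    then have kG: "k \<in> G" using assms(4) by auto
    have eq: "Lpow n v + t + k = Lpow n v + (t + k)" using v t(1) kG by (intro vec_eqI) auto
    show "Lpow n v + t + k \<in> Fn (m + n) \<and> iter \<zeta> (m + n) b (Lpow n v + t + k) = u k"
      unfolding eq using Fn_add[OF assms(2), of "t + k" n] iter_add[OF assms(2), of "t + k" n b] t(2)[OF k] assms(3)
      by simp
  qed (use v t(1) in simp)
qed

end

section \<open>Consequences of primitivity\<close>

locale prim_subst = csubst +
  assumes prim: "primitive \<zeta>"
begin

lemma letters_Suc: "iter \<zeta> (Suc m) a ` Fn (Suc m) = (\<Union>b\<in>iter \<zeta> m a ` Fn m. iter \<zeta> 1 b ` Fn 1)"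
proof (intro subset_antisym subsetI)
  fix b assume "b \<in> iter \<zeta> (Suc m) a ` Fn (Suc m)"
  then obtain v where b: "v \<in> Fn (Suc m)" "b = iter \<zeta> (Suc m) a v" by blast
  obtain j f where v: "j \<in> Fn m" "f \<in> F" "v = L *\<^sub>v j + f" using b(1) by (rule Fn_SucE)
  have "b = iter \<zeta> 1 (iter \<zeta> m a j) f"
    unfolding b(2) v(3) using iter_Suc'[OF v(1,2)] iter_1_apply[OF cs v(2)] by simp
  then show "b \<in> (\<Union>b\<in>iter \<zeta> m a ` Fn m. iter \<zeta> 1 b ` Fn 1)"
    using v iter_supp_1[OF cs] by blast
next
  fix b assume "b \<in> (\<Union>b\<in>iter \<zeta> m a ` Fn m. iter \<zeta> 1 b ` Fn 1)"
  then obtain j f where j: "j \<in> Fn m" "f \<in> F" "b = iter \<zeta> 1 (iter \<zeta> m a j) f"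
    unfolding iter_supp_1[OF cs] by blast
  have "b = iter \<zeta> (Suc m) a (L *\<^sub>v j + f)"
    unfolding j(3) using iter_Suc'[OF j(1,2)] iter_1_apply[OF cs j(2)] by simp
  then show "b \<in> iter \<zeta> (Suc m) a ` Fn (Suc m)" using Fn_Suc_intro[OF j(1,2)] by blast
qed

text \<open>The exponent in \<open>primitive\<close> comes without a bound. The table of the letters
  in all level-m images evolves by a fixed map on a finite set, so the full table also appears at a
  level n' bounded by the number of tables. A larger level m is reduced to n' through the letter at
  the origin of the level m - n' image.\<close>

lemma full_level: "m \<ge> (2 ^ c) ^ c \<Longrightarrow> a \<in> A \<Longrightarrow> b \<in> A \<Longrightarrow> \<exists>v\<in>Fn m. iter \<zeta> m a v = b"
proof -
  define s where "s m = (\<lambda>a\<in>A. iter \<zeta> m a ` Fn m)" for m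
  define h where "h S = (\<lambda>a\<in>A. \<Union>b\<in>S a. iter \<zeta> 1 b ` Fn 1)" for S :: "nat \<Rightarrow> nat set"
  have step: "s (Suc m) = h (s m)" for m
  proof
    fix a
    have "iter \<zeta> (Suc m) a ` Fn (Suc m) = (\<Union>b\<in>iter \<zeta> m a ` Fn m. iter \<zeta> 1 b ` Fn 1)"
      by (rule letters_Suc)
    then show "s (Suc m) a = h (s m) a" by (simp add: s_def h_def)
  qed
  have fin: "finite (A \<rightarrow>\<^sub>E Pow A)" using finite_A by (simp add: finite_PiE)
  have "s m \<in> A \<rightarrow>\<^sub>E Pow A" for m using iter_A by (auto simp: s_def)
  note orb = orbit_bound[where Q = "A \<rightarrow>\<^sub>E Pow A" and s = s and h = h, OF fin this step]
  have "card (A \<rightarrow>\<^sub>E Pow A) = (2 ^ card A) ^ card A" using finite_A by (simp add: card_PiE card_Pow)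
  also have "\<dots> \<le> (2 ^ c) ^ card A" using card_A by (intro power_mono power_increasing) auto
  also have "\<dots> \<le> (2 ^ c) ^ c" using card_A by (intro power_increasing) auto
  finally have card: "card (A \<rightarrow>\<^sub>E Pow A) \<le> (2 ^ c) ^ c" .
  obtain n where n: "\<And>a b. a \<in> A \<Longrightarrow> b \<in> A \<Longrightarrow> \<exists>v\<in>Fn n. iter \<zeta> n a v = b"
    using prim unfolding primitive_def by blast
  obtain n' where n': "n' \<le> card (A \<rightarrow>\<^sub>E Pow A)" "s n = s n'" using orb[of n] by (elim exE conjE)
  assume m: "m \<ge> (2 ^ c) ^ c" and a: "a \<in> A" and b: "b \<in> A"
  define e where "e = iter \<zeta> (m - n') a (0\<^sub>v d)"
  have e: "e \<in> A" unfolding e_def by (rule iter_A[OF a zero_Fn])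
  have "b \<in> iter \<zeta> n e ` Fn n" using n[OF e b] by auto
  then have "b \<in> iter \<zeta> n' e ` Fn n'" using fun_cong[OF n'(2), of e] e by (simp add: s_def)
  then obtain v where v: "v \<in> Fn n'" "iter \<zeta> n' e v = b" by blast
  have "m - n' + n' = m" using n'(1) card m by linarith
  then show ?thesis
    using iter_add[OF zero_Fn v(1), of "m - n'" a] Fn_add[OF zero_Fn v(1), of "m - n'"] v(2)
    by (intro bexI[of _ "Lpow n' (0\<^sub>v d) + v"]) (simp_all add: e_def)
qed

text \<open>The pattern first occurs in the image of some letter a, and a occurs in the image of b;
  \<open>recurrence_level\<close> is the sum of the two level bounds.\<close>

lemma occ_all:
  assumes u: "u \<in> X" and r: "base_radius c \<le> r" and m: "recurrence_level c r \<le> m" and b: "b \<in> A"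
  shows "occ m b (B r) u"
proof -
  obtain n a where a: "a \<in> A" "occ n a (B r) u"
    using X_occ[OF u finite_lattice_ball ball_G] by blast
  obtain n' where n': "n' \<le> pattern_bound c r * pattern_bound c r" "occ n' a (B r) u" using occ_short[OF r a] by blast
  have le: "(2 ^ c) ^ c \<le> m - n'" "n' \<le> m" using m n'(1) unfolding recurrence_level_def by linarith+
  obtain v where "v \<in> Fn (m - n')" "iter \<zeta> (m - n') b v = a" using full_level[OF le(1) b a(1)] by blast
  from occ_lift[OF n'(2) this ball_G] le(2) show ?thesis by simp
qed

end

section \<open>Desubstitution and recognizability\<close>

context prim_subst
begin

lemma X_occ_large:
  assumes x: "x \<in> X" and P: "finite P" "P \<subseteq> G"
  shows "\<exists>n\<ge>N. \<exists>a\<in>A. occ n a P x"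
proof -
  obtain n a where n: "a \<in> A" "occ n a P x" using X_occ[OF assms] by blast
  obtain v where "v \<in> Fn ((2 ^ c) ^ c + N)" "iter \<zeta> ((2 ^ c) ^ c + N) a v = a"
    using full_level[of "(2 ^ c) ^ c + N" a a] n(1) by auto
  from occ_lift[OF n(2) this P(2)] n(1) show ?thesis by (intro exI[of _ "(2 ^ c) ^ c + N + n"]) auto
qed

text \<open>Finite form of desubstitution: the window of x sits in an image of level n, and the
  image of level n - 1, recentred at the quotient of that position, provides the window of
  y.\<close>

lemma desubstitution_window:
  assumes x: "x \<in> X"
  shows "\<exists>g\<in>F. \<exists>y\<in>Conf. (\<forall>k\<in>B r. sub y (g + k) = x k) \<and>
    (\<exists>n>0. \<exists>a\<in>A. occ n a ((\<lambda>k. quo (g + k)) ` B r) y)"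
proof -
  \<comment> \<open>Level at least 2 keeps the level n - 1 of the preimage positive, as membership
    in \<open>X\<close> demands.\<close>
  obtain n a where n: "n \<ge> 2" "a \<in> A" "occ n a (B r) x"
    using X_occ_large[OF x finite_lattice_ball ball_G] by blast
  define m where "m = n - 1"
  have m: "n = Suc m" "m > 0" using n by (auto simp: m_def)
  obtain t where t: "t \<in> G" "\<And>k. k \<in> B r \<Longrightarrow> t + k \<in> Fn n \<and> iter \<zeta> n a (t + k) = x k"
    using n(3) by (auto simp: occ_def)
  obtain j g where j: "j \<in> G" "g \<in> F" "t = L *\<^sub>v j + g" using t(1) by (rule decompE)
  \<comment> \<open>Outside the support the letter a is a filler that makes y a configuration; the
    window never reads it.\<close>
  define y where "y = (\<lambda>i\<in>G. if j + i \<in> Fn m then iter \<zeta> m a (j + i) else a)"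
  have y: "y \<in> Conf" using iter_A[OF n(2)] n(2) by (auto simp: y_def)
  have yk: "j + quo (g + k) \<in> Fn m" "sub y (g + k) = x k" if k: "k \<in> B r" for k
  proof -
    have kG: "k \<in> G" "g \<in> G" using k j by (auto simp: lattice_ball_iff)
    have tk: "t + k = L *\<^sub>v j + (g + k)" unfolding j(3) using kG j(1) by (intro vec_eqI) auto
    have q: "quo (t + k) = j + quo (g + k)" "dig (t + k) = dig (g + k)"
      unfolding tk using kG j(1) by (simp_all add: quo_add)
    show *: "j + quo (g + k) \<in> Fn m"
      using t(2)[OF k] Fn_Suc_iff[of "t + k" m] t(1) kG by (simp add: m q)
    have "x k = subst_rule \<zeta> (iter \<zeta> m a (j + quo (g + k))) (dig (g + k))"
      using t(2)[OF k] iter_Suc[of "t + k" m a] t(1) kG by (simp add: m q)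
    then show "sub y (g + k) = x k" using * kG by (simp add: sub_def y_def)
  qed
  have "occ m a ((\<lambda>k. quo (g + k)) ` B r) y"
    unfolding occ_def
  proof (intro bexI[of _ j] ballI)
    fix i assume "i \<in> (\<lambda>k. quo (g + k)) ` B r"
    then obtain k where k: "k \<in> B r" "i = quo (g + k)" by blast
    have "i \<in> G" using k j by (auto simp: lattice_ball_iff)
    then show "j + i \<in> Fn m \<and> iter \<zeta> m a (j + i) = y i" using yk(1)[OF k(1)] k(2) by (simp add: y_def)
  qed (rule j)
  then show ?thesis using j(2) y yk(2) m(2) n(2) by blast
qed

text \<open>Compactness turns the windows into one y. The offset g must not vary with the window, so
  it is fixed first, by a pigeonhole argument over the finite support.\<close>

lemma desubstitution:
  assumes x: "x \<in> X" shows "\<exists>g\<in>F. \<exists>y\<in>X. x = shift d g (sub y)"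
proof -
  define Q where "Q g r y \<longleftrightarrow> (\<forall>k\<in>B r. sub y (g + k) = x k) \<and>
    (\<exists>n>0. \<exists>a\<in>A. occ n a ((\<lambda>k. quo (g + k)) ` B r) y)" for g r y
  have dec: "Q g r y" if rs: "r \<le> s" and Qs: "Q g s y" for g r s y
  proof -
    have sub: "B r \<subseteq> B s" by (rule lattice_ball_mono[OF rs])
    obtain n a where n: "n > 0" "a \<in> A" "occ n a ((\<lambda>k. quo (g + k)) ` B s) y"
      using Qs unfolding Q_def by (elim conjE exE bexE)
    have "occ n a ((\<lambda>k. quo (g + k)) ` B r) y" by (rule occ_mono[OF n(3) image_mono[OF sub]])
    moreover have "\<forall>k\<in>B r. sub y (g + k) = x k" using Qs sub unfolding Q_def by blast
    ultimately show ?thesis unfolding Q_def using n(1,2) by (intro conjI exI bexI)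
  qed
  have "\<exists>g\<in>F. \<forall>r. \<exists>y\<in>Conf. Q g r y"
  proof (rule ccontr)
    assume "\<not> ?thesis"
    then have "\<forall>g\<in>F. \<exists>r. \<not> (\<exists>y\<in>Conf. Q g r y)" by blast
    then obtain R where R: "\<And>g. g \<in> F \<Longrightarrow> \<not> (\<exists>y\<in>Conf. Q g (R g) y)" by metis
    obtain g y where g: "g \<in> F" "y \<in> Conf" "Q g (Max (R ` F)) y"
      using desubstitution_window[OF x, of "Max (R ` F)"] unfolding Q_def by blast
    have "R g \<le> Max (R ` F)" using g(1) finite_F by (intro Max_ge) auto
    then show False using dec[OF _ g(3)] g(1,2) R by blast
  qed
  then obtain g where g: "g \<in> F" "\<And>r. \<exists>y\<in>Conf. Q g r y" by blast
  have gG: "g \<in> G" using g(1) by simp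
  have det: "determined_on d A ((\<lambda>k. quo (g + k)) ` B r) (Q g r)" for r
    unfolding determined_on_def
  proof (intro conjI ballI impI)
    show "finite ((\<lambda>k. quo (g + k)) ` B r)" by (simp add: finite_lattice_ball)
    show "(\<lambda>k. quo (g + k)) ` B r \<subseteq> G" using gG by (auto simp: lattice_ball_iff)
    fix y z assume eq: "\<forall>k\<in>(\<lambda>k. quo (g + k)) ` B r. y k = z k" and Q: "Q g r y"
    have "sub z (g + k) = sub y (g + k)" if "k \<in> B r" for k
      using eq that gG by (simp add: sub_def)
    moreover have "occ n a ((\<lambda>k. quo (g + k)) ` B r) y \<longleftrightarrow> occ n a ((\<lambda>k. quo (g + k)) ` B r) z" for n a
      using eq unfolding occ_def by simp
    ultimately show "Q g r z" using Q unfolding Q_def by simp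
  qed
  obtain y where y: "y \<in> Conf" "\<And>r. Q g r y"
    using config_compactness[of A d "\<lambda>r. (\<lambda>k. quo (g + k)) ` B r" "Q g", OF finite_A det g(2)] dec by blast
  have "x = shift d g (sub y)"
  proof (rule PiE_ext[OF X_Conf[OF x]])
    fix k assume k: "k \<in> G"
    then obtain r where "k \<in> B r" using finite_subset_lattice_ball[of "{k}" d] by auto
    then show "x k = shift d g (sub y) k" using y(2)[of r] k by (simp add: Q_def shift_apply)
  qed (use y(1) gG in simp)
  moreover have "y \<in> X"
  proof (rule X_I[OF y(1)])
    fix r
    have "(\<lambda>i. L *\<^sub>v i - g) ` B r \<subseteq> G" using gG by (auto simp: lattice_ball_iff)
    then obtain s where s: "(\<lambda>i. L *\<^sub>v i - g) ` B r \<subseteq> B s"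
      using finite_subset_lattice_ball[of "(\<lambda>i. L *\<^sub>v i - g) ` B r" d] finite_lattice_ball by auto
    \<comment> \<open>The point L i - g has quotient i once g is added, so the windows on which y is
      known to be admissible exhaust Z^d.\<close>
    have "B r \<subseteq> (\<lambda>k. quo (g + k)) ` B s"
    proof
      fix i assume i: "i \<in> B r"
      then have iG: "i \<in> G" by (auto simp: lattice_ball_iff)
      have "g + (L *\<^sub>v i - g) = L *\<^sub>v i + 0\<^sub>v d" using iG gG by (intro vec_eqI) auto
      then have "quo (g + (L *\<^sub>v i - g)) = i" using quo_eq[OF iG zero_F] by simp
      then show "i \<in> (\<lambda>k. quo (g + k)) ` B s" using s i by (intro image_eqI[of _ _ "L *\<^sub>v i - g"]) auto
    qed
    then show "\<exists>n>0. \<exists>a\<in>A. occ n a (B r) y" using y(2)[of s] occ_mono unfolding Q_def by blast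
  qed
  ultimately show ?thesis using g(1) by blast
qed

lemma desubstitution_pow: "x \<in> X \<Longrightarrow> \<exists>g\<in>Fn n. \<exists>y\<in>X. x = shift d g (subn n y)"
proof (induction n arbitrary: x)
  case 0
  then show ?case using shift_zero[OF X_Conf] by (auto simp: Fn_0)
next
  case (Suc n)
  obtain g y where g: "g \<in> F" "y \<in> X" "x = shift d g (sub y)" using desubstitution[OF Suc.prems] by blast
  obtain h z where h: "h \<in> Fn n" "z \<in> X" "y = shift d h (subn n z)" using Suc.IH[OF g(2)] by blast
  have G: "g \<in> G" "h \<in> G" using g h by auto
  have "x = shift d (g + L *\<^sub>v h) (subn (Suc n) z)"
    unfolding g(3) h(3) using G by (simp add: sub_shift shift_shift)
  moreover have "g + L *\<^sub>v h = L *\<^sub>v h + g" using G by (intro vec_eqI) auto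
  ultimately show ?case using Fn_Suc_intro[OF h(1) g(1)] h(2) by auto
qed

text \<open>The point t lies in a level-N block of x, and every such block contains every admissible
  window of radius r. Both t and the occurrence belong to that block, so their distance is at most
  twice the bound for its support.\<close>

lemma repetitive:
  assumes x: "x \<in> X" and u: "u \<in> X" and t: "t \<in> G" and r: "base_radius c \<le> r"
  shows "\<exists>s\<in>G. znorm (s - t) \<le> real (recurrence_radius c r) \<and> (\<forall>k\<in>B r. x (s + k) = u k)"
proof -
  define N where "N = recurrence_level c r"
  obtain g y where g: "g \<in> Fn N" "y \<in> X" "x = shift d g (subn N y)" using desubstitution_pow[OF x] by blast
  have gG: "g \<in> G" using g(1) by simp
  obtain f where f: "f \<in> Fn N" "g + t = Lpow N (quon N (g + t)) + f" using quon_decomp[of "g + t" N] gG t by auto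
  define j where "j = quon N (g + t)"
  have j: "j \<in> G" "f \<in> G" using gG t f(1) by (auto simp: j_def)
  have "y j \<in> A" using X_Conf[OF g(2)] j(1) by blast
  then obtain t0 where t0: "t0 \<in> G" "\<And>k. k \<in> B r \<Longrightarrow> t0 + k \<in> Fn N \<and> iter \<zeta> N (y j) (t0 + k) = u k"
    using occ_all[OF u r, of N "y j"] by (auto simp: occ_def N_def)
  have t0F: "t0 \<in> Fn N" using t0(2)[OF zero_in_lattice_ball] t0(1) by simp
  define s where "s = Lpow N j + t0 - g"
  have s: "s \<in> G" using j t0(1) gG by (simp add: s_def)
  have "s - t = Lpow N j + t0 - (g + t)" unfolding s_def using j t0(1) gG t by (intro vec_eqI) auto
  also have "\<dots> = t0 - f"
    unfolding f(2)[folded j_def] using j t0(1) by (intro vec_eqI) auto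
  finally have "znorm (s - t) \<le> znorm t0 + znorm f" using znorm_diff[OF t0(1) j(2)] by simp
  also have "\<dots> \<le> real (recurrence_radius c r)" using Fn_le[OF t0F] Fn_le[OF f(1)] by (simp add: recurrence_radius_def N_def)
  finally have "znorm (s - t) \<le> real (recurrence_radius c r)" .
  moreover have "x (s + k) = u k" if k: "k \<in> B r" for k
  proof -
    have kG: "k \<in> G" using k by (auto simp: lattice_ball_iff)
    have "g + (s + k) = Lpow N j + (t0 + k)" unfolding s_def using j t0(1) gG kG by (intro vec_eqI) auto
    then show ?thesis using subn_eq[OF j(1), of "t0 + k" N y] t0(2)[OF k] kG s by (simp add: g(3) shift_apply)
  qed
  ultimately show ?thesis using s by blast
qed

text \<open>The window of w occurs near the origin in \<zeta>^n(y), at a place s, and hence also in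
  \<zeta>^n(x), at f + s. If the residues p and q of the two places modulo L^n agreed, then f would
  be a multiple of L^n.\<close>

lemma two_decompositions:
  assumes x: "x \<in> X" and y: "y \<in> X" and f: "f \<in> G" "\<not> (\<exists>h\<in>G. f = Lpow n h)" and w: "w \<in> X"
    and m: "base_radius c \<le> m" and eq: "\<And>k. k \<in> B (recurrence_radius c m + m) \<Longrightarrow> subn n x (f + k) = subn n y k"
  shows "\<exists>p\<in>Fn n. \<exists>q\<in>Fn n. \<exists>z\<in>X. \<exists>z'\<in>X. p \<noteq> q \<and>
    (\<forall>k\<in>B m. w k = subn n z (p + k)) \<and> (\<forall>k\<in>B m. w k = subn n z' (q + k))"
proof -
  obtain s where s: "s \<in> G" "znorm s \<le> real (recurrence_radius c m)" "\<And>k. k \<in> B m \<Longrightarrow> subn n y (s + k) = w k"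
  proof -
    obtain s where "s \<in> G" "znorm (s - 0\<^sub>v d) \<le> real (recurrence_radius c m)" "\<forall>k\<in>B m. subn n y (s + k) = w k"
      using repetitive[OF subn_X[OF y] w _ m, of "0\<^sub>v d" n] by auto
    moreover have "s - 0\<^sub>v d = s" using \<open>s \<in> G\<close> by (intro vec_eqI) auto
    ultimately show ?thesis using that by simp
  qed
  obtain p where p: "p \<in> Fn n" "s = Lpow n (quon n s) + p" using quon_decomp[OF s(1)] by blast
  obtain q where q: "q \<in> Fn n" "f + s = Lpow n (quon n (f + s)) + q"
    using quon_decomp[OF add_carrier_vec[OF f(1) s(1)], of n] by blast
  define i j where "i = quon n s" and "j = quon n (f + s)"
  have G: "i \<in> G" "j \<in> G" "p \<in> G" "q \<in> G" using f s p q by (auto simp: i_def j_def)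
  have "w k = subn n (shift d i y) (p + k)" if k: "k \<in> B m" for k
  proof -
    have kG: "k \<in> G" using k by (auto simp: lattice_ball_iff)
    have "Lpow n i + (p + k) = (Lpow n i + p) + k" using G kG by (intro vec_eqI) auto
    also have "\<dots> = s + k" using p(2) by (simp add: i_def)
    finally have "Lpow n i + (p + k) = s + k" .
    then show ?thesis using G kG s(3)[OF k] by (simp add: subn_shift shift_apply)
  qed
  moreover have "w k = subn n (shift d j x) (q + k)" if k: "k \<in> B m" for k
  proof -
    have kG: "k \<in> G" using k by (auto simp: lattice_ball_iff)
    have "Lpow n j + (q + k) = (Lpow n j + q) + k" using G kG by (intro vec_eqI) auto
    also have "\<dots> = f + (s + k)" using f s kG by (subst q(2)[folded j_def, symmetric]) (auto intro!: vec_eqI)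
    finally have e: "Lpow n j + (q + k) = f + (s + k)" .
    have "s + k \<in> B (recurrence_radius c m + m)"
      using znorm_triangle[OF s(1) kG] s k kG by (simp add: lattice_ball_iff)
    then show ?thesis using e G kG s(3)[OF k] eq[of "s + k"] by (simp add: subn_shift shift_apply)
  qed
  moreover have "p \<noteq> q"
  proof
    assume pq: "p = q"
    have "f = (f + s) - s" using f s by (intro vec_eqI) auto
    also have "\<dots> = (Lpow n j + p) - (Lpow n i + p)" using p(2) q(2) pq by (simp add: i_def j_def)
    also have "\<dots> = Lpow n (j - i)" using G by (intro vec_eqI) (auto simp: Lpow_diff)
    finally have "f = Lpow n (j - i)" .
    moreover have "j - i \<in> G" using G by simp
    ultimately show False using f(2) by blast
  qed
  ultimately show ?thesis using p(1) q(1) x y G by (meson shift_X)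
qed

text \<open>Each of the preimages z and z' has again two decompositions, so their number doubles
  with every round of l levels. The window does not shrink: for m \<ge> \<open>base_radius c\<close>
  the quotients of p + k stay in \<open>B m\<close>. Uniqueness of digit expansions keeps the
  residues distinct.\<close>

lemma many_decompositions:
  assumes m: "base_radius c \<le> m"
    and two: "\<And>w. w \<in> X \<Longrightarrow> \<exists>p\<in>Fn l. \<exists>q\<in>Fn l. \<exists>z\<in>X. \<exists>z'\<in>X. p \<noteq> q \<and>
      (\<forall>k\<in>B m. w k = subn l z (p + k)) \<and> (\<forall>k\<in>B m. w k = subn l z' (q + k))"
  shows "w \<in> X \<Longrightarrow> \<exists>D \<subseteq> Fn (l * n). card D = 2 ^ n \<and> (\<forall>p\<in>D. \<exists>z\<in>X. \<forall>k\<in>B m. w k = subn (l * n) z (p + k))"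
proof (induction n arbitrary: w)
  case 0
  have "w k = subn (l * 0) w (0\<^sub>v d + k)" if "k \<in> B m" for k using that by (auto simp: lattice_ball_iff)
  then show ?case using 0 by (intro exI[of _ "{0\<^sub>v d}"]) (auto simp: Fn_0)
next
  case (Suc n)
  obtain p q z z' where pq: "p \<in> Fn l" "q \<in> Fn l" "z \<in> X" "z' \<in> X" "p \<noteq> q"
    and z: "\<And>k. k \<in> B m \<Longrightarrow> w k = subn l z (p + k)" and z': "\<And>k. k \<in> B m \<Longrightarrow> w k = subn l z' (q + k)"
    using two[OF Suc.prems] by blast
  obtain D where D: "D \<subseteq> Fn (l * n)" "card D = 2 ^ n"
    "\<And>p. p \<in> D \<Longrightarrow> \<exists>y\<in>X. \<forall>k\<in>B m. z k = subn (l * n) y (p + k)" using Suc.IH[OF pq(3)] by blast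
  obtain D' where D': "D' \<subseteq> Fn (l * n)" "card D' = 2 ^ n"
    "\<And>p. p \<in> D' \<Longrightarrow> \<exists>y\<in>X. \<forall>k\<in>B m. z' k = subn (l * n) y (p + k)" using Suc.IH[OF pq(4)] by blast
  define E E' where "E = (\<lambda>e. Lpow l e + p) ` D" and "E' = (\<lambda>e. Lpow l e + q) ` D'"
  have lift: "\<exists>y\<in>X. \<forall>k\<in>B m. w k = subn (l * Suc n) y (Lpow l e + p + k)"
    if p: "p \<in> Fn l" and e: "e \<in> Fn (l * n)" and z: "\<And>k. k \<in> B m \<Longrightarrow> w k = subn l z (p + k)"
      and y: "\<exists>y\<in>X. \<forall>k\<in>B m. z k = subn (l * n) y (e + k)" for p z e
  proof -
    obtain y where y: "y \<in> X" "\<And>k. k \<in> B m \<Longrightarrow> z k = subn (l * n) y (e + k)" using y by blast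
    have "w k = subn (l * Suc n) y (Lpow l e + p + k)" if k: "k \<in> B m" for k
    proof -
      have G: "k \<in> G" "p \<in> G" "e \<in> G" using k p e by (auto simp: lattice_ball_iff)
      define i where "i = quon l (p + k)"
      obtain f where f: "f \<in> Fn l" "p + k = Lpow l i + f" using quon_decomp[of "p + k" l] G by (auto simp: i_def)
      have i: "i \<in> B m" unfolding i_def by (rule quon_ball'[OF m p k])
      have G': "i \<in> G" "f \<in> G" using G f(1) by (auto simp: i_def)
      have "Lpow l e + p + k = Lpow l e + (p + k)" using G by (intro vec_eqI) auto
      also have "\<dots> = Lpow l (e + i) + f" unfolding f(2) using G G' by (intro vec_eqI) (auto simp: Lpow_add)
      finally have "subn (l * Suc n) y (Lpow l e + p + k) = subn l (subn (l * n) y) (Lpow l (e + i) + f)"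
        by (simp add: subn_subn)
      also have "\<dots> = iter \<zeta> l (z i) f" using subn_eq[of "e + i" f l] G G' f(1) y(2)[OF i] by simp
      also have "\<dots> = w k" using z[OF k] f subn_eq[OF G'(1) f(1), of z] by simp
      finally show ?thesis by simp
    qed
    then show ?thesis using y(1) by blast
  qed
  have inj: "inj_on (\<lambda>e. Lpow l e + p) (Fn (l * n))" if "p \<in> Fn l" for p
    using Fn_decomp_unique[of _ p l _ p] that by (intro inj_onI) auto
  have "E \<inter> E' = {}"
  proof -
    have "Lpow l e + p \<noteq> Lpow l e' + q" if "e \<in> D" "e' \<in> D'" for e e'
    proof -
      have "e \<in> G" "e' \<in> G" using that D(1) D'(1) Fn_G by blast+
      then show ?thesis using Fn_decomp_unique[of e p l e' q] pq by blast
    qed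
    then show ?thesis by (auto simp: E_def E'_def)
  qed
  moreover have "finite E" "finite E'"
    using finite_subset[OF D(1) finite_Fn] finite_subset[OF D'(1) finite_Fn] by (simp_all add: E_def E'_def)
  moreover have "card E = 2 ^ n" "card E' = 2 ^ n"
    unfolding E_def E'_def
    using card_image[OF inj_on_subset[OF inj[OF pq(1)] D(1)]] card_image[OF inj_on_subset[OF inj[OF pq(2)] D'(1)]]
      D(2) D'(2) by simp_all
  ultimately have "card (E \<union> E') = 2 ^ Suc n" by (simp add: card_Un_disjoint)
  moreover have "E \<union> E' \<subseteq> Fn (l * Suc n)"
    using Fn_add[of _ "l * n" p l] Fn_add[of _ "l * n" q l] D(1) D'(1) pq by (auto simp: E_def E'_def add.commute)
  moreover have "\<exists>y\<in>X. \<forall>k\<in>B m. w k = subn (l * Suc n) y (e + k)" if "e \<in> E \<union> E'" for e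
    using that lift[OF pq(1) _ z D(3)] lift[OF pq(2) _ z' D'(3)] D(1) D'(1) unfolding E_def E'_def by blast
  ultimately show ?case by blast
qed

text \<open>Write u as the shift by g of \<zeta>^n(u'). A patch of u' occurs at s in z', and z has
  the same letter at s. Reading \<zeta>^n(z) at L^n s + g and \<zeta>^n(z') at L^n s + g + q - p
  gives u(0) and u(q - p), while both positions belong to the same point v - p of w.\<close>

lemma coincident_patches_period:
  assumes p: "p \<in> Fn n" and q: "q \<in> Fn n" and w: "w \<in> X" and z: "z \<in> X" "z' \<in> X"
    and wz: "\<And>k. k \<in> B m \<Longrightarrow> w k = subn n z (p + k)" and wz': "\<And>k. k \<in> B m \<Longrightarrow> w k = subn n z' (q + k)"
    and zz: "\<And>k. k \<in> B (recurrence_radius c (base_radius c)) \<Longrightarrow> z k = z' k"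
    and m: "c ^ n * recurrence_radius c (base_radius c) + 2 * support_radius c n \<le> m"
    and u: "u \<in> X"
  shows "u (q - p) = u (0\<^sub>v d)"
proof -
  obtain g u' where g: "g \<in> Fn n" "u' \<in> X" "u = shift d g (subn n u')" using desubstitution_pow[OF u] by blast
  have G: "p \<in> G" "q \<in> G" "g \<in> G" using p q g by auto
  obtain s where s: "s \<in> G" "znorm (s - 0\<^sub>v d) \<le> real (recurrence_radius c (base_radius c))" "\<And>k. k \<in> B (base_radius c) \<Longrightarrow> z' (s + k) = u' k"
    using repetitive[OF z(2) g(2), of "0\<^sub>v d" "base_radius c"] by auto
  have s0: "s - 0\<^sub>v d = s" using s(1) by (intro vec_eqI) auto
  have sB: "s \<in> B (recurrence_radius c (base_radius c))" using s(1,2) by (simp add: s0 lattice_ball_iff)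
  have zs: "z' s = u' (0\<^sub>v d)" using s(3)[OF zero_in_lattice_ball] s(1) by simp
  define v where "v = Lpow n s + g"
  have v: "v \<in> G" using s(1) G by (simp add: v_def)
  \<comment> \<open>This is what the size of m pays for: c^n times the recurrence radius bounds L^n
    s, and the two support radii bound g and e.\<close>
  have vB: "v - e \<in> B m" if "e \<in> Fn n" for e
  proof -
    have "znorm (v - e) \<le> znorm (Lpow n s) + znorm g + znorm e"
      using znorm_diff[of v d e] znorm_triangle[of "Lpow n s" d g] v that G s(1) by (simp add: v_def)
    also have "\<dots> \<le> real (c ^ n) * real (recurrence_radius c (base_radius c)) + real (support_radius c n) + real (support_radius c n)"
    proof -
      have "znorm (Lpow n s) \<le> real (c ^ n) * znorm s" by (rule znorm_Lpow[OF s(1)])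
      also have "\<dots> \<le> real (c ^ n) * real (recurrence_radius c (base_radius c))" using s(2) s0 by (intro mult_left_mono) auto
      finally show ?thesis using Fn_le[OF g(1)] Fn_le[OF that] by simp
    qed
    also have "\<dots> = real (c ^ n * recurrence_radius c (base_radius c) + 2 * support_radius c n)" by simp
    also have "\<dots> \<le> real m" using m by (rule of_nat_mono)
    finally show ?thesis using v that by (simp add: lattice_ball_iff)
  qed
  define i where "i = quon n (g + q - p)"
  obtain h where h: "h \<in> Fn n" "g + q - p = Lpow n i + h" using quon_decomp[of "g + q - p" n] G by (auto simp: i_def)
  have e0: "g + q - p + 0\<^sub>v d = g + q - p" using G by (intro vec_eqI) auto
  \<comment> \<open>The carry of g + q - p is bounded independently of n, so it stays inside the
    patch of u' that was found at s.\<close>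
  have i: "i \<in> B (base_radius c)"
    using quon_ball[OF order_refl g(1) q p zero_in_lattice_ball] unfolding e0 i_def .
  then have iG: "i \<in> G" by (auto simp: lattice_ball_iff)
  have hG: "h \<in> G" using h(1) by simp
  have "u (q - p) = subn n u' (Lpow n i + h)"
  proof -
    have "g + (q - p) = g + q - p" using G by (intro vec_eqI) auto
    then show ?thesis using G by (simp add: g(3) shift_apply h(2))
  qed
  also have "\<dots> = iter \<zeta> n (z' (s + i)) h" using subn_eq[OF iG h(1)] s(3)[OF i] by simp
  also have "\<dots> = subn n z' (Lpow n (s + i) + h)" using subn_eq[of "s + i" h n] s(1) iG h(1) by simp
  also have "Lpow n (s + i) + h = Lpow n s + (Lpow n i + h)"
    using s(1) iG hG by (intro vec_eqI) (auto simp: Lpow_add)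
  also have "\<dots> = q + (v - p)" unfolding h(2)[symmetric] v_def using G s(1) by (intro vec_eqI) auto
  also have "subn n z' (q + (v - p)) = w (v - p)" using wz'[OF vB[OF p]] by simp
  also have "\<dots> = subn n z (p + (v - p))" using wz[OF vB[OF p]] .
  also have "p + (v - p) = Lpow n s + g" using v G by (subst v_def[symmetric]) (auto intro!: vec_eqI)
  also have "subn n z (Lpow n s + g) = iter \<zeta> n (u' (0\<^sub>v d)) g" using subn_eq[OF s(1) g(1)] zz[OF sB] zs by simp
  also have "\<dots> = subn n u' (Lpow n (0\<^sub>v d) + g)" using subn_eq[of "0\<^sub>v d" g n u'] g(1) by simp
  also have "\<dots> = u (0\<^sub>v d)" using G by (simp add: g(3) shift_apply Lpow_zero)
  finally show ?thesis .
qed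

end

text \<open>After n rounds of l levels, n being the bound for the number of patches, there are 2^n
  decompositions, and 2^n > n.\<close>

definition witness_level :: "nat \<Rightarrow> nat \<Rightarrow> nat" where
  "witness_level c l = l * pattern_bound c (recurrence_radius c (base_radius c))"

text \<open>The window required by \<open>coincident_patches_period\<close> at that level, enlarged
  by \<open>base_radius c\<close> to meet the threshold of
  \<open>many_decompositions\<close>.\<close>

definition witness_radius :: "nat \<Rightarrow> nat \<Rightarrow> nat" where
  "witness_radius c l = c ^ witness_level c l * recurrence_radius c (base_radius c) + 2 * support_radius c (witness_level c l) + base_radius c"

definition recog_radius :: "nat \<Rightarrow> nat \<Rightarrow> nat" where
  "recog_radius c l = recurrence_radius c (witness_radius c l) + witness_radius c l"

text \<open>Recognizability is applied at level c c + 1 to points shifted by L g, where g lies in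
  the support of level c c. The second summand pays for this shift, the third for reading a whole
  block.\<close>

definition injectivity_radius :: "nat \<Rightarrow> nat" where
  "injectivity_radius c = recog_radius c (c * c + 1) + c * support_radius c (c * c) + support_radius c (c * c + 1)"

section \<open>Aperiodicity: recognizability and injectivity of the substitution\<close>

locale aper_subst = prim_subst +
  assumes aper: "aperiodic \<zeta>"
begin

lemma recognizability:
  assumes x: "x \<in> X" and y: "y \<in> X" and f: "f \<in> G"
    and eq: "\<And>k. k \<in> B (recog_radius c l) \<Longrightarrow> subn l x (f + k) = subn l y k"
  shows "\<exists>h\<in>G. f = Lpow l h"
proof (rule ccontr)
  assume neg: "\<not> ?thesis"
  define n m R where "n = pattern_bound c (recurrence_radius c (base_radius c))" and "m = witness_radius c l" and "R = recurrence_radius c (base_radius c)"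
  have m: "base_radius c \<le> m" by (simp add: m_def witness_radius_def)
  have eq': "subn l x (f + k) = subn l y k" if "k \<in> B (recurrence_radius c m + m)" for k
    using eq[of k] that by (simp add: recog_radius_def m_def)
  obtain D where D: "D \<subseteq> Fn (l * n)" "card D = 2 ^ n"
    "\<And>p. p \<in> D \<Longrightarrow> \<exists>z\<in>X. \<forall>k\<in>B m. x k = subn (l * n) z (p + k)"
    using many_decompositions[OF m two_decompositions[OF x y f neg _ m eq'] x, of n] by blast
  obtain Z where Z: "\<And>p. p \<in> D \<Longrightarrow> Z p \<in> X" "\<And>p k. p \<in> D \<Longrightarrow> k \<in> B m \<Longrightarrow> x k = subn (l * n) (Z p) (p + k)"
    using D(3) by metis
  \<comment> \<open>\<open>Some\<close> places the patches among the partial patterns, so that the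
    count \<open>pattern_bound\<close> applies to them.\<close>
  define h where "h p = (\<lambda>k\<in>B R. Some (Z p k))" for p
  have "h ` D \<subseteq> B R \<rightarrow>\<^sub>E insert None (Some ` A)"
    using Z(1) X_Conf ball_G[of R] by (fastforce simp: h_def PiE_iff)
  moreover have "finite (B R \<rightarrow>\<^sub>E insert None (Some ` A))"
    by (intro finite_PiE finite_lattice_ball) (simp add: finite_A)
  ultimately have "card (h ` D) \<le> card (B R \<rightarrow>\<^sub>E insert None (Some ` A))" by (intro card_mono)
  also have "\<dots> \<le> n" using card_partial_patterns[of R] by (simp add: n_def R_def)
  also have "\<dots> < card D" unfolding D(2) by (rule less_exp)
  finally have "\<not> inj_on h D" using pigeonhole by blast
  then obtain p q where pq: "p \<in> D" "q \<in> D" "h p = h q" "p \<noteq> q" by (auto simp: inj_on_def)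
  have F: "p \<in> Fn (l * n)" "q \<in> Fn (l * n)" using pq D(1) by auto
  have zz: "Z p k = Z q k" if "k \<in> B (recurrence_radius c (base_radius c))" for k
    using fun_cong[OF pq(3), of k] that by (simp add: h_def R_def)
  have m': "c ^ (l * n) * recurrence_radius c (base_radius c) + 2 * support_radius c (l * n) \<le> m"
    by (simp add: m_def witness_radius_def witness_level_def n_def)
  have per: "u (q - p) = u (0\<^sub>v d)" if "u \<in> X" for u
    by (rule coincident_patches_period[OF F x Z(1)[OF pq(1)] Z(1)[OF pq(2)] Z(2)[OF pq(1)] Z(2)[OF pq(2)] zz m' that])
  have G: "p \<in> G" "q \<in> G" using F by auto
  \<comment> \<open>Applied to all shifts of x, the equality of two letters becomes a period of
    x.\<close>
  have "shift d (q - p) x = x"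
  proof (rule PiE_ext[OF shift_Conf X_Conf[OF x]])
    fix k assume k: "k \<in> G"
    have "x (q - p + k) = shift d k x (q - p)"
    proof -
      have "q - p + k = k + (q - p)" using G k by (intro vec_eqI) auto
      then show ?thesis using G by (simp add: shift_apply)
    qed
    also have "\<dots> = shift d k x (0\<^sub>v d)" using per[OF shift_X[OF x k]] .
    also have "\<dots> = x k" using k by (simp add: shift_apply)
    finally show "shift d (q - p) x k = x k" using k by (simp add: shift_apply)
  qed (use G X_Conf[OF x] in auto)
  then have "q - p = 0\<^sub>v d" using aper x G unfolding aperiodic_def by simp
  moreover have "q = (q - p) + p" using G by (intro vec_eqI) auto
  ultimately show False using pq(4) G by simp
qed

text \<open>The letters that \<zeta>^n does not distinguish. As the substitution may merge letters,
  this relation can be larger than equality.\<close>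

definition coalesced :: "nat \<Rightarrow> (nat \<times> nat) set" where
  "coalesced n = {(a, b). a \<in> A \<and> b \<in> A \<and> (\<forall>f\<in>Fn n. iter \<zeta> n a f = iter \<zeta> n b f)}"

lemma coalesced_mono: "coalesced n \<subseteq> coalesced (Suc n)"
proof (clarsimp simp: coalesced_def)
  fix a b f assume eq: "\<forall>f\<in>Fn n. iter \<zeta> n a f = iter \<zeta> n b f" and "f \<in> Fn (Suc n)"
  then obtain j g where "j \<in> Fn n" "g \<in> F" "f = L *\<^sub>v j + g" by (elim Fn_SucE)
  then show "iter \<zeta> (Suc n) a f = iter \<zeta> (Suc n) b f" using eq by (simp add: iter_Suc')
qed

text \<open>\<open>iter\<close> peels off the lowest digit; here the highest one is peeled off,
  \<zeta>^(n+1) being \<zeta>^n after \<zeta>. The relation of level n + 1 is thus a fixed function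
  of that of level n, so the chain is constant from its first repetition on.\<close>

lemma coalesced_Suc:
  "coalesced (Suc n) = {(a, b). a \<in> A \<and> b \<in> A \<and> (\<forall>g\<in>F. (subst_rule \<zeta> a g, subst_rule \<zeta> b g) \<in> coalesced n)}"
proof -
  have top: "iter \<zeta> (Suc n) a (Lpow n g + f) = iter \<zeta> n (subst_rule \<zeta> a g) f" if "g \<in> F" "f \<in> Fn n" for a g f
    using iter_add[of g 1 f n a] that iter_supp_1[OF cs] iter_1_apply[OF cs that(1)] by simp
  have Fn_top: "Fn (Suc n) = {Lpow n g + f | g f. g \<in> F \<and> f \<in> Fn n}"
  proof (induction n)
    case 0
    then show ?case using Fn_Suc[of 0] L_zero by (force simp: Fn_0)
  next
    case (Suc n)
    show ?case
    proof (intro subset_antisym subsetI)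
      fix v assume "v \<in> Fn (Suc (Suc n))"
      then obtain j e where v: "j \<in> Fn (Suc n)" "e \<in> F" "v = L *\<^sub>v j + e" by (rule Fn_SucE)
      obtain g f where gf: "g \<in> F" "f \<in> Fn n" "j = Lpow n g + f" using v(1) Suc.IH by blast
      have fG: "f \<in> G" using gf by simp
      have "v = Lpow (Suc n) g + (L *\<^sub>v f + e)"
        unfolding v(3) gf(3) using v(2) gf(1) fG by (intro vec_eqI) (auto simp: L_add)
      then show "v \<in> {Lpow (Suc n) g + f | g f. g \<in> F \<and> f \<in> Fn (Suc n)}"
        using gf(1) Fn_Suc_intro[OF gf(2) v(2)] by blast
    next
      fix v assume "v \<in> {Lpow (Suc n) g + f | g f. g \<in> F \<and> f \<in> Fn (Suc n)}"
      then show "v \<in> Fn (Suc (Suc n))" using Fn_add[of _ 1 _ "Suc n"] iter_supp_1[OF cs] by auto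
    qed
  qed
  have "(\<forall>f\<in>Fn (Suc n). iter \<zeta> (Suc n) a f = iter \<zeta> (Suc n) b f) \<longleftrightarrow>
    (\<forall>g\<in>F. \<forall>f\<in>Fn n. iter \<zeta> n (subst_rule \<zeta> a g) f = iter \<zeta> n (subst_rule \<zeta> b g) f)" for a b
    unfolding Fn_top using top by fastforce
  then show ?thesis by (auto simp: coalesced_def)
qed

text \<open>An increasing chain of relations on at most c letters grows strictly at most c c
  times.\<close>

lemma coalesced_stable: "coalesced (Suc (c * c)) = coalesced (c * c)"
proof -
  have fin: "finite (coalesced n)" and le: "card (coalesced n) \<le> c * c" for n
  proof -
    have sub: "coalesced n \<subseteq> A \<times> A" by (auto simp: coalesced_def)
    show "finite (coalesced n)" by (rule finite_subset[OF sub]) (simp add: finite_A)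
    have "card (coalesced n) \<le> card (A \<times> A)" by (rule card_mono[OF _ sub]) (simp add: finite_A)
    also have "\<dots> \<le> c * c" by (simp add: card_cartesian_product mult_le_mono card_A)
    finally show "card (coalesced n) \<le> c * c" .
  qed
  have "\<exists>n\<le>c * c. coalesced (Suc n) = coalesced n"
  proof (rule ccontr)
    assume neg: "\<not> ?thesis"
    have "n \<le> card (coalesced n)" if "n \<le> Suc (c * c)" for n
      using that
    proof (induction n)
      case (Suc n)
      have "coalesced n \<subset> coalesced (Suc n)" using neg Suc.prems coalesced_mono[of n] by auto
      then have "card (coalesced n) < card (coalesced (Suc n))" by (rule psubset_card_mono[OF fin])
      then show ?case using Suc by simp
    qed simp
    from this[of "Suc (c * c)"] le[of "Suc (c * c)"] show False by simp
  qed
  then obtain n where n: "n \<le> c * c" "coalesced (Suc n) = coalesced n" by blast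
  have "coalesced (Suc k) = coalesced k" if "n \<le> k" for k
    using that by (induction k rule: dec_induct) (use n(2) coalesced_Suc in auto)
  then show ?thesis using n(1) by simp
qed

text \<open>Going k = c c levels back, y and y' are the shifts by g and g' of \<zeta>^k(z) and
  \<zeta>^k(z'). Recognizability at level k + 1 makes L g and L g' congruent modulo L^(k+1), whence
  g = g'. The letters of z and z' at the origin then have equal images under \<zeta>^(k+1), by
  stabilization also under \<zeta>^k, and y(0) and y'(0) are read in these images at g.\<close>

lemma sub_injective:
  assumes y: "y \<in> X" "y' \<in> X" and eq: "\<And>v. v \<in> B (injectivity_radius c) \<Longrightarrow> sub y v = sub y' v"
  shows "y (0\<^sub>v d) = y' (0\<^sub>v d)"
proof -
  define k where "k = c * c"
  obtain g z where g: "g \<in> Fn k" "z \<in> X" "y = shift d g (subn k z)" using desubstitution_pow[OF y(1)] by blast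
  obtain g' z' where g': "g' \<in> Fn k" "z' \<in> X" "y' = shift d g' (subn k z')" using desubstitution_pow[OF y(2)] by blast
  have G: "g \<in> G" "g' \<in> G" using g g' by auto
  have Lg: "znorm (L *\<^sub>v e) \<le> real (c * support_radius c k)" if "e \<in> Fn k" for e
    using lip[of e] Fn_le[OF that] that mult_left_mono[of "znorm e" "real (support_radius c k)" "real c"] by fastforce
  have suby: "sub y v = subn (Suc k) z (L *\<^sub>v g + v)" if "v \<in> G" for v
    using that G by (simp add: g(3) sub_shift shift_apply)
  have suby': "sub y' v = subn (Suc k) z' (L *\<^sub>v g' + v)" if "v \<in> G" for v
    using that G by (simp add: g'(3) sub_shift shift_apply)
  have "subn (Suc k) z (L *\<^sub>v g - L *\<^sub>v g' + v) = subn (Suc k) z' v" if v: "v \<in> B (recog_radius c (Suc k))" for v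
  proof -
    have vG: "v \<in> G" using v by (auto simp: lattice_ball_iff)
    have "znorm (v - L *\<^sub>v g') \<le> real (recog_radius c (Suc k)) + real (c * support_radius c k)"
      using znorm_diff[OF vG, of "L *\<^sub>v g'"] Lg[OF g'(1)] G v by (simp add: lattice_ball_iff)
    also have "\<dots> \<le> real (injectivity_radius c)" by (simp add: injectivity_radius_def k_def)
    finally have vB: "v - L *\<^sub>v g' \<in> B (injectivity_radius c)" using vG G by (simp add: lattice_ball_iff)
    have e: "L *\<^sub>v g - L *\<^sub>v g' + v = L *\<^sub>v g + (v - L *\<^sub>v g')" "v = L *\<^sub>v g' + (v - L *\<^sub>v g')"
      using vG G by (auto intro!: vec_eqI)
    have "subn (Suc k) z (L *\<^sub>v g - L *\<^sub>v g' + v) = sub y (v - L *\<^sub>v g')"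
      unfolding e(1) using suby[of "v - L *\<^sub>v g'"] vG G by simp
    also have "\<dots> = subn (Suc k) z' (L *\<^sub>v g' + (v - L *\<^sub>v g'))"
      using eq[OF vB] suby'[of "v - L *\<^sub>v g'"] vG G by simp
    finally show ?thesis using e(2) by simp
  qed
  then obtain h where h: "h \<in> G" "L *\<^sub>v g - L *\<^sub>v g' = Lpow (Suc k) h"
    using recognizability[OF g(2) g'(2), of "L *\<^sub>v g - L *\<^sub>v g'" "Suc k"] G by auto
  have "g - g' = Lpow k h" by (rule L_inj) (use h G in \<open>simp_all add: L_diff\<close>)
  moreover have "g = (g - g') + g'" using G by (intro vec_eqI) auto
  ultimately have "g = Lpow k h + g'" by simp
  then have "Lpow k (0\<^sub>v d) + g = Lpow k h + g'" using G by (simp add: Lpow_zero)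
  then have gg: "g = g'" using Fn_decomp_unique[of "0\<^sub>v d" g k h g'] h(1) g(1) g'(1) by simp
  have "iter \<zeta> (Suc k) (z (0\<^sub>v d)) f = iter \<zeta> (Suc k) (z' (0\<^sub>v d)) f" if f: "f \<in> Fn (Suc k)" for f
  proof -
    have fG: "f \<in> G" using f by simp
    have "znorm (f - L *\<^sub>v g) \<le> real (support_radius c (Suc k)) + real (c * support_radius c k)"
      using znorm_diff[OF fG, of "L *\<^sub>v g"] Lg[OF g(1)] Fn_le[OF f] G by simp
    also have "\<dots> \<le> real (injectivity_radius c)" by (simp add: injectivity_radius_def k_def)
    finally have fB: "f - L *\<^sub>v g \<in> B (injectivity_radius c)" using fG G by (simp add: lattice_ball_iff)
    have e: "L *\<^sub>v g + (f - L *\<^sub>v g) = Lpow (Suc k) (0\<^sub>v d) + f"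
      using fG G by (intro vec_eqI) (auto simp: Lpow_zero L_zero)
    have "iter \<zeta> (Suc k) (z (0\<^sub>v d)) f = sub y (f - L *\<^sub>v g)"
      using suby[of "f - L *\<^sub>v g"] fG G subn_eq[OF zero_carrier_vec f, of z] unfolding e by simp
    also have "\<dots> = sub y' (f - L *\<^sub>v g)" by (rule eq[OF fB])
    also have "\<dots> = iter \<zeta> (Suc k) (z' (0\<^sub>v d)) f"
      using suby'[of "f - L *\<^sub>v g"] fG G subn_eq[OF zero_carrier_vec f, of z'] unfolding gg[symmetric] e by simp
    finally show ?thesis .
  qed
  moreover have "z (0\<^sub>v d) \<in> A" "z' (0\<^sub>v d) \<in> A" using X_Conf[OF g(2)] X_Conf[OF g'(2)] by auto
  ultimately have "(z (0\<^sub>v d), z' (0\<^sub>v d)) \<in> coalesced (Suc k)" by (simp add: coalesced_def)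
  then have "(z (0\<^sub>v d), z' (0\<^sub>v d)) \<in> coalesced k" using coalesced_stable by (simp add: k_def)
  then have "iter \<zeta> k (z (0\<^sub>v d)) g = iter \<zeta> k (z' (0\<^sub>v d)) g" using g(1) by (simp add: coalesced_def)
  then show ?thesis
    using subn_eq[of "0\<^sub>v d" g k z] subn_eq[of "0\<^sub>v d" g k z'] g(1) G by (simp add: g(3) g'(3) gg[symmetric] shift_apply Lpow_zero)
qed

end

section \<open>Factor maps\<close>

text \<open>T is injective on classes of E and preserves the finite set of classes that meet K, so
  it permutes them. If T x is equivalent to k in K, then k is equivalent to T b for some b in K, and
  injectivity makes x equivalent to b. Everything is relative to U because E need only be an
  equivalence there.\<close>

lemma finite_injective_absorbs:
  assumes K: "finite K" "K \<subseteq> U" "\<And>a. a \<in> K \<Longrightarrow> T a \<in> K" and T: "\<And>a. a \<in> U \<Longrightarrow> T a \<in> U"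
    and refl: "\<And>a. a \<in> U \<Longrightarrow> E a a" and sym: "\<And>a b. a \<in> U \<Longrightarrow> b \<in> U \<Longrightarrow> E a b \<Longrightarrow> E b a"
    and trans: "\<And>a b c. a \<in> U \<Longrightarrow> b \<in> U \<Longrightarrow> c \<in> U \<Longrightarrow> E a b \<Longrightarrow> E b c \<Longrightarrow> E a c"
    and inj: "\<And>a b. a \<in> U \<Longrightarrow> b \<in> U \<Longrightarrow> E (T a) (T b) \<Longrightarrow> E a b"
    and x: "x \<in> U" "k \<in> K" "E (T x) k"
  shows "\<exists>k'\<in>K. E x k'"
proof -
  have KU: "a \<in> U" if "a \<in> K" for a using that K(2) by auto
  \<comment> \<open>Chosen representatives replace the quotient, so that
    \<open>endo_inj_surj\<close> applies to a plain set.\<close>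
  define rp where "rp a = (SOME b. b \<in> K \<and> E a b)" for a
  have rp: "rp a \<in> K" "E a (rp a)" if "a \<in> K" for a
  proof -
    have "rp a \<in> K \<and> E a (rp a)" unfolding rp_def by (rule someI_ex) (use that refl K in blast)
    then show "rp a \<in> K" "E a (rp a)" by auto
  qed
  have rp_eq: "rp a = rp b" if ab: "a \<in> K" "b \<in> K" "E a b" for a b
  proof -
    have "E a e \<longleftrightarrow> E b e" if "e \<in> K" for e
      using sym[OF KU[OF ab(1)] KU[OF ab(2)] ab(3)] ab(3) trans[OF KU[OF ab(1)] KU[OF ab(2)] KU[OF that]]
        trans[OF KU[OF ab(2)] KU[OF ab(1)] KU[OF that]] by blast
    then have "(\<lambda>e. e \<in> K \<and> E a e) = (\<lambda>e. e \<in> K \<and> E b e)" by auto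
    then show ?thesis by (simp add: rp_def)
  qed
  have rp_eq_iff: "E a b" if ab: "a \<in> K" "b \<in> K" and eq: "rp a = rp b" for a b
    using trans[OF KU[OF ab(1)] KU[OF rp(1)[OF ab(2)]] KU[OF ab(2)]] rp(2)[OF ab(1)] eq
      sym[OF KU[OF ab(2)] KU[OF rp(1)[OF ab(2)]] rp(2)[OF ab(2)]] by simp
  have "inj_on (\<lambda>b. rp (T b)) (rp ` K)"
  proof (rule inj_onI)
    fix b b' assume "b \<in> rp ` K" "b' \<in> rp ` K" and eq: "rp (T b) = rp (T b')"
    then obtain a a' where a: "a \<in> K" "b = rp a" "a' \<in> K" "b' = rp a'" by blast
    have bK: "b \<in> K" "b' \<in> K" using a rp by auto
    have "E b b'" using rp_eq_iff[OF K(3)[OF bK(1)] K(3)[OF bK(2)] eq] inj[OF KU[OF bK(1)] KU[OF bK(2)]] by blast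
    then have "rp b = rp b'" by (rule rp_eq[OF bK])
    moreover have "rp b = b" "rp b' = b'"
      using rp_eq[OF a(1) bK(1)] rp_eq[OF a(3) bK(2)] rp(2) a by auto
    ultimately show "b = b'" by simp
  qed
  moreover have "(\<lambda>b. rp (T b)) ` rp ` K \<subseteq> rp ` K" using rp(1) K(3) by auto
  moreover have "finite (rp ` K)" using K(1) by simp
  ultimately have surj: "(\<lambda>b. rp (T b)) ` rp ` K = rp ` K" by (intro endo_inj_surj)
  have "rp k \<in> (\<lambda>b. rp (T b)) ` rp ` K" unfolding surj using x(2) by (rule imageI)
  then obtain a where a: "a \<in> K" "rp k = rp (T (rp a))" by blast
  define b where "b = rp a"
  have b: "b \<in> K" "rp k = rp (T b)" using a rp by (auto simp: b_def)
  have "E k (T b)" by (rule rp_eq_iff[OF x(2) K(3)[OF b(1)] b(2)])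
  then have "E (T x) (T b)" by (rule trans[OF T[OF x(1)] KU[OF x(2)] KU[OF K(3)[OF b(1)]] x(3)])
  then have "E x b" by (rule inj[OF x(1) KU[OF b(1)]])
  then show ?thesis using b(1) by blast
qed

section \<open>Factor maps as block codes\<close>

locale subst_pair = s1: prim_subst d L c \<zeta>1 + s2: aper_subst d L c \<zeta>2
  for d :: nat and L :: "int mat" and c :: nat and \<zeta>1 \<zeta>2 :: substitution
begin

abbreviation "G \<equiv> Zd d"
abbreviation "B \<equiv> lattice_ball d"

definition fmap :: "((int Matrix.vec \<Rightarrow> nat) \<Rightarrow> (int Matrix.vec \<Rightarrow> nat)) \<Rightarrow> bool" where
  "fmap = factor_map d (alphabet \<zeta>1) s1.X (alphabet \<zeta>2) s2.X"

text \<open>Expresses the existence of a block map on \<open>B r\<close> without choosing its values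
  on patterns that do not occur; for equivariant maps the origin is enough.\<close>

definition coded :: "((int Matrix.vec \<Rightarrow> nat) \<Rightarrow> (int Matrix.vec \<Rightarrow> nat)) \<Rightarrow> nat \<Rightarrow> bool" where
  "coded \<phi> r \<longleftrightarrow> (\<forall>x\<in>s1.X. \<forall>y\<in>s1.X. (\<forall>k\<in>B r. x k = y k) \<longrightarrow> \<phi> x (0\<^sub>v d) = \<phi> y (0\<^sub>v d))"

lemma fmap_X: "fmap \<phi> \<Longrightarrow> x \<in> s1.X \<Longrightarrow> \<phi> x \<in> s2.X"
  by (auto simp: fmap_def factor_map_def)

lemma fmap_shift: "fmap \<phi> \<Longrightarrow> x \<in> s1.X \<Longrightarrow> n \<in> G \<Longrightarrow> \<phi> (shift d n x) = shift d n (\<phi> x)"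
  by (auto simp: fmap_def factor_map_def)

lemma codedD:
  "coded \<phi> r \<Longrightarrow> x \<in> s1.X \<Longrightarrow> y \<in> s1.X \<Longrightarrow> \<forall>k\<in>B r. x k = y k \<Longrightarrow> \<phi> x (0\<^sub>v d) = \<phi> y (0\<^sub>v d)"
  unfolding coded_def by blast

lemma coded_mono: "coded \<phi> r \<Longrightarrow> r \<le> s \<Longrightarrow> coded \<phi> s"
  unfolding coded_def using lattice_ball_mono[of r s d] by blast

lemma coded_at:
  assumes eqv: "\<And>x n. x \<in> s1.X \<Longrightarrow> n \<in> G \<Longrightarrow> \<phi> (shift d n x) = shift d n (\<phi> x)"
    and r: "coded \<phi> r" and x: "x \<in> s1.X" "y \<in> s1.X" and n: "n \<in> G"
    and eq: "\<And>k. k \<in> B r \<Longrightarrow> x (n + k) = y (n + k)"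
  shows "\<phi> x n = \<phi> y n"
proof -
  have "\<forall>k\<in>B r. shift d n x k = shift d n y k" using eq by (simp add: shift_def lattice_ball_iff)
  moreover have "shift d n x \<in> s1.X" "shift d n y \<in> s1.X" using x n by simp_all
  ultimately have "\<phi> (shift d n x) (0\<^sub>v d) = \<phi> (shift d n y) (0\<^sub>v d)"
    using r unfolding coded_def by blast
  then show ?thesis using x n by (simp add: eqv s1.shift_apply)
qed

lemma coded_ball:
  assumes \<phi>: "fmap \<phi>" and r: "coded \<phi> r" and x: "x \<in> s1.X" "y \<in> s1.X"
    and eq: "\<And>k. k \<in> B (r + m) \<Longrightarrow> x k = y k" and n: "n \<in> B m"
  shows "\<phi> x n = \<phi> y n"
proof (rule coded_at[OF fmap_shift[OF \<phi>] r x])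
  show nG: "n \<in> G" using n by (simp add: lattice_ball_iff)
  fix k assume k: "k \<in> B r"
  have "n + k \<in> B (r + m)" using znorm_triangle[of n d k] n k by (simp add: lattice_ball_iff)
  then show "x (n + k) = y (n + k)" by (rule eq)
qed

text \<open>The easy half of the Curtis-Hedlund-Lyndon theorem: every coordinate of the image is
  decided by a finite window and is therefore continuous.\<close>

lemma fmapI:
  assumes img: "\<phi> ` s1.X = s2.X"
    and eqv: "\<And>x n. x \<in> s1.X \<Longrightarrow> n \<in> G \<Longrightarrow> \<phi> (shift d n x) = shift d n (\<phi> x)" and r: "coded \<phi> r"
  shows "fmap \<phi>"
  unfolding fmap_def factor_map_def
proof (intro conjI ballI img eqv)
  have "continuous_map (subtopology (config_topology d s1.A) s1.X) (discrete_topology s2.A) (\<lambda>x. \<phi> x n)" if n: "n \<in> G" for n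
    unfolding continuous_map
  proof (intro conjI allI impI)
    show "(\<lambda>x. \<phi> x n) ` topspace (subtopology (config_topology d s1.A) s1.X) \<subseteq> topspace (discrete_topology s2.A)"
      using img s2.X_Conf n by (fastforce simp: topspace_config_topology)
    fix U assume "openin (discrete_topology s2.A) U"
    define P where "P y \<longleftrightarrow> (\<exists>x\<in>s1.X. \<phi> x n \<in> U \<and> (\<forall>k\<in>(\<lambda>k. n + k) ` B r. y k = x k))" for y
    have "determined_on d s1.A ((\<lambda>k. n + k) ` B r) P"
      unfolding determined_on_def
    proof (intro conjI ballI impI)
      show "finite ((\<lambda>k. n + k) ` B r)" by (simp add: finite_lattice_ball)
      show "(\<lambda>k. n + k) ` B r \<subseteq> G" using n by (auto simp: lattice_ball_iff)
      fix y z assume "\<forall>k\<in>(\<lambda>k. n + k) ` B r. y k = z k" "P y"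
      then show "P z" unfolding P_def by metis
    qed
    from openin_determined_on[OF this]
    have "openin (subtopology (config_topology d s1.A) s1.X) ({y \<in> s1.Conf. P y} \<inter> s1.X)"
      by (rule openin_subtopology_Int)
    moreover have "{y \<in> s1.Conf. P y} \<inter> s1.X = {x \<in> topspace (subtopology (config_topology d s1.A) s1.X). \<phi> x n \<in> U}"
    proof (intro subset_antisym subsetI)
      fix y assume y: "y \<in> {y \<in> s1.Conf. P y} \<inter> s1.X"
      then obtain x where x: "x \<in> s1.X" "\<phi> x n \<in> U" "\<And>k. k \<in> B r \<Longrightarrow> y (n + k) = x (n + k)" by (auto simp: P_def)
      have "\<phi> y n = \<phi> x n" by (rule coded_at[OF eqv r _ x(1) n x(3)]) (use y in auto)
      then show "y \<in> {x \<in> topspace (subtopology (config_topology d s1.A) s1.X). \<phi> x n \<in> U}"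
        using y x(2) by (auto simp: topspace_config_topology)
    next
      fix y assume "y \<in> {x \<in> topspace (subtopology (config_topology d s1.A) s1.X). \<phi> x n \<in> U}"
      then show "y \<in> {y \<in> s1.Conf. P y} \<inter> s1.X" by (auto simp: topspace_config_topology P_def)
    qed
    ultimately show "openin (subtopology (config_topology d s1.A) s1.X)
      {x \<in> topspace (subtopology (config_topology d s1.A) s1.X). \<phi> x n \<in> U}" by simp
  qed
  moreover have "\<phi> ` topspace (subtopology (config_topology d s1.A) s1.X) \<subseteq> s2.X"
    using img by (auto simp: topspace_config_topology)
  moreover have "\<phi> ` topspace (subtopology (config_topology d s1.A) s1.X) \<subseteq> extensional G"
    using img s2.X_Conf by (fastforce simp: topspace_config_topology PiE_iff)
  ultimately show "continuous_map (subtopology (config_topology d s1.A) s1.X) (subtopology (config_topology d s2.A) s2.X) \<phi>"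
    unfolding continuous_map_in_subtopology
    by (auto simp: config_topology_def continuous_map_componentwise image_subset_iff Pi_iff)
qed

text \<open>The other half of Curtis-Hedlund-Lyndon: continuity gives each x a radius of its own,
  and by compactness finitely many cylinders, hence a largest radius, suffice.\<close>

lemma fmap_coded:
  assumes \<phi>: "fmap \<phi>" shows "\<exists>r. coded \<phi> r"
proof -
  let ?T = "config_topology d s1.A"
  have "continuous_map (subtopology ?T s1.X) (subtopology (config_topology d s2.A) s2.X) \<phi>"
    using \<phi> by (simp add: fmap_def factor_map_def)
  then have "continuous_map (subtopology ?T s1.X) (config_topology d s2.A) \<phi>"
    by (rule continuous_map_into_fulltopology)
  then have cont: "continuous_map (subtopology ?T s1.X) (discrete_topology s2.A) (\<lambda>x. \<phi> x (0\<^sub>v d))"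
    by (simp add: config_topology_def continuous_map_componentwise)
  have loc: "\<exists>r. \<forall>y\<in>s1.X. (\<forall>k\<in>B r. y k = x k) \<longrightarrow> \<phi> y (0\<^sub>v d) = \<phi> x (0\<^sub>v d)" if x: "x \<in> s1.X" for x
  proof -
    have "\<phi> x (0\<^sub>v d) \<in> s2.A" using s2.X_Conf[OF fmap_X[OF \<phi> x]] by auto
    then have "openin (subtopology ?T s1.X) {y \<in> topspace (subtopology ?T s1.X). \<phi> y (0\<^sub>v d) \<in> {\<phi> x (0\<^sub>v d)}}"
      by (intro openin_continuous_map_preimage[OF cont]) simp
    then obtain W where W: "openin ?T W"
      "{y \<in> topspace (subtopology ?T s1.X). \<phi> y (0\<^sub>v d) \<in> {\<phi> x (0\<^sub>v d)}} = W \<inter> s1.X"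
      by (auto simp: openin_subtopology)
    have X1: "topspace (subtopology ?T s1.X) = s1.X"
      using s1.X_Conf by (auto simp: topspace_config_topology)
    have "x \<in> W" using W(2) x unfolding X1 by auto
    then obtain V where V: "x \<in> Pi\<^sub>E G V" "finite {i. V i \<noteq> s1.A}" "Pi\<^sub>E G V \<subseteq> W"
      using product_topology_open_contains_basis[OF W(1)[unfolded config_topology_def], of x]
      by (auto simp del: openin_discrete_topology)
    have "finite ({i. V i \<noteq> s1.A} \<inter> G)" using V(2) by simp
    then obtain r where r: "{i. V i \<noteq> s1.A} \<inter> G \<subseteq> B r" using finite_subset_lattice_ball by (metis inf_le2)
    have "\<phi> y (0\<^sub>v d) = \<phi> x (0\<^sub>v d)" if y: "y \<in> s1.X" "\<forall>k\<in>B r. y k = x k" for y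
    proof -
      have "y i \<in> V i" if "i \<in> G" for i
      proof (cases "V i = s1.A")
        case True
        then show ?thesis using s1.X_Conf[OF y(1)] that by auto
      next
        case False
        then have "y i = x i" using r that y(2) by auto
        then show ?thesis using V(1) that by auto
      qed
      then have "y \<in> Pi\<^sub>E G V" using s1.X_Conf[OF y(1)] by (auto simp: PiE_iff)
      then have "y \<in> W \<inter> s1.X" using V(3) y(1) by auto
      then show ?thesis unfolding W(2)[symmetric] by simp
    qed
    then show ?thesis by blast
  qed
  then obtain \<rho> where \<rho>: "\<And>x y. x \<in> s1.X \<Longrightarrow> y \<in> s1.X \<Longrightarrow> (\<forall>k\<in>B (\<rho> x). y k = x k) \<Longrightarrow> \<phi> y (0\<^sub>v d) = \<phi> x (0\<^sub>v d)"
    by metis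
  define C where "C x = {y \<in> s1.Conf. \<forall>k\<in>B (\<rho> x). y k = x k}" for x
  have "openin ?T (C x)" for x
    unfolding C_def
    by (rule openin_determined_on[of _ _ "B (\<rho> x)"])
      (auto simp: determined_on_def finite_lattice_ball lattice_ball_iff)
  moreover have "compactin ?T s1.X"
    by (rule closedin_compact_space[OF compact_space_config[OF s1.finite_A] s1.closedin_X])
  moreover have "s1.X \<subseteq> \<Union>(C ` s1.X)" using s1.X_Conf by (auto simp: C_def)
  ultimately obtain \<F> where F: "finite \<F>" "\<F> \<subseteq> C ` s1.X" "s1.X \<subseteq> \<Union>\<F>"
    using compactinD[of ?T s1.X "C ` s1.X"] by auto
  then obtain S where S: "S \<subseteq> s1.X" "finite S" "\<F> = C ` S" using finite_subset_image[OF F(1,2)] by blast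
  have "coded \<phi> (Max (insert 0 (\<rho> ` S)))"
    unfolding coded_def
  proof (intro ballI impI)
    fix x y assume x: "x \<in> s1.X" "y \<in> s1.X" and eq: "\<forall>k\<in>B (Max (insert 0 (\<rho> ` S))). x k = y k"
    obtain z where z: "z \<in> S" "x \<in> C z" using F(3) x(1) S(3) by blast
    have "\<rho> z \<le> Max (insert 0 (\<rho> ` S))" using z(1) S(2) by (intro Max_ge) auto
    then have "B (\<rho> z) \<subseteq> B (Max (insert 0 (\<rho> ` S)))" by (rule lattice_ball_mono)
    moreover have xz: "\<forall>k\<in>B (\<rho> z). x k = z k" using z(2) by (simp add: C_def)
    ultimately have "\<forall>k\<in>B (\<rho> z). y k = z k" using eq by (metis subsetD)
    then show "\<phi> x (0\<^sub>v d) = \<phi> y (0\<^sub>v d)" using xz \<rho>[of z x] \<rho>[of z y] z(1) S(1) x by auto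
  qed
  then show ?thesis by blast
qed

lemma coded_radius:
  assumes \<phi>: "fmap \<phi>" and r: "coded \<phi> r"
  shows "radius d s1.A s1.X s2.A \<phi> \<le> r"
proof -
  \<comment> \<open>The value on patterns that do not occur in \<open>s1.X\<close>, on which a block
    map must be defined as well.\<close>
  obtain b where b: "b \<in> s2.A" using s2.A_ne by blast
  define ex where "ex p \<longleftrightarrow> (\<exists>x. x \<in> s1.X \<and> (\<forall>k\<in>B r. x k = p k))" for p
  define pick where "pick p = (SOME x. x \<in> s1.X \<and> (\<forall>k\<in>B r. x k = p k))" for p
  define \<Phi> where "\<Phi> p = (if ex p then \<phi> (pick p) (0\<^sub>v d) else b)" for p
  have pick: "pick p \<in> s1.X" "\<forall>k\<in>B r. pick p k = p k" if "ex p" for p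
  proof -
    have "pick p \<in> s1.X \<and> (\<forall>k\<in>B r. pick p k = p k)"
      unfolding pick_def by (rule someI_ex[OF that[unfolded ex_def]])
    then show "pick p \<in> s1.X" "\<forall>k\<in>B r. pick p k = p k" by auto
  qed
  have \<Phi>_A: "\<Phi> p \<in> s2.A" for p
  proof (cases "ex p")
    case True
    then have "\<phi> (pick p) \<in> s2.Conf" by (intro s2.X_Conf fmap_X[OF \<phi>] pick)
    then show ?thesis using True by (auto simp: \<Phi>_def)
  qed (simp add: \<Phi>_def b)
  have "\<phi> x n = \<Phi> (\<lambda>k\<in>B r. x (n + k))" if x: "x \<in> s1.X" and n: "n \<in> G" for x n
  proof -
    define p where "p = (\<lambda>k\<in>B r. x (n + k))"
    have sx: "shift d n x \<in> s1.X" using x n by simp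
    have p: "\<forall>k\<in>B r. shift d n x k = p k" by (auto simp: p_def shift_def lattice_ball_iff)
    then have ex: "ex p" using sx unfolding ex_def by blast
    have "\<forall>k\<in>B r. shift d n x k = pick p k" using p pick(2)[OF ex] by simp
    then have "\<phi> (shift d n x) (0\<^sub>v d) = \<phi> (pick p) (0\<^sub>v d)"
      using r sx pick(1)[OF ex] unfolding coded_def by blast
    then show ?thesis
      unfolding p_def[symmetric] \<Phi>_def using ex n by (simp add: fmap_shift[OF \<phi> x n] s1.shift_apply)
  qed
  then have "induced_by d s1.A s1.X s2.A \<phi> (B r) \<Phi>" using \<Phi>_A by (simp add: induced_by_def)
  then have "r \<in> {r. \<exists>\<Phi>. induced_by d s1.A s1.X s2.A \<phi> (B r) \<Phi>}" by blast
  then show ?thesis unfolding radius_def by (intro cInf_lower) auto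
qed

end

section \<open>Descent of factor maps\<close>

context aper_subst
begin

lemma sub_inj_X:
  assumes y: "y \<in> X" "y' \<in> X" and eq: "sub y = sub y'" shows "y = y'"
proof (rule PiE_ext[OF X_Conf[OF y(1)] X_Conf[OF y(2)]])
  fix k assume k: "k \<in> G"
  have "sub (shift d k y) = sub (shift d k y')" using eq k by (simp add: sub_shift)
  then have "shift d k y (0\<^sub>v d) = shift d k y' (0\<^sub>v d)"
    using sub_injective[OF shift_X[OF y(1) k] shift_X[OF y(2) k]] by simp
  then show "y k = y' k" using k by (simp add: shift_apply)
qed

end

context csubst
begin

lemma shift_left_cancel:
  assumes "g \<in> G" "x \<in> Conf" "y \<in> Conf" "shift d g x = shift d g y" shows "x = y"
proof (rule PiE_ext[OF assms(2,3)])
  fix k assume k: "k \<in> G"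
  have "g + (k - g) = k" using assms(1) k by (intro vec_eqI) auto
  then show "x k = y k" using fun_cong[OF assms(4), of "k - g"] assms(1) k by (simp add: shift_apply)
qed

lemma sub_ball:
  assumes eq: "\<And>k. k \<in> B s \<Longrightarrow> x k = y k" and r: "real r + real c \<le> (1 + 1 / real c) * real s" and v: "v \<in> B r"
  shows "sub x v = sub y v"
proof -
  have vG: "v \<in> G" using v by (simp add: lattice_ball_iff)
  have "(1 + 1 / real c) * znorm (quo v) \<le> (1 + 1 / real c) * real s"
    using quo_bound[OF vG] v r by (simp add: lattice_ball_iff)
  moreover have "1 + 1 / real c > 0" by (simp add: add_pos_nonneg)
  ultimately have "quo v \<in> B s" using vG by (simp add: lattice_ball_iff)
  then show ?thesis using eq vG by (simp add: sub_def)
qed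

end

context subst_pair
begin

text \<open>A commuting square: \<psi> is \<phi> seen through the two substitutions, up to an offset
  g of the blocks that is the same for all points.\<close>

definition descends :: "((int Matrix.vec \<Rightarrow> nat) \<Rightarrow> (int Matrix.vec \<Rightarrow> nat)) \<Rightarrow> int Matrix.vec \<Rightarrow>
    ((int Matrix.vec \<Rightarrow> nat) \<Rightarrow> (int Matrix.vec \<Rightarrow> nat)) \<Rightarrow> bool" where
  "descends \<phi> g \<psi> \<longleftrightarrow> g \<in> s2.F \<and> (\<forall>x\<in>s1.X. \<psi> x \<in> s2.X \<and> \<phi> (s1.sub x) = shift d g (s2.sub (\<psi> x)))"

text \<open>Each \<open>\<phi> (s1.sub x)\<close> can be desubstituted, but with an offset g that
  might depend on x. By repetitivity a shift of x0 agrees with x on a large ball, so the images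
  agree there too; recognizability at level 1 makes the offsets g0 and g congruent modulo
  \<open>L\<close>, and both are digits.\<close>

lemma ex_descends:
  assumes \<phi>: "fmap \<phi>" and ne: "s1.X \<noteq> {}" shows "\<exists>g \<psi>. descends \<phi> g \<psi>"
proof -
  obtain r where r: "coded \<phi> r" using fmap_coded[OF \<phi>] by blast
  obtain x0 where x0: "x0 \<in> s1.X" using ne by blast
  obtain g0 y0 where g0: "g0 \<in> s2.F" "y0 \<in> s2.X" "\<phi> (s1.sub x0) = shift d g0 (s2.sub y0)"
    using s2.desubstitution[OF fmap_X[OF \<phi> s1.sub_X[OF x0]]] by blast
  have "\<exists>y\<in>s2.X. \<phi> (s1.sub x) = shift d g0 (s2.sub y)" if x: "x \<in> s1.X" for x
  proof -
    obtain g y where g: "g \<in> s2.F" "y \<in> s2.X" "\<phi> (s1.sub x) = shift d g (s2.sub y)"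
      using s2.desubstitution[OF fmap_X[OF \<phi> s1.sub_X[OF x]]] by blast
    have G: "g \<in> G" "g0 \<in> G" using g(1) g0(1) by auto
    \<comment> \<open>The extra c allows for the displacement by g. In s, the summand c pays for the
      remainder in \<open>sub_ball\<close> and \<open>base_radius c\<close> for the threshold of
      \<open>repetitive\<close>.\<close>
    define m where "m = recog_radius c 1 + c"
    define s where "s = r + m + c + base_radius c"
    obtain k where k: "k \<in> G" "\<And>i. i \<in> B s \<Longrightarrow> x0 (k + i) = x i"
      using s1.repetitive[OF x0 x zero_carrier_vec, of s] by (auto simp: s_def)
    have "shift d k x0 i = x i" if "i \<in> B s" for i
      using k(2)[OF that] that by (simp add: s1.shift_apply lattice_ball_iff)
    moreover have "real (r + m) + real c \<le> (1 + 1 / real c) * real s"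
      by (simp add: s_def algebra_simps add_increasing2)
    ultimately have "s1.sub (shift d k x0) v = s1.sub x v" if "v \<in> B (r + m)" for v
      using that by (intro s1.sub_ball[of s _ _ "r + m"]) auto
    then have eq: "\<phi> (s1.sub (shift d k x0)) v = \<phi> (s1.sub x) v" if "v \<in> B m" for v
      using coded_ball[OF \<phi> r _ _ _ that] x x0 k(1) by simp
    have "\<phi> (s1.sub (shift d k x0)) = shift d (L *\<^sub>v k) (shift d g0 (s2.sub y0))"
      using k(1) x0 by (simp add: s1.sub_shift fmap_shift[OF \<phi>] g0(3))
    also have "\<dots> = shift d (L *\<^sub>v k + g0) (s2.sub y0)" using k(1) G by (simp add: s2.shift_shift)
    finally have \<phi>0: "\<phi> (s1.sub (shift d k x0)) = shift d (L *\<^sub>v k + g0) (s2.sub y0)" .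
    have "s2.subn 1 y0 (L *\<^sub>v k + g0 - g + u) = s2.subn 1 y u" if u: "u \<in> B (recog_radius c 1)" for u
    proof -
      have uG: "u \<in> G" using u by (simp add: lattice_ball_iff)
      have "u - g \<in> B m" using znorm_diff[OF uG G(1)] u s2.F_le[OF g(1)] uG G by (simp add: lattice_ball_iff m_def)
      from eq[OF this] have "s2.sub y0 (L *\<^sub>v k + g0 + (u - g)) = s2.sub y (g + (u - g))"
        using uG G by (simp add: \<phi>0 g(3) s2.shift_apply)
      moreover have "L *\<^sub>v k + g0 + (u - g) = L *\<^sub>v k + g0 - g + u" "g + (u - g) = u"
        using uG G k(1) by (auto intro!: s1.vec_eqI)
      ultimately show ?thesis by simp
    qed
    then obtain h where h: "h \<in> G" "L *\<^sub>v k + g0 - g = L *\<^sub>v h"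
      using s2.recognizability[OF g0(2) g(2), of "L *\<^sub>v k + g0 - g" 1] G k(1) by auto
    have "L *\<^sub>v k + g0 = (L *\<^sub>v k + g0 - g) + g" using G k(1) by (intro s1.vec_eqI) auto
    then have "g0 = g" using s2.decomp_unique[OF k(1) g0(1) h(1) g(1)] h(2) by simp
    then show ?thesis using g by blast
  qed
  then obtain \<psi> where "\<And>x. x \<in> s1.X \<Longrightarrow> \<psi> x \<in> s2.X \<and> \<phi> (s1.sub x) = shift d g0 (s2.sub (\<psi> x))" by metis
  then have "descends \<phi> g0 \<psi>" using g0(1) by (simp add: descends_def)
  then show ?thesis by blast
qed

lemma descends_shift:
  assumes \<phi>: "fmap \<phi>" and d: "descends \<phi> g \<psi>" and x: "x \<in> s1.X" and n: "n \<in> G"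
  shows "\<psi> (shift d n x) = shift d n (\<psi> x)"
proof -
  have gG: "g \<in> G" and \<psi>: "\<And>x. x \<in> s1.X \<Longrightarrow> \<psi> x \<in> s2.X"
    and eq: "\<And>x. x \<in> s1.X \<Longrightarrow> \<phi> (s1.sub x) = shift d g (s2.sub (\<psi> x))"
    using d s2.F_G by (auto simp: descends_def)
  have sx: "shift d n x \<in> s1.X" using x n by simp
  have "shift d g (s2.sub (\<psi> (shift d n x))) = \<phi> (s1.sub (shift d n x))" using eq[OF sx] by simp
  also have "\<dots> = shift d (L *\<^sub>v n) (shift d g (s2.sub (\<psi> x)))"
    using x n by (simp add: s1.sub_shift fmap_shift[OF \<phi>] eq)
  also have "\<dots> = shift d (g + L *\<^sub>v n) (s2.sub (\<psi> x))"
    using n gG comm_add_vec[of "L *\<^sub>v n" d g] by (simp add: s2.shift_shift)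
  also have "\<dots> = shift d g (s2.sub (shift d n (\<psi> x)))"
    using n gG by (simp add: s2.sub_shift s2.shift_shift)
  finally have "s2.sub (\<psi> (shift d n x)) = s2.sub (shift d n (\<psi> x))"
    using s2.shift_left_cancel[OF gG] s2.X_Conf \<psi> x n sx by (meson s2.shift_X s2.sub_X)
  then show ?thesis using s2.sub_inj_X \<psi> x n sx by (meson s2.shift_X)
qed

text \<open>To decide \<psi> x at the origin, \<open>sub_injective\<close> needs
  \<open>injectivity_radius c\<close>, the offset g one more c, and \<phi> another r. Passing from
  \<open>s1.sub x\<close> to x adds c for the remainder and divides by 1 + 1 / c; this contraction
  drives the descent.\<close>

lemma descends_coded:
  assumes \<phi>: "fmap \<phi>" and d: "descends \<phi> g \<psi>" and r: "coded \<phi> r"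
    and s: "real (r + 2 * c + injectivity_radius c) \<le> (1 + 1 / real c) * real s"
  shows "coded \<psi> s"
  unfolding coded_def
proof (intro ballI impI)
  have gF: "g \<in> s2.F" "g \<in> G" and \<psi>: "\<And>x. x \<in> s1.X \<Longrightarrow> \<psi> x \<in> s2.X"
    and eq: "\<And>x. x \<in> s1.X \<Longrightarrow> \<phi> (s1.sub x) = shift d g (s2.sub (\<psi> x))"
    using d s2.F_G by (auto simp: descends_def)
  fix x y assume x: "x \<in> s1.X" "y \<in> s1.X" and xy: "\<forall>k\<in>B s. x k = y k"
  have "s1.sub x v = s1.sub y v" if "v \<in> B (r + (c + injectivity_radius c))" for v
    using xy that s by (intro s1.sub_ball[of s _ _ "r + (c + injectivity_radius c)"]) (auto simp: algebra_simps)
  then have \<phi>xy: "\<phi> (s1.sub x) v = \<phi> (s1.sub y) v" if "v \<in> B (c + injectivity_radius c)" for v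
    using coded_ball[OF \<phi> r _ _ _ that] x by simp
  have "s2.sub (\<psi> x) v = s2.sub (\<psi> y) v" if v: "v \<in> B (injectivity_radius c)" for v
  proof -
    have vG: "v \<in> G" using v by (simp add: lattice_ball_iff)
    have "v - g \<in> B (c + injectivity_radius c)"
      using znorm_diff[OF vG gF(2)] v s2.F_le[OF gF(1)] vG gF(2) by (simp add: lattice_ball_iff)
    moreover have "g + (v - g) = v" using vG gF(2) by (intro s1.vec_eqI) auto
    ultimately show ?thesis using \<phi>xy[of "v - g"] vG gF(2) by (simp add: eq[OF x(1)] eq[OF x(2)] s2.shift_apply)
  qed
  then show "\<psi> x (0\<^sub>v d) = \<psi> y (0\<^sub>v d)" using s2.sub_injective \<psi> x by blast
qed

text \<open>Surjectivity is the point. The shift by g of \<open>s2.sub y\<close> has a preimage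
  under \<phi>, which is the shift by some h of \<open>s1.sub x\<close>; hence
  \<open>s2.sub y\<close> is the shift by h of \<open>s2.sub (\<psi> x)\<close>. Recognizability
  gives h = L k, and y is \<psi> of the shift of x by k.\<close>

lemma descends_fmap:
  assumes \<phi>: "fmap \<phi>" and d: "descends \<phi> g \<psi>" shows "fmap \<psi>"
proof -
  have gF: "g \<in> s2.F" "g \<in> G" and \<psi>: "\<And>x. x \<in> s1.X \<Longrightarrow> \<psi> x \<in> s2.X"
    and eq: "\<And>x. x \<in> s1.X \<Longrightarrow> \<phi> (s1.sub x) = shift d g (s2.sub (\<psi> x))"
    using d s2.F_G by (auto simp: descends_def)
  obtain r where r: "coded \<phi> r" using fmap_coded[OF \<phi>] by blast
  have "s2.X \<subseteq> \<psi> ` s1.X"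
  proof
    fix y assume y: "y \<in> s2.X"
    have "shift d g (s2.sub y) \<in> \<phi> ` s1.X"
      using \<phi> y gF(2) by (simp add: fmap_def factor_map_def)
    then obtain w where w: "w \<in> s1.X" "shift d g (s2.sub y) = \<phi> w" by blast
    obtain h x where h: "h \<in> s1.F" "x \<in> s1.X" "w = shift d h (s1.sub x)" using s1.desubstitution[OF w(1)] by blast
    have hG: "h \<in> G" using h(1) by simp
    have "shift d g (s2.sub y) = shift d h (shift d g (s2.sub (\<psi> x)))"
      using w(2) h hG by (simp add: fmap_shift[OF \<phi>] eq)
    also have "\<dots> = shift d g (shift d h (s2.sub (\<psi> x)))"
      using hG gF(2) comm_add_vec[of h d g] by (simp add: s2.shift_shift)
    finally have yx: "s2.sub y = shift d h (s2.sub (\<psi> x))"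
      using s2.shift_left_cancel[OF gF(2)] s2.X_Conf y \<psi>[OF h(2)] hG by (meson s2.shift_X s2.sub_X)
    have "s2.subn 1 (\<psi> x) (h + k) = s2.subn 1 y k" if "k \<in> B (recog_radius c 1)" for k
      using that by (simp add: yx s2.shift_apply lattice_ball_iff)
    then obtain k where k: "k \<in> G" "h = L *\<^sub>v k"
      using s2.recognizability[OF \<psi>[OF h(2)] y hG, of 1] by auto
    have "s2.sub y = s2.sub (\<psi> (shift d k x))"
      using yx k h(2) by (simp add: descends_shift[OF \<phi> d] s2.sub_shift)
    then have "y = \<psi> (shift d k x)" using s2.sub_inj_X[OF y \<psi>] k(1) h(2) by simp
    then show "y \<in> \<psi> ` s1.X" using k(1) h(2) by simp
  qed
  then have "\<psi> ` s1.X = s2.X" using \<psi> by blast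
  \<comment> \<open>Continuity only needs some radius; this one satisfies the inequality without any
    division.\<close>
  moreover have "coded \<psi> (c * (r + 2 * c + injectivity_radius c))"
  proof (rule descends_coded[OF \<phi> d r])
    have "r + 2 * c + injectivity_radius c \<le> c * (r + 2 * c + injectivity_radius c)" using s1.c_pos by simp
    then have "real (r + 2 * c + injectivity_radius c) \<le> real (c * (r + 2 * c + injectivity_radius c))" by (rule of_nat_mono)
    also have "\<dots> \<le> (1 + 1 / real c) * real (c * (r + 2 * c + injectivity_radius c))" by (simp add: algebra_simps)
    finally show "real (r + 2 * c + injectivity_radius c) \<le> (1 + 1 / real c) * real (c * (r + 2 * c + injectivity_radius c))" .
  qed
  ultimately show ?thesis using fmapI descends_shift[OF \<phi> d] by blast
qed

section \<open>Factor maps modulo shifts\<close>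

definition shift_equiv :: "((int Matrix.vec \<Rightarrow> nat) \<Rightarrow> (int Matrix.vec \<Rightarrow> nat)) \<Rightarrow>
    ((int Matrix.vec \<Rightarrow> nat) \<Rightarrow> (int Matrix.vec \<Rightarrow> nat)) \<Rightarrow> bool" where
  "shift_equiv \<phi> \<psi> \<longleftrightarrow> (\<exists>j\<in>G. \<forall>x\<in>s1.X. \<phi> x = shift d j (\<psi> x))"

lemma shift_equiv_refl: "fmap \<phi> \<Longrightarrow> shift_equiv \<phi> \<phi>"
  unfolding shift_equiv_def using s2.shift_zero[OF s2.X_Conf[OF fmap_X]] by (intro bexI[of _ "0\<^sub>v d"]) auto

lemma shift_equiv_sym:
  assumes "fmap \<psi>" "shift_equiv \<phi> \<psi>" shows "shift_equiv \<psi> \<phi>"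
proof -
  obtain j where j: "j \<in> G" "\<And>x. x \<in> s1.X \<Longrightarrow> \<phi> x = shift d j (\<psi> x)" using assms(2) by (auto simp: shift_equiv_def)
  have "- j + j = 0\<^sub>v d" using j(1) by (intro s1.vec_eqI) auto
  then have "\<psi> x = shift d (- j) (\<phi> x)" if "x \<in> s1.X" for x
    using j that s2.shift_zero[OF s2.X_Conf[OF fmap_X[OF assms(1) that]]] by (simp add: s2.shift_shift)
  then show ?thesis unfolding shift_equiv_def using j(1) by (intro bexI[of _ "- j"]) auto
qed

lemma shift_equiv_trans:
  assumes "shift_equiv \<phi> \<psi>" "shift_equiv \<psi> \<chi>" shows "shift_equiv \<phi> \<chi>"
proof -
  obtain i j where "i \<in> G" "\<And>x. x \<in> s1.X \<Longrightarrow> \<phi> x = shift d i (\<psi> x)"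
    and "j \<in> G" "\<And>x. x \<in> s1.X \<Longrightarrow> \<psi> x = shift d j (\<chi> x)" using assms by (auto simp: shift_equiv_def)
  then show ?thesis unfolding shift_equiv_def by (intro bexI[of _ "i + j"]) (auto simp: s2.shift_shift)
qed

text \<open>Injectivity of the descent on classes. On points \<open>s1.sub x\<close> the maps \<phi>
  and \<phi>' differ by the shift i = g + L j - g', and equivariance extends this to all of
  \<open>s1.X\<close>, whose points are shifts of such points.\<close>

lemma descends_equiv:
  assumes \<phi>: "fmap \<phi>" "fmap \<phi>'" and d: "descends \<phi> g \<psi>" "descends \<phi>' g' \<psi>'" and e: "shift_equiv \<psi> \<psi>'"
  shows "shift_equiv \<phi> \<phi>'"
proof -
  obtain j where j: "j \<in> G" "\<And>x. x \<in> s1.X \<Longrightarrow> \<psi> x = shift d j (\<psi>' x)" using e by (auto simp: shift_equiv_def)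
  have G: "g \<in> G" "g' \<in> G" using d s2.F_G by (auto simp: descends_def)
  define i where "i = g + L *\<^sub>v j - g'"
  have i: "i \<in> G" using G j(1) by (simp add: i_def)
  have ig: "i + g' = g + L *\<^sub>v j" unfolding i_def using G j(1) by (intro s1.vec_eqI) auto
  have sub: "\<phi> (s1.sub x) = shift d i (\<phi>' (s1.sub x))" if x: "x \<in> s1.X" for x
  proof -
    have "\<phi> (s1.sub x) = shift d (g + L *\<^sub>v j) (s2.sub (\<psi>' x))"
      using d(1) x j G by (simp add: descends_def s2.sub_shift s2.shift_shift)
    also have "\<dots> = shift d i (shift d g' (s2.sub (\<psi>' x)))" using i G by (simp add: s2.shift_shift ig)
    also have "\<dots> = shift d i (\<phi>' (s1.sub x))" using d(2) x by (simp add: descends_def)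
    finally show ?thesis .
  qed
  have "\<phi> w = shift d i (\<phi>' w)" if w: "w \<in> s1.X" for w
  proof -
    obtain h x where h: "h \<in> s1.F" "x \<in> s1.X" "w = shift d h (s1.sub x)" using s1.desubstitution[OF w] by blast
    have hG: "h \<in> G" using h(1) by simp
    have "\<phi> w = shift d h (shift d i (\<phi>' (s1.sub x)))" unfolding h(3) using h(2) hG by (simp add: fmap_shift[OF \<phi>(1)] sub)
    also have "\<dots> = shift d i (shift d h (\<phi>' (s1.sub x)))" using hG i comm_add_vec[of h d i] by (simp add: s2.shift_shift)
    also have "\<dots> = shift d i (\<phi>' w)" unfolding h(3) using h(2) hG by (simp add: fmap_shift[OF \<phi>(2)])
    finally show ?thesis .
  qed
  then show ?thesis unfolding shift_equiv_def using i by blast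
qed

lemma fmap_cong:
  assumes \<phi>: "fmap \<phi>" and eq: "\<forall>x\<in>s1.X. \<phi> x = \<psi> x" shows "fmap \<psi>"
proof -
  obtain r where r: "coded \<phi> r" using fmap_coded[OF \<phi>] by blast
  have "\<psi> ` s1.X = s2.X"
  proof -
    have "\<psi> ` s1.X = \<phi> ` s1.X" by (rule image_cong[OF refl]) (use eq in simp)
    then show ?thesis using \<phi> by (simp add: fmap_def factor_map_def)
  qed
  moreover have "\<psi> (shift d n x) = shift d n (\<psi> x)" if "x \<in> s1.X" "n \<in> G" for x n
    using fmap_shift[OF \<phi> that] bspec[OF eq that(1)] bspec[OF eq s1.shift_X[OF that]] by simp
  moreover have "coded \<psi> r"
    unfolding coded_def
  proof (intro ballI impI)
    fix x y assume "x \<in> s1.X" "y \<in> s1.X" "\<forall>k\<in>B r. x k = y k"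
    then have "\<phi> x (0\<^sub>v d) = \<phi> y (0\<^sub>v d)" using r unfolding coded_def by blast
    then show "\<psi> x (0\<^sub>v d) = \<psi> y (0\<^sub>v d)" using bspec[OF eq \<open>x \<in> s1.X\<close>] bspec[OF eq \<open>y \<in> s1.X\<close>] by simp
  qed
  ultimately show ?thesis by (rule fmapI)
qed

text \<open>A map in this set is determined by the relation between windows and letters at the
  origin, and there are finitely many such relations. Extensionality removes the arbitrary values
  outside \<open>s1.X\<close>.\<close>

lemma finite_coded: "finite {\<phi> \<in> extensional s1.X. fmap \<phi> \<and> coded \<phi> r}" (is "finite ?K")
proof -
  define graph where "graph \<phi> = (\<lambda>x. (restrict x (B r), \<phi> x (0\<^sub>v d))) ` s1.X" for \<phi> :: "(int Matrix.vec \<Rightarrow> nat) \<Rightarrow> (int Matrix.vec \<Rightarrow> nat)"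
  have "inj_on graph ?K"
  proof (rule inj_onI)
    fix \<phi> \<psi> assume \<phi>: "\<phi> \<in> ?K" and \<psi>: "\<psi> \<in> ?K" and eq: "graph \<phi> = graph \<psi>"
    have zero: "\<phi> x (0\<^sub>v d) = \<psi> x (0\<^sub>v d)" if x: "x \<in> s1.X" for x
    proof -
      have "(restrict x (B r), \<phi> x (0\<^sub>v d)) \<in> graph \<phi>" unfolding graph_def using x by (rule imageI)
      then have "(restrict x (B r), \<phi> x (0\<^sub>v d)) \<in> graph \<psi>" by (simp only: eq)
      then obtain y where y: "y \<in> s1.X" "restrict x (B r) = restrict y (B r)" "\<phi> x (0\<^sub>v d) = \<psi> y (0\<^sub>v d)"
        unfolding graph_def by (elim imageE) simp
      have "\<forall>k\<in>B r. x k = y k"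
      proof
        fix k assume "k \<in> B r"
        then show "x k = y k" using fun_cong[OF y(2), of k] by simp
      qed
      moreover have "coded \<psi> r" using \<psi> by blast
      ultimately have "\<psi> x (0\<^sub>v d) = \<psi> y (0\<^sub>v d)" using x y(1) by (intro codedD)
      then show ?thesis using y(3) by simp
    qed
    have "\<phi> x = \<psi> x" if x: "x \<in> s1.X" for x
    proof (rule PiE_ext)
      show "\<phi> x \<in> s2.Conf" "\<psi> x \<in> s2.Conf" using \<phi> \<psi> x s2.X_Conf fmap_X by auto
      fix n assume n: "n \<in> G"
      have "\<phi> (shift d n x) (0\<^sub>v d) = \<psi> (shift d n x) (0\<^sub>v d)" using zero[of "shift d n x"] x n by simp
      then show "\<phi> x n = \<psi> x n" using \<phi> \<psi> x n by (simp add: fmap_shift s2.shift_apply)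
    qed
    moreover have "\<phi> \<in> extensional s1.X" "\<psi> \<in> extensional s1.X" using \<phi> \<psi> by blast+
    ultimately show "\<phi> = \<psi>" by (intro extensionalityI[of \<phi> s1.X \<psi>])
  qed
  moreover have "graph ` ?K \<subseteq> Pow ((B r \<rightarrow>\<^sub>E s1.A) \<times> s2.A)"
  proof clarify
    fix \<phi> p b assume "fmap \<phi>" "(p, b) \<in> graph \<phi>"
    then obtain x where x: "x \<in> s1.X" "p = restrict x (B r)" "b = \<phi> x (0\<^sub>v d)" by (auto simp: graph_def)
    have "x \<in> s1.Conf" "\<phi> x \<in> s2.Conf" using x(1) s1.X_Conf s2.X_Conf fmap_X[OF \<open>fmap \<phi>\<close>] by auto
    then show "p \<in> B r \<rightarrow>\<^sub>E s1.A \<and> b \<in> s2.A" using x(2,3) s1.ball_G[of r] by auto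
  qed
  moreover have "finite (Pow ((B r \<rightarrow>\<^sub>E s1.A) \<times> s2.A))"
    using s1.finite_A s2.finite_A by (simp add: finite_PiE finite_lattice_ball)
  ultimately show ?thesis by (rule inj_on_finite)
qed

end

text \<open>With C = 2 c + \<open>injectivity_radius c\<close>, descent preserves the radius r once
  r \<ge> c C, and lowers r + 1 to r once r \<ge> c (C + 1).\<close>

definition factor_radius :: "nat \<Rightarrow> nat" where
  "factor_radius c = c * (2 * c + injectivity_radius c + 1) + 1"

context subst_pair
begin

lemma ex_equiv_bounded:
  assumes \<phi>: "fmap \<phi>"
  shows "\<exists>\<psi>. fmap \<psi> \<and> coded \<psi> (factor_radius c) \<and> shift_equiv \<phi> \<psi>"
\<comment> \<open>\<open>ex_descends\<close> needs a base point; over an empty \<open>s1.X\<close>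
  every map is \<open>coded\<close> with every radius.\<close>
proof (cases "s1.X = {}")
  case True
  then show ?thesis using \<phi> shift_equiv_refl by (auto simp: coded_def)
next
  case ne: False
  define U where "U = {\<phi> \<in> extensional s1.X. fmap \<phi>}"
  define K where "K = {\<phi> \<in> extensional s1.X. fmap \<phi> \<and> coded \<phi> (factor_radius c)}"
  have "\<exists>\<psi> g. \<psi> \<in> U \<and> descends \<phi> g \<psi>" if \<phi>: "\<phi> \<in> U" for \<phi>
  proof -
    obtain g \<psi> where d: "descends \<phi> g \<psi>" using ex_descends[OF _ ne, of \<phi>] \<phi> unfolding U_def by blast
    have "descends \<phi> g (restrict \<psi> s1.X)" using d by (simp add: descends_def)
    moreover have "fmap (restrict \<psi> s1.X)"
      using fmap_cong[OF descends_fmap[OF _ d], of "restrict \<psi> s1.X"] \<phi> by (auto simp: U_def)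
    ultimately show ?thesis by (auto simp: U_def)
  qed
  then obtain T g where T: "\<And>\<phi>. \<phi> \<in> U \<Longrightarrow> T \<phi> \<in> U \<and> descends \<phi> (g \<phi>) (T \<phi>)" by metis
  have c: "real c > 0" using s1.c_pos by simp
  have T_coded: "coded (T \<phi>) s" if "\<phi> \<in> U" "coded \<phi> r" "real r + real (2 * c + injectivity_radius c) \<le> real s + real s / real c" for \<phi> r s
    using that T[OF that(1)] by (intro descends_coded[of \<phi> "g \<phi>" "T \<phi>" r s]) (auto simp: U_def algebra_simps)
  have TK: "T \<phi> \<in> K" if "\<phi> \<in> K" for \<phi>
  proof -
    have "real (2 * c + injectivity_radius c) \<le> real (factor_radius c) / real c"
      using c by (simp add: factor_radius_def field_simps)
    then show ?thesis
      using T_coded[of \<phi> "factor_radius c" "factor_radius c"] T[of \<phi>] that by (simp add: K_def U_def)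
  qed
  have inj: "shift_equiv \<phi> \<psi>" if "\<phi> \<in> U" "\<psi> \<in> U" "shift_equiv (T \<phi>) (T \<psi>)" for \<phi> \<psi>
    using descends_equiv that T[OF that(1)] T[OF that(2)] unfolding U_def by blast
  have absorb: "\<exists>\<psi>\<in>K. shift_equiv \<phi> \<psi>" if "\<phi> \<in> U" "\<kappa> \<in> K" "shift_equiv (T \<phi>) \<kappa>" for \<phi> \<kappa>
  proof (rule finite_injective_absorbs[where K = K and U = U and T = T and E = shift_equiv and x = \<phi> and k = \<kappa>])
    show "finite K" unfolding K_def by (rule finite_coded)
    show "K \<subseteq> U" by (auto simp: K_def U_def)
    show "T a \<in> K" if "a \<in> K" for a using TK that .
    show "T a \<in> U" if "a \<in> U" for a using T that by blast
    show "shift_equiv a a" if "a \<in> U" for a using that shift_equiv_refl by (simp add: U_def)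
    show "shift_equiv b a" if "a \<in> U" "b \<in> U" "shift_equiv a b" for a b
      using that shift_equiv_sym[of b a] by (simp add: U_def)
    show "shift_equiv a e" if "a \<in> U" "b \<in> U" "e \<in> U" "shift_equiv a b" "shift_equiv b e" for a b e
      using shift_equiv_trans that by blast
    show "shift_equiv a b" if "a \<in> U" "b \<in> U" "shift_equiv (T a) (T b)" for a b using inj that by blast
  qed (fact that)+
  \<comment> \<open>Above \<open>factor_radius c\<close> one step of T lowers the radius bound by
    one, so the induction hypothesis applies to T \<phi>; \<open>absorb\<close> carries its
    conclusion back to \<phi>.\<close>
  have main: "\<exists>\<psi>\<in>K. shift_equiv \<phi> \<psi>" if "\<phi> \<in> U" "coded \<phi> r" for \<phi> r
    using that
  proof (induction r arbitrary: \<phi>)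
    case 0
    then have "\<phi> \<in> K" using coded_mono[of \<phi> 0 "factor_radius c"] by (simp add: K_def U_def)
    then show ?case using shift_equiv_refl[of \<phi>] by (auto simp: K_def)
  next
    case (Suc r)
    show ?case
    proof (cases "Suc r \<le> factor_radius c")
      case True
      then have "\<phi> \<in> K" using coded_mono[OF Suc.prems(2)] Suc.prems(1) by (simp add: K_def U_def)
      then show ?thesis using shift_equiv_refl[of \<phi>] by (auto simp: K_def)
    next
      case False
      then have "c * (2 * c + injectivity_radius c + 1) \<le> r" by (simp add: factor_radius_def)
      then have "real (c * (2 * c + injectivity_radius c + 1)) \<le> real r" by (rule of_nat_mono)
      then have "real (2 * c + injectivity_radius c + 1) \<le> real r / real c" using c by (simp add: field_simps)
      then have "coded (T \<phi>) r" using T_coded[OF Suc.prems, of r] by simp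
      then obtain \<kappa> where "\<kappa> \<in> K" "shift_equiv (T \<phi>) \<kappa>" using Suc.IH T[OF Suc.prems(1)] by blast
      then show ?thesis using absorb Suc.prems(1) by blast
    qed
  qed
  obtain r where r: "coded \<phi> r" using fmap_coded[OF \<phi>] by blast
  have \<phi>': "fmap (restrict \<phi> s1.X)" by (rule fmap_cong[OF \<phi>]) simp
  obtain \<psi> where "\<psi> \<in> K" "shift_equiv (restrict \<phi> s1.X) \<psi>"
  proof -
    have "coded (restrict \<phi> s1.X) r"
      unfolding coded_def
    proof (intro ballI impI)
      fix x y assume "x \<in> s1.X" "y \<in> s1.X" "\<forall>k\<in>B r. x k = y k"
      then show "restrict \<phi> s1.X x (0\<^sub>v d) = restrict \<phi> s1.X y (0\<^sub>v d)" using codedD[OF r, of x y] by simp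
    qed
    then show ?thesis using main[of "restrict \<phi> s1.X" r] \<phi>' that by (auto simp: U_def)
  qed
  then show ?thesis by (auto simp: K_def shift_equiv_def)
qed

end

section \<open>A lower bound for the expansion constant\<close>

lemma abs_det_le:
  fixes M :: "int mat"
  assumes M: "M \<in> carrier_mat n n" and e: "\<And>i j. i < n \<Longrightarrow> j < n \<Longrightarrow> \<bar>M $$ (i, j)\<bar> \<le> e"
  shows "\<bar>det M\<bar> \<le> fact n * e ^ n"
proof -
  have "\<bar>det M\<bar> \<le> (\<Sum>p | p permutes {0..<n}. \<bar>of_int (sign p) * (\<Prod>i = 0..<n. M $$ (i, p i))\<bar>)"
    unfolding det_def'[OF M] by (rule sum_abs)
  also have "\<dots> \<le> (\<Sum>p | p permutes {0..<n}. e ^ n)"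
  proof (rule sum_mono)
    fix p assume "p \<in> {p. p permutes {0..<n}}"
    then have p: "p i < n" if "i < n" for i using permutes_in_image[of p "{0..<n}" i] that by auto
    have "\<bar>of_int (sign p) * (\<Prod>i = 0..<n. M $$ (i, p i))\<bar> = (\<Prod>i = 0..<n. \<bar>M $$ (i, p i)\<bar>)"
      by (simp add: abs_mult abs_prod sign_def)
    also have "\<dots> \<le> (\<Prod>i = 0..<n. e)" using e p by (intro prod_mono) auto
    finally show "\<bar>of_int (sign p) * (\<Prod>i = 0..<n. M $$ (i, p i))\<bar> \<le> e ^ n" by simp
  qed
  also have "\<dots> = fact n * e ^ n" by (simp add: card_permutations)
  finally show ?thesis .
qed

text \<open>Cofactors have size n - 1, but the bound is stated with n so that no subtraction enters
  the computable constant.\<close>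

lemma abs_adj_mat_le:
  fixes M :: "int mat"
  assumes M: "M \<in> carrier_mat n n" and e: "\<And>i j. i < n \<Longrightarrow> j < n \<Longrightarrow> \<bar>M $$ (i, j)\<bar> \<le> e" "1 \<le> e"
    and ij: "i < n" "j < n"
  shows "\<bar>adj_mat M $$ (i, j)\<bar> \<le> int (n ^ n) * e ^ n"
proof -
  have "\<bar>adj_mat M $$ (i, j)\<bar> = \<bar>det (mat_delete M j i)\<bar>"
    using M ij by (simp add: adj_mat_def cofactor_def abs_mult power_abs)
  also have "\<dots> \<le> fact (n - 1) * e ^ (n - 1)"
  proof (rule abs_det_le)
    show "mat_delete M j i \<in> carrier_mat (n - 1) (n - 1)" by (rule mat_delete_carrier[OF M])
    show "\<bar>mat_delete M j i $$ (k, l)\<bar> \<le> e" if "k < n - 1" "l < n - 1" for k l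
      using M that by (auto simp: mat_delete_def intro!: e(1))
  qed
  also have "\<dots> \<le> int (n ^ n) * e ^ n"
  proof (rule mult_mono)
    have "fact (n - 1) \<le> (fact n :: int)" by (rule fact_mono) simp
    also have "\<dots> \<le> of_nat (n ^ n)" by (rule fact_le_power)
    finally show "fact (n - 1) \<le> int (n ^ n)" .
    show "e ^ (n - 1) \<le> e ^ n" using e(2) by (intro power_increasing) auto
  qed (use e(2) in auto)
  finally show ?thesis .
qed

lemma abs_coord_mult_le:
  fixes v :: "int Matrix.vec"
  assumes "v \<in> Zd d" "i < d" "j < d" shows "\<bar>v $ i * v $ j\<bar> \<le> v \<bullet> v"
proof -
  have sq: "v $ k * v $ k \<le> v \<bullet> v" if "k < d" for k
    using that assms(1) member_le_sum[of k "{0..<d}" "\<lambda>k. v $ k * v $ k"] by (simp add: scalar_prod_def)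
  have "0 \<le> (\<bar>v $ i\<bar> - \<bar>v $ j\<bar>) * (\<bar>v $ i\<bar> - \<bar>v $ j\<bar>)" by simp
  then have "2 * \<bar>v $ i * v $ j\<bar> \<le> v $ i * v $ i + v $ j * v $ j" by (simp add: algebra_simps abs_mult)
  then show ?thesis using sq[OF assms(2)] sq[OF assms(3)] by linarith
qed

lemma abs_bilinear_le:
  fixes v :: "int Matrix.vec" and M :: "int mat"
  assumes M: "M \<in> carrier_mat d d" "\<And>i j. i < d \<Longrightarrow> j < d \<Longrightarrow> \<bar>M $$ (i, j)\<bar> \<le> e" and v: "v \<in> Zd d"
  shows "\<bar>(M *\<^sub>v v) \<bullet> v\<bar> \<le> int d * int d * e * (v \<bullet> v)"
proof -
  have "(M *\<^sub>v v) \<bullet> v = (\<Sum>i = 0..<d. \<Sum>j = 0..<d. M $$ (i, j) * (v $ j * v $ i))"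
    using M(1) v by (simp add: scalar_prod_def sum_distrib_right index_mult_mat_vec mult.assoc)
  also have "\<bar>\<dots>\<bar> \<le> (\<Sum>i = 0..<d. \<Sum>j = 0..<d. \<bar>M $$ (i, j) * (v $ j * v $ i)\<bar>)"
    by (intro order_trans[OF sum_abs] sum_mono sum_abs)
  also have "\<dots> \<le> (\<Sum>i = 0..<d. \<Sum>j = 0..<d. e * (v \<bullet> v))"
  proof (intro sum_mono)
    fix i j assume "i \<in> {0..<d}" "j \<in> {0..<d}"
    then have ij: "i < d" "j < d" by auto
    have "0 \<le> e" using M(2)[OF ij] by linarith
    then show "\<bar>M $$ (i, j) * (v $ j * v $ i)\<bar> \<le> e * (v \<bullet> v)"
      unfolding abs_mult[of "M $$ (i, j)"] using M(2)[OF ij] abs_coord_mult_le[OF v ij(2,1)] by (intro mult_mono) auto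
  qed
  finally show ?thesis by (simp add: mult.assoc)
qed

lemma znorm_sq: "v \<in> Zd d \<Longrightarrow> (znorm v)\<^sup>2 = real_of_int (v \<bullet> v)"
proof -
  assume v: "v \<in> Zd d"
  have "0 \<le> map_vec real_of_int v \<bullet> map_vec real_of_int v" by (simp add: scalar_prod_def sum_nonneg)
  then show ?thesis by (simp add: znorm_def enorm_def scalar_prod_def)
qed

text \<open>\<open>Q v = \<parallel>L v\<parallel>\<^sup>2 - \<parallel>v\<parallel>\<^sup>2\<close> is a positive definite integral quadratic form, with matrix
  \<open>N = L\<^sup>T L - 1\<close>. The Cauchy--Schwarz inequality for \<open>v\<close> and \<open>z = adj N v\<close>, for which \<open>N z = det N v\<close>,
  bounds \<open>Q\<close> from below since \<open>\<bar>det N\<bar> \<ge> 1\<close>.\<close>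

lemma expansion_gap:
  assumes L: "expansion_matrix d L" and b: "\<And>i j. i < d \<Longrightarrow> j < d \<Longrightarrow> \<bar>L $$ (i, j)\<bar> \<le> b"
    and v: "v \<in> Zd d"
  shows "v \<bullet> v \<le> int d * int d * (int (d ^ d) * (int d * (b * b) + 1) ^ d) * ((L *\<^sub>v v) \<bullet> (L *\<^sub>v v) - v \<bullet> v)"
proof (cases "v = 0\<^sub>v d")
  case True
  have "L \<in> carrier_mat d d" using L by (simp add: expansion_matrix_def)
  then show ?thesis unfolding True by (simp add: mult_mat_vec_zero)
next
  case v0: False
  have Lc: "L \<in> carrier_mat d d" using L by (simp add: expansion_matrix_def)
  define N where "N = L\<^sup>T * L - 1\<^sub>m d"
  define e where "e = int d * (b * b) + 1"
  have Nc: "N \<in> carrier_mat d d" by (simp add: N_def minus_carrier_mat)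
  have Lv: "L *\<^sub>v u \<in> Zd d" if "u \<in> Zd d" for u using Lc that by simp
  have Nu: "N *\<^sub>v u = L\<^sup>T *\<^sub>v (L *\<^sub>v u) - u" if "u \<in> Zd d" for u
    using Lc that minus_mult_distrib_mat_vec[of "L\<^sup>T * L" d d "1\<^sub>m d" u] by (simp add: N_def)
  have Nu_c: "N *\<^sub>v u \<in> Zd d" if "u \<in> Zd d" for u using Nc that by simp
  have form: "w \<bullet> (N *\<^sub>v u) = (L *\<^sub>v w) \<bullet> (L *\<^sub>v u) - w \<bullet> u" if "w \<in> Zd d" "u \<in> Zd d" for w u
  proof -
    have "w \<bullet> (N *\<^sub>v u) = w \<bullet> (L\<^sup>T *\<^sub>v (L *\<^sub>v u)) - w \<bullet> u"
      unfolding Nu[OF that(2)] using that Lc by (intro scalar_prod_minus_distrib[of _ d]) auto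
    also have "w \<bullet> (L\<^sup>T *\<^sub>v (L *\<^sub>v u)) = (L\<^sup>T *\<^sub>v (L *\<^sub>v u)) \<bullet> w"
      using that Lc by (intro comm_scalar_prod[of _ d]) auto
    also have "\<dots> = (L *\<^sub>v u) \<bullet> (L *\<^sub>v w)"
      by (rule transpose_vec_mult_scalar[OF Lc that(1) Lv[OF that(2)]])
    also have "\<dots> = (L *\<^sub>v w) \<bullet> (L *\<^sub>v u)" using that Lv by (intro comm_scalar_prod[of _ d]) auto
    finally show ?thesis .
  qed
  have symm: "w \<bullet> (N *\<^sub>v u) = u \<bullet> (N *\<^sub>v w)" if "w \<in> Zd d" "u \<in> Zd d" for w u
    using form[OF that] form[OF that(2,1)] comm_scalar_prod[OF that] comm_scalar_prod[OF Lv[OF that(1)] Lv[OF that(2)]] by simp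
  have pos: "0 < u \<bullet> (N *\<^sub>v u)" if u: "u \<in> Zd d" "u \<noteq> 0\<^sub>v d" for u
  proof -
    obtain l where l: "l > 1"
      "\<And>x. x \<in> carrier_vec d - {0\<^sub>v d} \<Longrightarrow> enorm (map_mat real_of_int L *\<^sub>v x) > l * enorm x"
      using L unfolding expansion_matrix_def by blast
    have "map_vec real_of_int u \<noteq> 0\<^sub>v d"
    proof
      assume "map_vec real_of_int u = 0\<^sub>v d"
      then have "u = 0\<^sub>v d" using u(1) by (metis of_int_hom.vec_hom_zero_iff)
      then show False using u(2) by simp
    qed
    then have "l * znorm u < enorm (map_mat real_of_int L *\<^sub>v map_vec real_of_int u)"
      using l(2)[of "map_vec real_of_int u"] u(1) by (simp add: znorm_def)
    also have "\<dots> = znorm (L *\<^sub>v u)"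
      unfolding znorm_def of_int_hom.mult_mat_vec_hom[OF Lc u(1)] ..
    finally have "znorm u < znorm (L *\<^sub>v u)"
      using l(1) mult_right_mono[of 1 l "znorm u"] znorm_nonneg[of u] by simp
    then have "(znorm u)\<^sup>2 < (znorm (L *\<^sub>v u))\<^sup>2" using znorm_nonneg by (intro power_strict_mono) auto
    then show ?thesis unfolding znorm_sq[OF u(1)] znorm_sq[OF Lv[OF u(1)]] form[OF u(1) u(1)] by simp
  qed
  \<comment> \<open>A singular integer matrix has a nonzero integer vector in its kernel, which
    positivity on integer vectors excludes.\<close>
  have det0: "det N \<noteq> 0"
  proof
    assume "det N = 0"
    then obtain u where "u \<in> Zd d" "u \<noteq> 0\<^sub>v d" "N *\<^sub>v u = 0\<^sub>v d" using det_0_iff_vec_prod_zero[OF Nc] by blast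
    then show False using pos[of u] by simp
  qed
  define z where "z = adj_mat N *\<^sub>v v"
  have z: "z \<in> Zd d" using adj_mat(1)[OF Nc] v by (simp add: z_def)
  have Nz: "N *\<^sub>v z = det N \<cdot>\<^sub>v v"
  proof -
    have "N *\<^sub>v z = (N * adj_mat N) *\<^sub>v v" unfolding z_def using assoc_mult_mat_vec[OF Nc adj_mat(1)[OF Nc] v] by simp
    also have "\<dots> = det N \<cdot>\<^sub>v v"
      unfolding adj_mat(2)[OF Nc] using v by (intro eq_vecI) (simp_all add: scalar_prod_smult_left index_mult_mat_vec)
    finally show ?thesis .
  qed
  have z0: "z \<noteq> 0\<^sub>v d"
  proof
    assume "z = 0\<^sub>v d"
    then have "det N \<cdot>\<^sub>v v = 0\<^sub>v d" using Nz mult_mat_vec_zero[OF Nc] by simp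
    then have "v $ i = 0" if "i < d" for i using det0 v that by (metis carrier_vecD index_smult_vec(1) index_zero_vec(1) mult_eq_0_iff)
    then have "v = 0\<^sub>v d" using v by (intro eq_vecI) auto
    then show False using v0 by simp
  qed
  define \<alpha> \<beta> q where "\<alpha> = z \<bullet> (N *\<^sub>v z)" and "\<beta> = v \<bullet> (N *\<^sub>v z)" and "q = v \<bullet> (N *\<^sub>v v)"
  have \<alpha>: "0 < \<alpha>" unfolding \<alpha>_def by (rule pos[OF z z0])
  \<comment> \<open>The component of v orthogonal to z for the form N, multiplied by \<alpha> to
    stay integral; nonnegativity of the form at w is the Cauchy-Schwarz inequality.\<close>
  define w where "w = \<alpha> \<cdot>\<^sub>v v - \<beta> \<cdot>\<^sub>v z"
  have w: "w \<in> Zd d" using v z by (simp add: w_def)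
  have lin: "w \<bullet> y = \<alpha> * (v \<bullet> y) - \<beta> * (z \<bullet> y)" if "y \<in> Zd d" for y
    unfolding w_def using v z that minus_scalar_prod_distrib[of "\<alpha> \<cdot>\<^sub>v v" d "\<beta> \<cdot>\<^sub>v z" y] by simp
  have "w \<bullet> (N *\<^sub>v w) = \<alpha> * (w \<bullet> (N *\<^sub>v v)) - \<beta> * (w \<bullet> (N *\<^sub>v z))"
    using lin[OF Nu_c[OF w]] symm[OF v w] symm[OF z w] by simp
  also have "\<dots> = \<alpha> * (\<alpha> * q - \<beta> * \<beta>)"
  proof -
    have "w \<bullet> (N *\<^sub>v v) = \<alpha> * q - \<beta> * \<beta>"
      using lin[OF Nu_c[OF v]] symm[OF z v] by (simp add: \<beta>_def q_def)
    moreover have "w \<bullet> (N *\<^sub>v z) = 0"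
      using lin[OF Nu_c[OF z]] by (simp add: \<alpha>_def \<beta>_def mult.commute)
    ultimately show ?thesis by simp
  qed
  finally have ww: "w \<bullet> (N *\<^sub>v w) = \<alpha> * (\<alpha> * q - \<beta> * \<beta>)" .
  have "0 \<le> w \<bullet> (N *\<^sub>v w)"
  proof (cases "w = 0\<^sub>v d")
    case True
    then show ?thesis using Nu_c[OF w] by simp
  qed (use pos[OF w] in simp)
  then have cs: "\<beta> * \<beta> \<le> \<alpha> * q" using \<alpha> unfolding ww by (simp add: zero_le_mult_iff)
  define D where "D = \<bar>det N\<bar>"
  have D: "1 \<le> D" using det0 by (simp add: D_def)
  have vv: "0 \<le> v \<bullet> v" by (simp add: scalar_prod_def sum_nonneg)
  have vv0: "0 < v \<bullet> v"
  proof -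
    obtain i where i: "i < d" "v $ i \<noteq> 0" using v0 v by (metis carrier_vecD eq_vecI index_zero_vec)
    have "v $ i * v $ i \<noteq> 0" using i(2) by simp
    then have "0 < \<bar>v $ i * v $ i\<bar>" using zero_less_abs_iff by blast
    also have "\<dots> \<le> v \<bullet> v" by (rule abs_coord_mult_le[OF v i(1) i(1)])
    finally show ?thesis .
  qed
  have q0: "0 \<le> q" unfolding q_def using pos[OF v v0] by simp
  define E where "E = int d * int d * (int (d ^ d) * e ^ d)"
  have zv: "\<bar>z \<bullet> v\<bar> \<le> E * (v \<bullet> v)"
    unfolding z_def E_def
  proof (rule abs_bilinear_le[OF adj_mat(1)[OF Nc] abs_adj_mat_le[OF Nc] v])
    show "\<bar>N $$ (i, j)\<bar> \<le> e" if ij: "i < d" "j < d" for i j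
    proof -
      have "N $$ (i, j) = (\<Sum>k = 0..<d. L $$ (k, i) * L $$ (k, j)) - (if i = j then 1 else 0)"
        using ij Lc by (simp add: N_def scalar_prod_def)
      moreover have "\<bar>\<Sum>k = 0..<d. L $$ (k, i) * L $$ (k, j)\<bar> \<le> (\<Sum>k = 0..<d. b * b)"
      proof (intro order_trans[OF sum_abs] sum_mono)
        fix k assume "k \<in> {0..<d}"
        then have k: "k < d" by simp
        show "\<bar>L $$ (k, i) * L $$ (k, j)\<bar> \<le> b * b"
          unfolding abs_mult using b[OF k ij(1)] b[OF k ij(2)] by (intro mult_mono) auto
      qed
      ultimately show ?thesis by (auto simp: e_def split: if_splits)
    qed
    show "1 \<le> e" by (simp add: e_def)
  qed
  have "\<beta> = det N * (v \<bullet> v)" unfolding \<beta>_def Nz using v by simp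
  then have "\<beta> * \<beta> = D * (v \<bullet> v) * (D * (v \<bullet> v))" by (simp add: D_def mult.commute mult.left_commute)
  moreover have "\<alpha> \<le> D * (E * (v \<bullet> v))"
  proof -
    have "\<alpha> = det N * (z \<bullet> v)" unfolding \<alpha>_def Nz using v z by simp
    also have "\<dots> \<le> D * \<bar>z \<bullet> v\<bar>" unfolding D_def by (metis abs_ge_self abs_mult)
    also have "\<dots> \<le> D * (E * (v \<bullet> v))" using zv D by (intro mult_left_mono) auto
    finally show ?thesis .
  qed
  then have "\<alpha> * q \<le> D * (E * (v \<bullet> v)) * q" using q0 by (rule mult_right_mono)
  ultimately have "D * (v \<bullet> v) * (D * (v \<bullet> v)) \<le> D * (v \<bullet> v) * (E * q)" using cs by (simp add: mult.commute mult.left_commute)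
  then have "D * (v \<bullet> v) \<le> E * q" using D vv0 by (simp add: mult_le_cancel_left zero_less_mult_iff)
  moreover have "1 * (v \<bullet> v) \<le> D * (v \<bullet> v)" using D vv by (rule mult_right_mono)
  ultimately have "v \<bullet> v \<le> E * q" by linarith
  then show ?thesis unfolding E_def e_def q_def form[OF v v] .
qed

section \<open>Computability\<close>

text \<open>Codes dominate the numbers they encode, so the size of the data can be bounded by the
  code itself.\<close>

lemma le_list_encode: "x \<in> set xs \<Longrightarrow> x \<le> list_encode xs"
proof (induction xs)
  case (Cons y ys)
  then show ?case
    using le_prod_encode_1[of y "list_encode ys"] le_prod_encode_2[of "list_encode ys" y] by fastforce
qed simp

lemma length_le_list_encode: "length xs \<le> list_encode xs"
proof (induction xs)
  case (Cons y ys)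
  then show ?case using le_prod_encode_2[of "list_encode ys" y] by simp
qed simp

lemma le_set_encode: "finite S \<Longrightarrow> x \<in> S \<Longrightarrow> x \<le> set_encode S"
proof -
  assume S: "finite S" "x \<in> S"
  have "x \<le> 2 ^ x" using less_exp[of x] by simp
  also have "\<dots> \<le> set_encode S" unfolding set_encode_def using S by (intro member_le_sum) auto
  finally show ?thesis .
qed

lemma abs_le_int_encode: "\<bar>i\<bar> \<le> int (int_encode i)"
  by (auto simp: int_encode_def sum_encode_def)

lemma abs_le_vec_code: "i < dim_vec v \<Longrightarrow> \<bar>v $ i\<bar> \<le> int (vec_code v)"
proof -
  assume "i < dim_vec v"
  then have "v $ i \<in> set (list_of_vec v)" by (auto simp: set_list_of_vec vec_set_def)
  then have "int_encode (v $ i) \<le> vec_code v" unfolding vec_code_def by (intro le_list_encode) auto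
  then show ?thesis using abs_le_int_encode[of "v $ i"] by linarith
qed

lemma dim_row_le_mat_code: "dim_row M \<le> mat_code M"
  using length_le_list_encode[of "map vec_code (rows M)"] by (simp add: mat_code_def)

lemma abs_le_mat_code: "i < dim_row M \<Longrightarrow> j < dim_col M \<Longrightarrow> \<bar>M $$ (i, j)\<bar> \<le> int (mat_code M)"
proof -
  assume ij: "i < dim_row M" "j < dim_col M"
  then have "row M i \<in> set (rows M)" by (auto simp: rows_def)
  then have "vec_code (row M i) \<le> mat_code M" unfolding mat_code_def by (intro le_list_encode) auto
  moreover have "\<bar>row M i $ j\<bar> \<le> int (vec_code (row M i))" using ij by (intro abs_le_vec_code) simp
  ultimately show ?thesis using ij by simp
qed

lemma mat_code_le_subst_code: "mat_code (expansion \<zeta>) \<le> subst_code \<zeta>"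
  by (simp add: subst_code_def le_prod_encode_1)

lemma subst_code_bounds:
  assumes \<zeta>: "constant_shape_substitution \<zeta>" and a: "a \<in> alphabet \<zeta>" and f: "f \<in> supp \<zeta>"
  shows "a \<le> subst_code \<zeta>" "vec_code f \<le> subst_code \<zeta>"
proof -
  define S where "S = {prod_encode (a, prod_encode (vec_code f, subst_rule \<zeta> a f)) | a f. a \<in> alphabet \<zeta> \<and> f \<in> supp \<zeta>}"
  have "S = (\<lambda>(a, f). prod_encode (a, prod_encode (vec_code f, subst_rule \<zeta> a f))) ` (alphabet \<zeta> \<times> supp \<zeta>)"
    by (auto simp: S_def)
  moreover have "finite (alphabet \<zeta> \<times> supp \<zeta>)"
    using \<zeta> finite_fundamental_domain unfolding constant_shape_substitution_def by blast
  ultimately have "finite S" by simp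
  moreover have "prod_encode (a, prod_encode (vec_code f, subst_rule \<zeta> a f)) \<in> S" using a f by (auto simp: S_def)
  ultimately have "prod_encode (a, prod_encode (vec_code f, subst_rule \<zeta> a f)) \<le> set_encode S" by (rule le_set_encode)
  also have "\<dots> \<le> subst_code \<zeta>" by (simp add: subst_code_def S_def le_prod_encode_2)
  finally have *: "prod_encode (a, prod_encode (vec_code f, subst_rule \<zeta> a f)) \<le> subst_code \<zeta>" .
  show "a \<le> subst_code \<zeta>" using * le_prod_encode_1 le_trans by blast
  have "vec_code f \<le> prod_encode (vec_code f, subst_rule \<zeta> a f)" by (rule le_prod_encode_1)
  also have "\<dots> \<le> prod_encode (a, prod_encode (vec_code f, subst_rule \<zeta> a f))" by (rule le_prod_encode_2)
  finally show "vec_code f \<le> subst_code \<zeta>" using * by simp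
qed

lemma znorm_le_coords:
  assumes v: "v \<in> Zd d" and b: "\<And>i. i < d \<Longrightarrow> \<bar>real_of_int (v $ i)\<bar> \<le> b"
  shows "znorm v \<le> real d * b"
proof -
  have "znorm v \<le> (\<Sum>i<d. \<bar>real_of_int (v $ i)\<bar>)" unfolding znorm_L2_set[OF v] by (rule L2_set_le_sum_abs)
  also have "\<dots> \<le> (\<Sum>i<d. b)" using b by (intro sum_mono) simp
  finally show ?thesis by simp
qed

text \<open>The constant of \<open>expansion_gap\<close> with the dimension and the entry bound
  replaced by s; the factor 3 comes from (1 + 1 / c)^2 \<le> 1 + 3 / c in
  \<open>gap_sqrt\<close>.\<close>

definition gap_bound :: "nat \<Rightarrow> nat" where
  "gap_bound s = 3 * (s * s * (s ^ s * (s * (s * s) + 1) ^ s))"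

text \<open>Besides the gap, the summands bound the Lipschitz constant d d s of \<open>L\<close>,
  the norm d s of a digit, the dimension, and the number of letters, which all lie in
  {0..s}.\<close>

definition size_bound :: "nat \<Rightarrow> nat" where
  "size_bound s = gap_bound s + s * s * s + s * s + s + 1"

lemma gap_sqrt:
  fixes E x y :: real
  assumes E: "0 < E" and xy: "0 \<le> y" "x\<^sup>2 \<le> E * (y\<^sup>2 - x\<^sup>2)" and c: "3 * E \<le> c" "1 \<le> c"
  shows "(1 + 1 / c) * x \<le> y"
proof (rule power2_le_imp_le[OF _ xy(1)])
  have "(1 + 1 / c)\<^sup>2 = 1 + (2 * c + 1) / (c * c)" using c by (simp add: power2_eq_square field_simps)
  also have "(2 * c + 1) / (c * c) \<le> (3 * c) / (c * c)" using c by (intro divide_right_mono) auto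
  also have "(3 * c) / (c * c) = 3 / c" using c by simp
  also have "3 / c \<le> 1 / E" using E c by (simp add: field_simps)
  finally have "(1 + 1 / c)\<^sup>2 \<le> 1 + 1 / E" by simp
  then have "(1 + 1 / c)\<^sup>2 * x\<^sup>2 \<le> (1 + 1 / E) * x\<^sup>2" by (rule mult_right_mono) simp
  also have "\<dots> = x\<^sup>2 + x\<^sup>2 / E" by (simp add: algebra_simps)
  also have "x\<^sup>2 / E \<le> y\<^sup>2 - x\<^sup>2" using xy(2) E by (simp add: field_simps)
  finally show "((1 + 1 / c) * x)\<^sup>2 \<le> y\<^sup>2" by (simp add: power_mult_distrib)
qed

lemma csubstI:
  assumes \<zeta>: "constant_shape_substitution \<zeta>" and s: "subst_code \<zeta> \<le> s"
  shows "csubst (sdim \<zeta>) (expansion \<zeta>) (size_bound s) \<zeta>"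
proof -
  define d L where "d = sdim \<zeta>" and "L = expansion \<zeta>"
  have Lc: "L \<in> carrier_mat d d" unfolding d_def L_def by (rule expansion_carrier[OF \<zeta>])
  have L: "expansion_matrix d L" using \<zeta> unfolding constant_shape_substitution_def d_def L_def by blast
  have d1: "1 \<le> d" using \<zeta> unfolding constant_shape_substitution_def d_def by blast
  have mc: "mat_code L \<le> s" using mat_code_le_subst_code[of \<zeta>] s by (simp add: L_def)
  have ds: "d \<le> s" using dim_row_le_mat_code[of L] mc unfolding d_def L_def by linarith
  have s1: "1 \<le> s" using d1 ds by simp
  have entry: "\<bar>L $$ (i, j)\<bar> \<le> int s" if "i < d" "j < d" for i j
    using abs_le_mat_code[of i L j] Lc that mc by simp
  have "expanding d L (size_bound s)"
  proof
    show "L \<in> carrier_mat d d" by (rule Lc)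
    show "1 \<le> size_bound s" "d \<le> size_bound s" using ds by (simp_all add: size_bound_def)
    fix v assume v: "v \<in> Zd d"
    have Lv: "L *\<^sub>v v \<in> Zd d" using Lc v by simp
    define E where "E = d * d * (d ^ d * (d * (s * s) + 1) ^ d)"
    have E1: "0 < E" using d1 by (simp add: E_def)
    have "E \<le> s * s * (s ^ s * (s * (s * s) + 1) ^ s)"
    proof -
      have "d ^ d \<le> s ^ s" using power_mono[OF ds, of d] power_increasing[OF ds, of s] s1 by linarith
      moreover have "(d * (s * s) + 1) ^ d \<le> (s * (s * s) + 1) ^ s"
      proof -
        have "d * (s * s) + 1 \<le> s * (s * s) + 1" using mult_le_mono1[OF ds] by (rule add_le_mono1)
        then have "(d * (s * s) + 1) ^ d \<le> (s * (s * s) + 1) ^ d" by (rule power_mono) simp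
        also have "\<dots> \<le> (s * (s * s) + 1) ^ s" by (rule power_increasing[OF ds]) simp
        finally show ?thesis .
      qed
      ultimately show ?thesis unfolding E_def using ds by (intro mult_le_mono)
    qed
    then have cE: "3 * E \<le> size_bound s" by (simp add: size_bound_def gap_bound_def)
    have "v \<bullet> v \<le> int d * int d * (int (d ^ d) * (int d * (int s * int s) + 1) ^ d) * ((L *\<^sub>v v) \<bullet> (L *\<^sub>v v) - v \<bullet> v)"
      by (rule expansion_gap[OF L entry v])
    also have "int d * int d * (int (d ^ d) * (int d * (int s * int s) + 1) ^ d) = int E" by (simp add: E_def add.commute)
    finally have "real_of_int (v \<bullet> v) \<le> real_of_int (int E * ((L *\<^sub>v v) \<bullet> (L *\<^sub>v v) - v \<bullet> v))" by (rule of_int_le_iff[THEN iffD2])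
    then have sq: "(znorm v)\<^sup>2 \<le> real E * ((znorm (L *\<^sub>v v))\<^sup>2 - (znorm v)\<^sup>2)"
      unfolding znorm_sq[OF v] znorm_sq[OF Lv] by simp
    show "(1 + 1 / real (size_bound s)) * znorm v \<le> znorm (L *\<^sub>v v)"
    proof (rule gap_sqrt[OF _ znorm_nonneg sq])
      show "0 < real E" using E1 by simp
      have "real (3 * E) \<le> real (size_bound s)" using cE by (rule of_nat_mono)
      then show "3 * real E \<le> real (size_bound s)" by simp
      show "1 \<le> real (size_bound s)" by (simp add: size_bound_def)
    qed
    have "\<bar>real_of_int ((L *\<^sub>v v) $ i)\<bar> \<le> real d * (real s * znorm v)" if i: "i < d" for i
    proof -
      have "real_of_int ((L *\<^sub>v v) $ i) = (\<Sum>j = 0..<d. real_of_int (L $$ (i, j)) * real_of_int (v $ j))"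
        using i Lc v by (simp add: index_mult_mat_vec scalar_prod_def)
      also have "\<bar>\<dots>\<bar> \<le> (\<Sum>j = 0..<d. real s * znorm v)"
      proof (intro order_trans[OF sum_abs] sum_mono)
        fix j assume "j \<in> {0..<d}"
        then have j: "j < d" by simp
        have "\<bar>real_of_int (L $$ (i, j))\<bar> \<le> real s" using entry[OF i j] by linarith
        then show "\<bar>real_of_int (L $$ (i, j)) * real_of_int (v $ j)\<bar> \<le> real s * znorm v"
          unfolding abs_mult using znorm_coord[OF v j] by (intro mult_mono) auto
      qed
      finally show ?thesis by simp
    qed
    then have "znorm (L *\<^sub>v v) \<le> real d * (real d * (real s * znorm v))" by (rule znorm_le_coords[OF Lv])
    also have "\<dots> = real (d * d * s) * znorm v" by simp
    also have "\<dots> \<le> real (size_bound s) * znorm v"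
    proof (rule mult_right_mono[OF _ znorm_nonneg])
      have "d * d * s \<le> s * s * s" using ds by (intro mult_le_mono) auto
      then show "real (d * d * s) \<le> real (size_bound s)" unfolding of_nat_le_iff size_bound_def by linarith
    qed
    finally show "znorm (L *\<^sub>v v) \<le> real (size_bound s) * znorm v" .
  qed
  moreover have "csubst_axioms L (size_bound s) \<zeta>"
  proof
    show "constant_shape_substitution \<zeta>" by (rule \<zeta>)
    show "expansion \<zeta> = L" by (simp add: L_def)
    have A: "alphabet \<zeta> \<noteq> {}" and F: "0\<^sub>v d \<in> supp \<zeta>" "supp \<zeta> \<subseteq> Zd d"
      using \<zeta> unfolding constant_shape_substitution_def fundamental_domain_def d_def by blast+
    have "alphabet \<zeta> \<subseteq> {..s}" using subst_code_bounds(1)[OF \<zeta> _ F(1)] s by fastforce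
    then have "card (alphabet \<zeta>) \<le> s + 1" using card_mono[of "{..s}" "alphabet \<zeta>"] by simp
    then show "card (alphabet \<zeta>) \<le> size_bound s" by (simp add: size_bound_def)
    fix f assume f: "f \<in> supp \<zeta>"
    have fd: "f \<in> Zd d" using f F(2) by blast
    obtain a where "a \<in> alphabet \<zeta>" using A by blast
    then have vf: "vec_code f \<le> s" using subst_code_bounds(2)[OF \<zeta> _ f] s le_trans by blast
    have "\<bar>real_of_int (f $ i)\<bar> \<le> real s" if "i < d" for i
      using abs_le_vec_code[of i f] that fd vf by simp
    then have "znorm f \<le> real d * real s" by (rule znorm_le_coords[OF fd])
    also have "\<dots> \<le> real (size_bound s)"
    proof -
      have "d * s \<le> s * s" using ds by (rule mult_le_mono1)
      then show ?thesis unfolding of_nat_mult[symmetric] of_nat_le_iff size_bound_def by linarith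
    qed
    finally show "znorm f \<le> real (size_bound s)" .
  qed
  ultimately show ?thesis unfolding d_def L_def by (rule csubst.intro)
qed

section \<open>Recursive functions computing the bound\<close>

definition computable2 :: "(nat \<Rightarrow> nat \<Rightarrow> nat) \<Rightarrow> bool" where
  "computable2 f \<longleftrightarrow> (\<exists>p. \<forall>a b. recf_eval p [a, b] (f a b))"

definition recf_add :: recf where "recf_add = Prec (Proj 0) (Comp Succ [Proj 1])"
definition recf_mult :: recf where "recf_mult = Prec Zero (Comp recf_add [Proj 1, Proj 2])"
text \<open>Primitive recursion runs over the first argument, so the exponent precedes the
  base.\<close>

definition recf_power :: recf where "recf_power = Prec (Comp Succ [Zero]) (Comp recf_mult [Proj 1, Proj 2])"

lemma recf_eval_Proj: "i < length xs \<Longrightarrow> y = xs ! i \<Longrightarrow> recf_eval (Proj i) xs y"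
  by (auto intro: recf_eval.Proj)

lemma recf_eval_Comp1: "recf_eval g xs y \<Longrightarrow> recf_eval f [y] z \<Longrightarrow> recf_eval (Comp f [g]) xs z"
  by (rule recf_eval.Comp[of _ _ "[y]"]) auto

lemma recf_eval_Comp2:
  "recf_eval g xs y \<Longrightarrow> recf_eval h xs y' \<Longrightarrow> recf_eval f [y, y'] z \<Longrightarrow> recf_eval (Comp f [g, h]) xs z"
  by (rule recf_eval.Comp[of _ _ "[y, y']"]) auto

lemma recf_eval_add: "recf_eval recf_add [n, x] (n + x)"
  unfolding recf_add_def
proof (induction n)
  case 0
  show ?case by (rule recf_eval.Prec_0) (simp add: recf_eval_Proj)
next
  case (Suc n)
  have "recf_eval (Comp Succ [Proj 1]) [n, n + x, x] (Suc (n + x))"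
    by (rule recf_eval_Comp1[OF recf_eval_Proj recf_eval.Succ]) simp_all
  with Suc show ?case by (auto intro: recf_eval.Prec_Suc)
qed

lemma recf_eval_mult: "recf_eval recf_mult [n, x] (n * x)"
  unfolding recf_mult_def
proof (induction n)
  case 0
  show ?case using recf_eval.Prec_0[OF recf_eval.Zero] by simp
next
  case (Suc n)
  have "recf_eval (Comp recf_add [Proj 1, Proj 2]) [n, n * x, x] (n * x + x)"
    by (rule recf_eval_Comp2[OF recf_eval_Proj recf_eval_Proj recf_eval_add]) simp_all
  with Suc have "recf_eval (Prec Zero (Comp recf_add [Proj 1, Proj 2])) [Suc n, x] (n * x + x)"
    by (rule recf_eval.Prec_Suc)
  then show ?case by (simp add: add.commute)
qed

lemma recf_eval_power: "recf_eval recf_power [n, x] (x ^ n)"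
  unfolding recf_power_def
proof (induction n)
  case 0
  have "recf_eval (Comp Succ [Zero]) [x] (Suc 0)" by (rule recf_eval_Comp1[OF recf_eval.Zero recf_eval.Succ])
  then show ?case using recf_eval.Prec_0 by fastforce
next
  case (Suc n)
  have "recf_eval (Comp recf_mult [Proj 1, Proj 2]) [n, x ^ n, x] (x ^ n * x)"
    by (rule recf_eval_Comp2[OF recf_eval_Proj recf_eval_Proj recf_eval_mult]) simp_all
  with Suc have "recf_eval (Prec (Comp Succ [Zero]) (Comp recf_mult [Proj 1, Proj 2])) [Suc n, x] (x ^ n * x)"
    by (rule recf_eval.Prec_Suc)
  then show ?case by (simp add: mult.commute)
qed

lemma computable2_args: "computable2 (\<lambda>a b. a)" "computable2 (\<lambda>a b. b)"
proof -
  have "recf_eval (Proj 0) [a, b] a" "recf_eval (Proj 1) [a, b] b" for a b by (rule recf_eval_Proj; simp)+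
  then show "computable2 (\<lambda>a b. a)" "computable2 (\<lambda>a b. b)" unfolding computable2_def by blast+
qed

lemma computable2_Suc: "computable2 f \<Longrightarrow> computable2 (\<lambda>a b. Suc (f a b))"
  unfolding computable2_def by (meson recf_eval_Comp1 recf_eval.Succ)

lemma computable2_const: "computable2 (\<lambda>a b. n)"
proof (induction n)
  case 0
  show ?case unfolding computable2_def using recf_eval.Zero by blast
qed (rule computable2_Suc)

lemma computable2_arith:
  assumes f: "computable2 f" and g: "computable2 g"
  shows "computable2 (\<lambda>a b. f a b + g a b)" "computable2 (\<lambda>a b. f a b * g a b)"
    "computable2 (\<lambda>a b. f a b ^ g a b)"
proof -
  obtain p q where p: "\<And>a b. recf_eval p [a, b] (f a b)" and q: "\<And>a b. recf_eval q [a, b] (g a b)"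
    using f g unfolding computable2_def by blast
  show "computable2 (\<lambda>a b. f a b + g a b)" unfolding computable2_def
    using recf_eval_Comp2[OF p q recf_eval_add] by blast
  show "computable2 (\<lambda>a b. f a b * g a b)" unfolding computable2_def
    using recf_eval_Comp2[OF p q recf_eval_mult] by blast
  show "computable2 (\<lambda>a b. f a b ^ g a b)" unfolding computable2_def
    using recf_eval_Comp2[OF q p recf_eval_power] by blast
qed

text \<open>The sum of the codes dominates both, so a single c serves both substitutions. Each
  constant is treated with arbitrary computable arguments because the definitions are
  nested.\<close>

lemma computable2_factor_radius: "computable2 (\<lambda>a b. factor_radius (size_bound (a + b)) + 1)"
proof -
  note arith = computable2_args computable2_const computable2_arith
  have base_radius: "computable2 (\<lambda>a b. base_radius (f a b))" if "computable2 f" for f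
    unfolding base_radius_def by (intro arith that)
  have support_radius: "computable2 (\<lambda>a b. support_radius (f a b) (g a b))" if "computable2 f" "computable2 g" for f g
    unfolding support_radius_def by (intro arith that)
  have pattern_bound: "computable2 (\<lambda>a b. pattern_bound (f a b) (g a b))" if "computable2 f" "computable2 g" for f g
    unfolding pattern_bound_def by (intro arith that)
  have recurrence_level: "computable2 (\<lambda>a b. recurrence_level (f a b) (g a b))" if "computable2 f" "computable2 g" for f g
    unfolding recurrence_level_def by (intro arith pattern_bound that)
  have recurrence_radius: "computable2 (\<lambda>a b. recurrence_radius (f a b) (g a b))" if "computable2 f" "computable2 g" for f g
    unfolding recurrence_radius_def by (intro arith support_radius recurrence_level that)
  have witness_level: "computable2 (\<lambda>a b. witness_level (f a b) (g a b))" if "computable2 f" "computable2 g" for f g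
    unfolding witness_level_def by (intro arith pattern_bound recurrence_radius base_radius that)
  have witness_radius: "computable2 (\<lambda>a b. witness_radius (f a b) (g a b))" if "computable2 f" "computable2 g" for f g
    unfolding witness_radius_def by (intro arith witness_level support_radius recurrence_radius base_radius that)
  have recog_radius: "computable2 (\<lambda>a b. recog_radius (f a b) (g a b))" if "computable2 f" "computable2 g" for f g
    unfolding recog_radius_def by (intro arith witness_radius recurrence_radius that)
  have injectivity_radius: "computable2 (\<lambda>a b. injectivity_radius (f a b))" if "computable2 f" for f
    unfolding injectivity_radius_def by (intro arith recog_radius support_radius that)
  have factor_radius: "computable2 (\<lambda>a b. factor_radius (f a b))" if "computable2 f" for f
    unfolding factor_radius_def by (intro arith injectivity_radius that)
  have size_bound: "computable2 (\<lambda>a b. size_bound (f a b))" if "computable2 f" for f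
    unfolding size_bound_def gap_bound_def by (intro arith that)
  show ?thesis by (intro arith factor_radius size_bound)
qed

theorem theorem2:
  shows "\<exists>algorithm. \<forall>\<zeta>\<^sub>1 \<zeta>\<^sub>2.
    constant_shape_substitution \<zeta>\<^sub>1 \<and> constant_shape_substitution \<zeta>\<^sub>2 \<and>
    folner \<zeta>\<^sub>1 \<and> folner \<zeta>\<^sub>2 \<and>
    primitive \<zeta>\<^sub>1 \<and> primitive \<zeta>\<^sub>2 \<and>
    aperiodic \<zeta>\<^sub>1 \<and> aperiodic \<zeta>\<^sub>2 \<and>
    expansion \<zeta>\<^sub>1 = expansion \<zeta>\<^sub>2 \<longrightarrow>
    (\<exists>R. recf_eval algorithm [subst_code \<zeta>\<^sub>1, subst_code \<zeta>\<^sub>2] R \<and>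
      (\<forall>\<phi>. subst_factor_map \<zeta>\<^sub>1 \<zeta>\<^sub>2 \<phi> \<longrightarrow>
        (\<exists>j \<in> Zd (sdim \<zeta>\<^sub>1). \<exists>\<psi>. subst_factor_map \<zeta>\<^sub>1 \<zeta>\<^sub>2 \<psi> \<and>
          subst_radius \<zeta>\<^sub>1 \<zeta>\<^sub>2 \<psi> < R \<and>
          (\<forall>x \<in> subst_shift \<zeta>\<^sub>1. \<phi> x = shift (sdim \<zeta>\<^sub>1) j (\<psi> x)))))"
proof -
  \<comment> \<open>p is fixed before the substitutions are and halts on every input; the final + 1
    makes the radius bound strict.\<close>
  obtain p where p: "\<And>a b. recf_eval p [a, b] (factor_radius (size_bound (a + b)) + 1)"
    using computable2_factor_radius unfolding computable2_def by blast
  have bound: "\<exists>j \<in> Zd (sdim \<zeta>1). \<exists>\<psi>. subst_factor_map \<zeta>1 \<zeta>2 \<psi> \<and>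
      subst_radius \<zeta>1 \<zeta>2 \<psi> < factor_radius (size_bound (subst_code \<zeta>1 + subst_code \<zeta>2)) + 1 \<and>
      (\<forall>x \<in> subst_shift \<zeta>1. \<phi> x = shift (sdim \<zeta>1) j (\<psi> x))"
    if cs: "constant_shape_substitution \<zeta>1" "constant_shape_substitution \<zeta>2"
      and prim: "primitive \<zeta>1" "primitive \<zeta>2" and aper: "aperiodic \<zeta>2"
      and L: "expansion \<zeta>1 = expansion \<zeta>2" and \<phi>: "subst_factor_map \<zeta>1 \<zeta>2 \<phi>" for \<zeta>1 \<zeta>2 \<phi>
  proof -
    define c where "c = size_bound (subst_code \<zeta>1 + subst_code \<zeta>2)"
    have cs1: "csubst (sdim \<zeta>1) (expansion \<zeta>1) c \<zeta>1" unfolding c_def by (rule csubstI[OF cs(1)]) simp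
    have cs2: "csubst (sdim \<zeta>1) (expansion \<zeta>1) c \<zeta>2" unfolding c_def L by (rule csubstI[OF cs(2)]) simp
    interpret subst_pair "sdim \<zeta>1" "expansion \<zeta>1" c \<zeta>1 \<zeta>2
      by (intro subst_pair.intro prim_subst.intro aper_subst.intro prim_subst_axioms.intro aper_subst_axioms.intro
          cs1 cs2 prim aper)
    obtain \<psi> where \<psi>: "fmap \<psi>" "coded \<psi> (factor_radius c)" "shift_equiv \<phi> \<psi>"
      using ex_equiv_bounded[of \<phi>] \<phi> unfolding fmap_def by blast
    obtain j where j: "j \<in> Zd (sdim \<zeta>1)" "\<forall>x\<in>subst_shift \<zeta>1. \<phi> x = shift (sdim \<zeta>1) j (\<psi> x)"
      using \<psi>(3) unfolding shift_equiv_def by blast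
    have "subst_radius \<zeta>1 \<zeta>2 \<psi> < factor_radius c + 1" using coded_radius[OF \<psi>(1,2)] by linarith
    with j \<psi>(1) show ?thesis unfolding fmap_def c_def by blast
  qed
  show ?thesis
  proof (intro exI[of _ p] allI impI, elim conjE, intro exI conjI allI impI)
    fix \<zeta>1 \<zeta>2 :: substitution and \<phi>
    assume "constant_shape_substitution \<zeta>1" "constant_shape_substitution \<zeta>2" "primitive \<zeta>1" "primitive \<zeta>2"
      "aperiodic \<zeta>2" "expansion \<zeta>1 = expansion \<zeta>2" "subst_factor_map \<zeta>1 \<zeta>2 \<phi>"
    then show "\<exists>j \<in> Zd (sdim \<zeta>1). \<exists>\<psi>. subst_factor_map \<zeta>1 \<zeta>2 \<psi> \<and>
      subst_radius \<zeta>1 \<zeta>2 \<psi> < factor_radius (size_bound (subst_code \<zeta>1 + subst_code \<zeta>2)) + 1 \<and>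
      (\<forall>x \<in> subst_shift \<zeta>1. \<phi> x = shift (sdim \<zeta>1) j (\<psi> x))"
      by (rule bound)
  qed (rule p)
qed

end
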